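(* The Gabrielov numbers of a virtual quadrangle complete intersection singularity coincide with the Dolgachev numbers of the dual one, and vice versa. That is, for each virtual singularity $X$ among the eight singularities $J'_{2,-1}$, $K'_{1,-1}$, $K^\flat_{1,-1}$, $L_{1,-1}$, $L^\sharp_{1,-1}$, $M_{1,-1}$, $M^\sharp_{1,-1}$, $I_{1,-1}$, with dual $X^{\rm dual}$, the Gabrielov numbers $\gamma_1,\gamma_2;\gamma_3,\gamma_4$ of $X$ are equal to the Dolgachev numbers $\alpha_1,\alpha_2;\alpha_3,\alpha_4$ of $X^{\rm dual}$, and the Dolgachev numbers of $X$ are equal to the Gabrielov numbers of $X^{\rm dual}$.
   Context: Virtual singularities. The eight virtual singularities are given by pairs $(h_1,h_2)$ of polynomials in $\mathbb{C}[x,y,z,w]$. For each of them $h_2$ has two associated parts $h_{2,1},h_{2,2}$ (the sums of the terms of $h_2$ lying on the two faces, not containing the origin, of the convex hull of $\{0\}$ and the exponents of $h_2$), and $(h_1,h_{2,i})$ is weighted homogeneous with a system of weights (weights of $x,y,z,w$; degrees of $h_1,h_{2,i}$): - $J'_{2,-1}$: $h_1=xy-w^2$, $h_2=-x^2z+yw+z^2+xw^2$; $h_{2,1}=-x^2z+z^2+xw^2$, weights $(2,4,4,3;6,8)$; $h_{2,2}=z^2+xw^2+yw$, weights $(2,6,5,4;8,10)$. - $K'_{1,-1}$: $h_1=xy-w^2$, $h_2=-x^2w+z^2+yz+xw^2$; $h_{2,1}=-x^2w+z^2+xw^2$, weights $(2,2,3,2;4,6)$; $h_{2,2}=z^2+xw^2+yz$,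 weights $(2,4,4,3;6,8)$. - $K^\flat_{1,-1}$: $h_1=xy-w^2$, $h_2=-x^2w+z^2+yz+x^2z$; $h_{2,1}=-x^2w+x^2z+yz$, weights $(2,4,3,3;6,7)$; $h_{2,2}=x^2z+yz+z^2$, weights $(2,4,4,3;6,8)$. - $L_{1,-1}$: $h_1=xy-zw$, $h_2=-x^2w+z^2+yw+xw^2$; $h_{2,1}=-x^2w+z^2+xw^2$, weights $(2,3,3,2;5,6)$; $h_{2,2}=z^2+xw^2+yw$, weights $(2,5,4,3;7,8)$. - $L^\sharp_{1,-1}$: $h_1=xy-zw$, $h_2=-x^2w+z^2+yw+x^2z$; $h_{2,1}=-x^2w+x^2z+yw$, weights $(2,4,3,3;6,7)$; $h_{2,2}=x^2z+yw+z^2$, weights $(2,5,4,3;7,8)$. - $M_{1,-1}$: $h_1=xy-w^2$, $h_2=-yz+xw+z^3+w^2$; $h_{2,1}=xw+z^3+w^2$, weights $(3,3,2,3;6,6)$; $h_{2,2}=z^3+w^2-yz$, weights $(2,4,2,3;6,6)$. - $M^\sharp_{1,-1}$: $h_1=xy-zw$, $h_2=-z^2+yw+x^2w+yz$; $h_{2,1}=-z^2+x^2w+yz$, weights $(2,3,3,2;5,6)$; $h_{2,2}=x^2w+yz+yw$, weights $(2,4,3,3;6,7)$. - $I_{1,-1}$: $h_1=xy-w^3$, $h_2=-xw+z^2+yz+xz$; $h_{2,1}=-xw+yz+xz$, weights $(3,3,2,2;6,5)$; $h_{2,2}=yz+xz+z^2$, weights $(3,3,3,2;6,6)$. Duality.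 The duality (obtained from Berglund–Hübsch transposition of associated $4\times4$ exponent matrices) is the involution which interchanges $K^\flat_{1,-1}$ and $L_{1,-1}$, and under which each of $J'_{2,-1}$, $K'_{1,-1}$, $L^\sharp_{1,-1}$, $M_{1,-1}$, $M^\sharp_{1,-1}$, $I_{1,-1}$ is dual to itself. Dolgachev numbers. For $i=1,2$ let $V_i=\{(x,y,z,w)\in\mathbb{C}^4 : h_1=h_{2,i}=0\}$, with the $\mathbb{C}^*$-action on $V_i$ (away from the origin) given by the system of weights of $(h_1,h_{2,i})$. An orbit is exceptional if it has non-trivial isotropy group. Three cases are distinguished: (A) $V_i$ contains a linear subspace $L$ of $\mathbb{C}^4$ of codimension 2 obtained by setting two coordinates to be zero. (B) $V_i=U\cup U'$ where $(h_1,h_{2,i})=(g_1(x,y,w),z\,g_2(x,y,z))$, $U=\{g_1=z=0\}$, $U'=\{g_1=g_2=0\}$. (C) $V_i$ is not of the form (A) or (B). The principal orbits are: in case (A) the exceptional orbits not contained in $L$; in case (B) the exceptional orbits not contained in $U$; in case (C) the exceptional orbits which do not coincide with the singular locus of $V_i$ (outside the origin). In all cases there are exactly two principal orbits. The Dolgachev numbers of the virtual singularity are $\alpha_1,\alpha_2;\alpha_3,\alpha_4$, where $\alpha_1,\alpha_2$ are the orders of the isotropy groups of the two principal orbits of $V_1$ and $\alpha_3,\alpha_4$ those of $V_2$. Gabrielov numbers. For this definition only, in the three cases $J'_{2,-1}$, $K'_{1,-1}$, $K^\flat_{1,-1}$ the first polynomial is replaced by $h_1:=xy-w^2-z^2$.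 Let $(X',0)\subset(\mathbb{C}^4,0)$ be defined by $h_1=0$, $h_2-zw=0$. The Gabrielov numbers are the numbers $\gamma_1,\gamma_2;\gamma_3,\gamma_4$ such that $(X',0)$ is $\mathcal{K}$-equivalent (contact equivalent: the defining ideals correspond under a biholomorphic coordinate change of $(\mathbb{C}^4,0)$) to the singularity at $0$ defined by $xy-z^{\gamma_1}-w^{\gamma_2}=0$, $x^{\gamma_3}+y^{\gamma_4}-zw=0$. Both sets of numbers are regarded as two pairs, up to interchanging the two numbers within a pair and interchanging the two pairs. *)

theory Defs
  imports "HOL-Analysis.Analysis" "HOL-Algebra.Group_Action"
    "HOL-Computational_Algebra.Polynomial"
begin

section \<open>The eight virtual singularities\<close>

datatype virtual_singularity =
  J2' | K1' | K1_flat | L1 | L1_sharp | M1 | M1_sharp | I1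

text \<open>Polynomials in $x,y,z,w$ are given as polynomial functions of four complex variables;
  \<open>on_C4\<close> turns them into functions of a point of $\mathbb{C}^4$ with coordinates
  \<open>p$1, p$2, p$3, p$4\<close>.\<close>

type_synonym fun4 = "complex \<Rightarrow> complex \<Rightarrow> complex \<Rightarrow> complex \<Rightarrow> complex"

definition on_C4 :: "fun4 \<Rightarrow> complex^4 \<Rightarrow> complex" where
  "on_C4 h p = h (p$1) (p$2) (p$3) (p$4)"

fun h1 :: "virtual_singularity \<Rightarrow> fun4" where
  "h1 J2'      x y z w = x*y - w^2"
| "h1 K1'      x y z w = x*y - w^2"
| "h1 K1_flat  x y z w = x*y - w^2"
| "h1 L1       x y z w = x*y - z*w"
| "h1 L1_sharp x y z w = x*y - z*w"
| "h1 M1       x y z w = x*y - w^2"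
| "h1 M1_sharp x y z w = x*y - z*w"
| "h1 I1       x y z w = x*y - w^3"

fun h2 :: "virtual_singularity \<Rightarrow> fun4" where
  "h2 J2'      x y z w = -(x^2)*z + y*w + z^2 + x*w^2"
| "h2 K1'      x y z w = -(x^2)*w + z^2 + y*z + x*w^2"
| "h2 K1_flat  x y z w = -(x^2)*w + z^2 + y*z + x^2*z"
| "h2 L1       x y z w = -(x^2)*w + z^2 + y*w + x*w^2"
| "h2 L1_sharp x y z w = -(x^2)*w + z^2 + y*w + x^2*z"
| "h2 M1       x y z w = - y*z + x*w + z^3 + w^2"
| "h2 M1_sharp x y z w = -(z^2) + y*w + x^2*w + y*z"
| "h2 I1       x y z w = - x*w + z^2 + y*z + x*z"

text \<open>The two parts of \<open>h2\<close>, with the weights of $x,y,z,w$ and the degrees of \<open>h1\<close> and of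
  the part.\<close>

fun h21 :: "virtual_singularity \<Rightarrow> fun4" where
  "h21 J2'      x y z w = -(x^2)*z + z^2 + x*w^2"
| "h21 K1'      x y z w = -(x^2)*w + z^2 + x*w^2"
| "h21 K1_flat  x y z w = -(x^2)*w + x^2*z + y*z"
| "h21 L1       x y z w = -(x^2)*w + z^2 + x*w^2"
| "h21 L1_sharp x y z w = -(x^2)*w + x^2*z + y*w"
| "h21 M1       x y z w = x*w + z^3 + w^2"
| "h21 M1_sharp x y z w = -(z^2) + x^2*w + y*z"
| "h21 I1       x y z w = - x*w + y*z + x*z"

fun h22 :: "virtual_singularity \<Rightarrow> fun4" where
  "h22 J2'      x y z w = z^2 + x*w^2 + y*w"
| "h22 K1'      x y z w = z^2 + x*w^2 + y*z"
| "h22 K1_flat  x y z w = x^2*z + y*z + z^2"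
| "h22 L1       x y z w = z^2 + x*w^2 + y*w"
| "h22 L1_sharp x y z w = x^2*z + y*w + z^2"
| "h22 M1       x y z w = z^3 + w^2 - y*z"
| "h22 M1_sharp x y z w = x^2*w + y*z + y*w"
| "h22 I1       x y z w = y*z + x*z + z^2"

fun weights1 :: "virtual_singularity \<Rightarrow> nat^4" where
  "weights1 J2'      = vector [2,4,4,3]"
| "weights1 K1'      = vector [2,2,3,2]"
| "weights1 K1_flat  = vector [2,4,3,3]"
| "weights1 L1       = vector [2,3,3,2]"
| "weights1 L1_sharp = vector [2,4,3,3]"
| "weights1 M1       = vector [3,3,2,3]"
| "weights1 M1_sharp = vector [2,3,3,2]"
| "weights1 I1       = vector [3,3,2,2]"

fun weights2 :: "virtual_singularity \<Rightarrow> nat^4" where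
  "weights2 J2'      = vector [2,6,5,4]"
| "weights2 K1'      = vector [2,4,4,3]"
| "weights2 K1_flat  = vector [2,4,4,3]"
| "weights2 L1       = vector [2,5,4,3]"
| "weights2 L1_sharp = vector [2,5,4,3]"
| "weights2 M1       = vector [2,4,2,3]"
| "weights2 M1_sharp = vector [2,4,3,3]"
| "weights2 I1       = vector [3,3,3,2]"

fun degrees1 :: "virtual_singularity \<Rightarrow> nat \<times> nat" where
  "degrees1 J2'      = (6,8)"
| "degrees1 K1'      = (4,6)"
| "degrees1 K1_flat  = (6,7)"
| "degrees1 L1       = (5,6)"
| "degrees1 L1_sharp = (6,7)"
| "degrees1 M1       = (6,6)"
| "degrees1 M1_sharp = (5,6)"
| "degrees1 I1       = (6,5)"

fun degrees2 :: "virtual_singularity \<Rightarrow> nat \<times> nat" where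
  "degrees2 J2'      = (8,10)"
| "degrees2 K1'      = (6,8)"
| "degrees2 K1_flat  = (6,8)"
| "degrees2 L1       = (7,8)"
| "degrees2 L1_sharp = (7,8)"
| "degrees2 M1       = (6,6)"
| "degrees2 M1_sharp = (6,7)"
| "degrees2 I1       = (6,6)"

fun dual :: "virtual_singularity \<Rightarrow> virtual_singularity" where
  "dual K1_flat = L1"
| "dual L1 = K1_flat"
| "dual J2' = J2'"
| "dual K1' = K1'"
| "dual L1_sharp = L1_sharp"
| "dual M1 = M1"
| "dual M1_sharp = M1_sharp"
| "dual I1 = I1"

section \<open>Dolgachev numbers\<close>

definition Cstar :: "complex monoid" where
  "Cstar = \<lparr>carrier = - {0}, monoid.mult = (*), one = 1\<rparr>"

definition act :: "nat^4 \<Rightarrow> complex \<Rightarrow> complex^4 \<Rightarrow> complex^4" where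
  "act wt c p = (\<chi> i. c ^ (wt$i) * p$i)"

lemma vector4 [simp]:
  fixes a b c d :: "'a::zero"
  shows "(vector [a,b,c,d] :: 'a^4)$1 = a" "(vector [a,b,c,d] :: 'a^4)$2 = b"
    "(vector [a,b,c,d] :: 'a^4)$3 = c" "(vector [a,b,c,d] :: 'a^4)$4 = d"
  unfolding vector_def by auto

lemma weighted_homogeneous:
  shows "on_C4 (h1 X) (act (weights1 X) c p) = c ^ fst (degrees1 X) * on_C4 (h1 X) p"
    and "on_C4 (h21 X) (act (weights1 X) c p) = c ^ snd (degrees1 X) * on_C4 (h21 X) p"
    and "on_C4 (h1 X) (act (weights2 X) c p) = c ^ fst (degrees2 X) * on_C4 (h1 X) p"
    and "on_C4 (h22 X) (act (weights2 X) c p) = c ^ snd (degrees2 X) * on_C4 (h22 X) p"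
  by (cases X; simp add: on_C4_def act_def algebra_simps power2_eq_square power3_eq_cube
      eval_nat_numeral)+

text \<open>With respect to each of the two systems of weights, the part of \<open>h2\<close> consists of the terms
  of highest weight (the remaining term has weight one less); this is the sense in which
  the parts belong to two faces of the Newton polytope.\<close>

lemma part_is_leading:
  shows "on_C4 (h2 X) (act (weights1 X) c p) = c ^ snd (degrees1 X) * on_C4 (h21 X) p
      + c ^ (snd (degrees1 X) - 1) * (on_C4 (h2 X) p - on_C4 (h21 X) p)"
    and "on_C4 (h2 X) (act (weights2 X) c p) = c ^ snd (degrees2 X) * on_C4 (h22 X) p
      + c ^ (snd (degrees2 X) - 1) * (on_C4 (h2 X) p - on_C4 (h22 X) p)"
  by (cases X; simp add: on_C4_def act_def algebra_simps power2_eq_square power3_eq_cube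
      eval_nat_numeral)+

definition zero_set :: "fun4 \<Rightarrow> fun4 \<Rightarrow> (complex^4) set" where
  "zero_set f g = {p. on_C4 f p = 0 \<and> on_C4 g p = 0}"

text \<open>The isotropy group of an orbit is the isotropy group of any of its points; these all
  coincide since the group is commutative, so that the intersection is that common value.\<close>

definition isotropy :: "nat^4 \<Rightarrow> (complex^4) set \<Rightarrow> complex set" where
  "isotropy wt Orb = (\<Inter>p\<in>Orb. stabilizer Cstar (act wt) p)"

definition exceptional_orbits :: "nat^4 \<Rightarrow> (complex^4) set \<Rightarrow> (complex^4) set set" where
  "exceptional_orbits wt V =
     {Orb \<in> orbits Cstar (V - {0}) (act wt). isotropy wt Orb \<noteq> {1}}"

definition gradient :: "fun4 \<Rightarrow> complex^4 \<Rightarrow> complex^4" where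
  "gradient f p = (\<chi> i. deriv (\<lambda>t. on_C4 f (\<chi> j. if j = i then t else p$j)) (p$i))"

definition singular_locus :: "fun4 \<Rightarrow> fun4 \<Rightarrow> (complex^4) set" where
  "singular_locus f g =
     {p \<in> zero_set f g. rank (vector [gradient f p, gradient g p] :: complex^4^2) < 2}"

definition case_A :: "(complex^4) set \<Rightarrow> (complex^4) set \<Rightarrow> bool" where
  "case_A V L \<longleftrightarrow> L \<subseteq> V \<and> (\<exists>i j. i \<noteq> j \<and> L = {p. p$i = 0 \<and> p$j = 0})"

text \<open>An element of \<open>complex poly poly poly\<close> is a polynomial in the third variable whose
  coefficients are polynomials in the second one with coefficients in $\mathbb{C}[x]$.\<close>

definition eval3 :: "complex poly poly poly \<Rightarrow> complex \<Rightarrow> complex \<Rightarrow> complex \<Rightarrow> complex" where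
  "eval3 g a b c = poly (poly (poly g [:[:c:]:]) [:b:]) a"

definition case_B :: "fun4 \<Rightarrow> fun4 \<Rightarrow> (complex^4) set \<Rightarrow> bool" where
  "case_B f g U \<longleftrightarrow> (\<exists>g1 g2.
     (\<forall>x y z w. f x y z w = eval3 g1 x y w \<and> g x y z w = z * eval3 g2 x y z) \<and>
     U = {p. eval3 g1 (p$1) (p$2) (p$4) = 0 \<and> p$3 = 0})"

definition principal_orbits :: "nat^4 \<Rightarrow> fun4 \<Rightarrow> fun4 \<Rightarrow> (complex^4) set set" where
  "principal_orbits wt f g =
    (let V = zero_set f g; E = exceptional_orbits wt V in
     if \<exists>L. case_A V L then {Orb \<in> E. \<forall>L. case_A V L \<longrightarrow> \<not> Orb \<subseteq> L}
     else if \<exists>U. case_B f g U then {Orb \<in> E. \<forall>U. case_B f g U \<longrightarrow> \<not> Orb \<subseteq> U}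
     else {Orb \<in> E. Orb \<noteq> singular_locus f g - {0}})"

text \<open>The values $\alpha_1,\alpha_2;\alpha_3,\alpha_4$ up to interchanging numbers within the pairs
  and interchanging the pairs.\<close>

type_synonym two_pairs = "nat multiset multiset"

definition two_pairs :: "nat \<Rightarrow> nat \<Rightarrow> nat \<Rightarrow> nat \<Rightarrow> two_pairs" where
  "two_pairs a b c d = {#{#a, b#}, {#c, d#}#}"

definition isotropy_orders :: "nat^4 \<Rightarrow> fun4 \<Rightarrow> fun4 \<Rightarrow> nat multiset" where
  "isotropy_orders wt f g =
     image_mset (\<lambda>Orb. card (isotropy wt Orb)) (mset_set (principal_orbits wt f g))"

definition dolgachev_numbers :: "virtual_singularity \<Rightarrow> two_pairs" where
  "dolgachev_numbers X =
     {# isotropy_orders (weights1 X) (h1 X) (h21 X),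
        isotropy_orders (weights2 X) (h1 X) (h22 X) #}"

section \<open>Contact equivalence and Gabrielov numbers\<close>

definition holo_on :: "(complex^'n) set \<Rightarrow> (complex^'n \<Rightarrow> complex) \<Rightarrow> bool" where
  "holo_on S f \<longleftrightarrow> (\<forall>p\<in>S. \<exists>D. (f has_derivative D) (at p) \<and> (\<forall>c v. D (c *s v) = c * D v))"

definition holo_map_on :: "(complex^'n) set \<Rightarrow> (complex^'n \<Rightarrow> complex^'m) \<Rightarrow> bool" where
  "holo_map_on S \<phi> \<longleftrightarrow> (\<forall>i. holo_on S (\<lambda>p. \<phi> p $ i))"

definition holo_at_0 :: "(complex^'n \<Rightarrow> complex) \<Rightarrow> bool" where
  "holo_at_0 f \<longleftrightarrow> (\<exists>S. open S \<and> 0 \<in> S \<and> holo_on S f)"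

text \<open>The ideal generated by two germs at $0$ in the ring of germs of holomorphic functions,
  represented by the set of all representatives of its elements.\<close>

definition germ_ideal ::
  "(complex^'n \<Rightarrow> complex) \<Rightarrow> (complex^'n \<Rightarrow> complex) \<Rightarrow> (complex^'n \<Rightarrow> complex) set" where
  "germ_ideal f1 f2 = {g. \<exists>a b. holo_at_0 a \<and> holo_at_0 b \<and>
     (\<forall>\<^sub>F p in nhds 0. g p = a p * f1 p + b p * f2 p)}"

definition coordinate_change_at_0 :: "(complex^'n \<Rightarrow> complex^'n) \<Rightarrow> bool" where
  "coordinate_change_at_0 \<phi> \<longleftrightarrow> \<phi> 0 = 0 \<and>
     (\<exists>S T \<psi>. open S \<and> 0 \<in> S \<and> open T \<and> homeomorphism S T \<phi> \<psi> \<and>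
        holo_map_on S \<phi> \<and> holo_map_on T \<psi>)"

definition K_equivalent ::
  "(complex^'n \<Rightarrow> complex) \<times> (complex^'n \<Rightarrow> complex) \<Rightarrow>
   (complex^'n \<Rightarrow> complex) \<times> (complex^'n \<Rightarrow> complex) \<Rightarrow> bool" where
  "K_equivalent F G \<longleftrightarrow> (\<exists>\<phi>. coordinate_change_at_0 \<phi> \<and>
     (\<forall>g. g \<circ> \<phi> \<in> germ_ideal (fst F) (snd F) \<longleftrightarrow> g \<in> germ_ideal (fst G) (snd G)))"

definition h1_gab :: "virtual_singularity \<Rightarrow> fun4" where
  "h1_gab X x y z w = (if X \<in> {J2', K1', K1_flat} then x*y - w^2 - z^2 else h1 X x y z w)"

definition X'_eqs :: "virtual_singularity \<Rightarrow> (complex^4 \<Rightarrow> complex) \<times> (complex^4 \<Rightarrow> complex)" where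
  "X'_eqs X = (on_C4 (h1_gab X), on_C4 (\<lambda>x y z w. h2 X x y z w - z*w))"

definition normal_form ::
  "nat \<Rightarrow> nat \<Rightarrow> nat \<Rightarrow> nat \<Rightarrow> (complex^4 \<Rightarrow> complex) \<times> (complex^4 \<Rightarrow> complex)" where
  "normal_form a b c d =
     (on_C4 (\<lambda>x y z w. x*y - z^a - w^b), on_C4 (\<lambda>x y z w. x^c + y^d - z*w))"

definition gabrielov_numbers :: "virtual_singularity \<Rightarrow> two_pairs" where
  "gabrielov_numbers X =
     (THE N. \<exists>a b c d. N = two_pairs a b c d \<and> K_equivalent (X'_eqs X) (normal_form a b c d))"

end

theory Submission
  imports Defs "HOL-Complex_Analysis.Cauchy_Integral_Formula"
begin

text \<open>
  \<^emph>\<open>Gabrielov numbers.\<close> Give \<open>x\<close>, \<open>y\<close>, \<open>z\<close>, \<open>w\<close> weights and consider a pair of equations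
  \<open>x*y + \<dots> = 0\<close>, \<open>z*w + \<dots> = 0\<close> whose other terms exceed the weight of \<open>x*y\<close> resp. \<open>z*w\<close>. In
  the first equation a term divisible by \<open>x\<close> or \<open>y\<close> is removed by a shift of \<open>y\<close> or \<open>x\<close>, and a term
  divisible by \<open>z*w\<close> by subtracting a multiple of the second equation; the second equation is
  treated in the same way. Each round increases the weight of the unwanted terms, so that eventually
  they are absorbed by the powers of \<open>z\<close>, \<open>w\<close> resp. \<open>x\<close>, \<open>y\<close>, which appear with unit factors. Taking
  logarithms, these units are scaled away by solving a linear system, which is regular if
  \<open>(a + b) * (c + d) \<noteq> a * b * c * d\<close>. For each of the eight singularities an explicit polynomial
  substitution leads to this situation.

  Conversely, the contact class determines the exponents. Those that are at least 3 are the maximal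
  orders to which the equations and the \<open>2\<times>2\<close> minors of their Jacobian matrix vanish along
  sequences approaching \<open>0\<close> in a coordinate direction, and in no other direction is order 3 possible.
  The derivative of a coordinate change therefore permutes these directions up to scalars, and it
  respects the two pairs, since the quadratic parts of the equations vanish on the sum of two such
  directions unless they belong to the same pair.

  \<^emph>\<open>Dolgachev numbers.\<close> A point with non-trivial isotropy has a zero among any two coordinates of
  coprime weights, which leaves only finitely many orbits on each \<open>V\<^sub>i\<close>.
\<close>

section \<open>Holomorphic germs\<close>

text \<open>Every round of the reduction stays within polynomials, and a monomial of large weight is
  divisible by a prescribed power of some coordinate. Hence finitely many rounds suffice and no
  power series has to converge. Analytic germs enter only at the end, through unit factors, a square
  root and logarithms. The linear system for the logarithms has determinant
  \<open>1 - (1/a + 1/b) * (1/c + 1/d)\<close>, which for exponents at least 2 vanishes only if all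
  four are 2.

  For uniqueness the equations alone would single out no direction, since they vanish identically
  along curves inside the singularity; the minors are there to exclude such curves. Order 2 carries
  no information, because equations and minors vanish to order 2 along every sequence considered. So
  exponent 2 is never detected directly: it is what remains for the exponents that are not at least
  3. Sequences with growth bounds replace arcs because they survive any differentiable map and any
  multiplication by a bounded germ.\<close>

lemma norm_axis_le: "norm (axis i x :: 'b::real_normed_vector^'n) \<le> norm x"
proof -
  have "norm (axis i x :: 'b^'n) \<le> (\<Sum>j\<in>UNIV. norm ((axis i x :: 'b^'n) $ j))"
    by (simp add: norm_vec_def L2_set_le_sum)
  also have "\<dots> = (\<Sum>j\<in>UNIV. if j = i then norm x else 0)"
    by (rule sum.cong) (auto simp: axis_def)
  finally show ?thesis by simp
qed

text \<open>\<open>f\<close> is the sum of its coordinates, each embedded by the bounded linear map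
  \<open>axis i\<close>. The Euclidean basis of \<open>complex^'n\<close> is a real one and would
  split every complex coordinate further.\<close>

lemma has_derivative_vec:
  fixes f :: "'a::real_normed_vector \<Rightarrow> 'b::real_normed_vector ^ 'n"
  assumes "\<And>i. ((\<lambda>x. f x $ i) has_derivative (\<lambda>h. D h $ i)) (at x)"
  shows "(f has_derivative D) (at x)"
proof -
  have bl: "bounded_linear (axis i :: 'b \<Rightarrow> 'b^'n)" for i
  proof (rule bounded_linear_intro[where K=1])
    fix x y :: 'b and r :: real
    show "axis i (x + y) = (axis i x + axis i y :: 'b^'n)"
      by (simp add: vec_eq_iff axis_def)
    show "axis i (r *\<^sub>R x) = (r *\<^sub>R axis i x :: 'b^'n)"
      by (simp add: vec_eq_iff axis_def)
    show "norm (axis i x :: 'b^'n) \<le> norm x * 1" using norm_axis_le[of i x] by simp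
  qed
  have e: "v = (\<Sum>i\<in>UNIV. axis i (v $ i))" for v :: "'b^'n"
    by (simp add: vec_eq_iff axis_def if_distrib cong: if_cong)
  have "((\<lambda>x. \<Sum>i\<in>UNIV. axis i (f x $ i) :: 'b^'n) has_derivative
      (\<lambda>h. \<Sum>i\<in>UNIV. axis i (D h $ i))) (at x)"
    by (intro has_derivative_sum bounded_linear.has_derivative[OF bl] assms)
  then show ?thesis by (simp flip: e)
qed

text \<open>The pointwise condition inside \<open>holo_on\<close>. With it a holomorphic germ
  becomes an \<open>eventually\<close> statement in \<open>nhds 0\<close>, so closure properties
  reduce to single points.\<close>

definition cdiff :: "(complex^'n \<Rightarrow> complex) \<Rightarrow> complex^'n \<Rightarrow> bool"
    where
  "cdiff f p \<longleftrightarrow> (\<exists>D. (f has_derivative D) (at p) \<and>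
      (\<forall>c v. D (c *s v) = c * D v))"

lemma holo_on_cdiff: "holo_on S f \<longleftrightarrow> (\<forall>p\<in>S. cdiff f p)"
  by (simp add: holo_on_def cdiff_def)

lemma holo_at_0_iff: "holo_at_0 f \<longleftrightarrow> (\<forall>\<^sub>F p in nhds 0. cdiff f p)"
  by (simp add: holo_at_0_def eventually_nhds holo_on_cdiff)

lemma cdiff_const [simp]: "cdiff (\<lambda>p. c) p"
  unfolding cdiff_def by (intro exI[of _ "\<lambda>_. 0"]) auto

lemma has_derivative_nth: "((\<lambda>p. p $ i) has_derivative (\<lambda>h. h $ i)) (at p)"
  by (rule bounded_linear_imp_has_derivative[OF bounded_linear_vec_nth])

lemma cdiff_nth [simp]: "cdiff (\<lambda>p. p $ i) p"
  unfolding cdiff_def by (intro exI[of _ "\<lambda>h. h $ i"]) (auto intro: has_derivative_nth)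

lemma cdiff_add: "cdiff f p \<Longrightarrow> cdiff g p \<Longrightarrow> cdiff (\<lambda>p. f p +
    g p) p"
proof -
  assume "cdiff f p" "cdiff g p"
  then obtain D E where "(f has_derivative D) (at p)" "\<forall>c v. D (c *s v) = c * D v"
    "(g has_derivative E) (at p)" "\<forall>c v. E (c *s v) = c * E v"
    unfolding cdiff_def by blast
  then show ?thesis unfolding cdiff_def
    by (intro exI[of _ "\<lambda>h. D h + E h"]) (auto intro: has_derivative_add simp:
        algebra_simps)
qed

lemma cdiff_mult: "cdiff f p \<Longrightarrow> cdiff g p \<Longrightarrow>
    cdiff (\<lambda>p. f p * g p) p"
proof -
  assume "cdiff f p" "cdiff g p"
  then obtain D E where "(f has_derivative D) (at p)" "\<forall>c v. D (c *s v) = c * D v"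
    "(g has_derivative E) (at p)" "\<forall>c v. E (c *s v) = c * E v"
    unfolding cdiff_def by blast
  moreover from this(1,3)
  have "((\<lambda>p. f p * g p) has_derivative (\<lambda>h. f p * E h + D h * g p)) (at p)"
    by (rule has_derivative_mult)
  ultimately show ?thesis unfolding cdiff_def
    by (intro exI[of _ "\<lambda>h. f p * E h + D h * g p"]) (simp add: algebra_simps)
qed

lemma cdiff_comp_field:
  "cdiff f p \<Longrightarrow> g field_differentiable (at (f p)) \<Longrightarrow>
      cdiff (\<lambda>p. g (f p)) p"
proof -
  assume f: "cdiff f p" and "g field_differentiable (at (f p))"
  then obtain g' where g: "(g has_derivative (*) g') (at (f p))"
    unfolding field_differentiable_def has_field_derivative_def by blast
  obtain D where "(f has_derivative D) (at p)" "\<forall>c v. D (c *s v) = c * D v"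
    using f unfolding cdiff_def by blast
  moreover from this(1) have "((\<lambda>p. g (f p)) has_derivative (\<lambda>h. g' * D h)) (at p)"
    by (rule has_derivative_compose) (rule g)
  ultimately show ?thesis unfolding cdiff_def
    by (intro exI[of _ "\<lambda>h. g' * D h"]) auto
qed

lemma cdiff_comp:
  fixes \<phi> :: "complex^'n \<Rightarrow> complex^'m"
  assumes "\<And>i. cdiff (\<lambda>p. \<phi> p $ i) p" "cdiff f (\<phi> p)"
  shows "cdiff (\<lambda>p. f (\<phi> p)) p"
proof -
  obtain D where D: "\<And>i. ((\<lambda>p. \<phi> p $ i) has_derivative D i) (at p)"
      "\<And>i c v. D i (c *s v) = c * D i v"
    using assms(1) unfolding cdiff_def by metis
  obtain E where E: "(f has_derivative E) (at (\<phi> p))" "\<And>c v. E (c *s v) = c * E v"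
    using assms(2) unfolding cdiff_def by metis
  have d: "(\<phi> has_derivative (\<lambda>h. \<chi> i. D i h)) (at p)"
    by (rule has_derivative_vec) (simp add: D)
  have "(\<chi> i. D i (c *s v)) = c *s (\<chi> i. D i v)" for c v
    by (simp add: vec_eq_iff D)
  then show ?thesis
    unfolding cdiff_def using has_derivative_compose[OF d E(1)] E(2)
    by (intro exI[of _ "\<lambda>h. E (\<chi> i. D i h)"]) auto
qed

lemma cdiff_isCont: "cdiff f p \<Longrightarrow> isCont f p"
  unfolding cdiff_def using has_derivative_continuous by blast

lemma holo0_const [simp]: "holo_at_0 (\<lambda>p. c)" by (simp add: holo_at_0_iff)
lemma holo0_nth [simp]: "holo_at_0 (\<lambda>p. p $ i)" by (simp add: holo_at_0_iff)

lemma holo0_add [intro]: "holo_at_0 f \<Longrightarrow> holo_at_0 g \<Longrightarrow>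
    holo_at_0 (\<lambda>p. f p + g p)"
  unfolding holo_at_0_iff by (erule (1) eventually_elim2) (rule cdiff_add)

lemma holo0_mult [intro]: "holo_at_0 f \<Longrightarrow> holo_at_0 g \<Longrightarrow>
    holo_at_0 (\<lambda>p. f p * g p)"
  unfolding holo_at_0_iff by (erule (1) eventually_elim2) (rule cdiff_mult)

lemma holo0_minus [intro]: "holo_at_0 f \<Longrightarrow> holo_at_0 (\<lambda>p. - f p)"
  using holo0_mult[of "\<lambda>_. -1" f] by simp

lemma holo0_diff [intro]: "holo_at_0 f \<Longrightarrow> holo_at_0 g \<Longrightarrow>
    holo_at_0 (\<lambda>p. f p - g p)"
  using holo0_add[of f "\<lambda>p. - g p"] by auto

lemma holo0_power [intro]: "holo_at_0 f \<Longrightarrow> holo_at_0 (\<lambda>p. f p ^ n)"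
  by (induction n) auto

lemma holo0_tendsto: "holo_at_0 f \<Longrightarrow> (f \<longlongrightarrow> f 0) (nhds 0)"
  using cdiff_isCont[of f 0] eventually_nhds_x_imp_x[of "cdiff f" 0]
  by (simp add: holo_at_0_iff isCont_def flip: tendsto_at_iff_tendsto_nhds)

lemma holo0_comp_field:
  assumes "holo_at_0 f" "g holomorphic_on S" "open S" "f 0 \<in> S"
  shows "holo_at_0 (\<lambda>p. g (f p))"
proof -
  have "\<forall>\<^sub>F p in nhds 0. f p \<in> S"
    using holo0_tendsto[OF assms(1)] assms(3,4) by (rule topological_tendstoD)
  moreover have "\<forall>\<^sub>F p in nhds 0. cdiff f p" using assms(1)
      by (simp add: holo_at_0_iff)
  ultimately show ?thesis unfolding holo_at_0_iff
    by eventually_elim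
      (rule cdiff_comp_field, assumption, rule holomorphic_on_imp_differentiable_at[OF assms(2,3)])
qed

lemma holo0_ne: "holo_at_0 f \<Longrightarrow> f 0 \<noteq> 0 \<Longrightarrow>
    \<forall>\<^sub>F p in nhds 0. f p \<noteq> 0"
  using topological_tendstoD[OF holo0_tendsto, of f "-{0}"] by auto

lemma holo0_inverse: "holo_at_0 f \<Longrightarrow> f 0 \<noteq> 0 \<Longrightarrow>
    holo_at_0 (\<lambda>p. inverse (f p))"
  by (rule holo0_comp_field[of f inverse "-{0}"]) (auto intro!: holomorphic_on_inverse
      holomorphic_on_ident)

lemma holo0_divide [intro]:
  "holo_at_0 f \<Longrightarrow> holo_at_0 g \<Longrightarrow> g 0 \<noteq> 0 \<Longrightarrow>
      holo_at_0 (\<lambda>p. f p / g p)"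
  unfolding divide_inverse by (intro holo0_mult holo0_inverse)

lemma holo0_exp [intro]: "holo_at_0 f \<Longrightarrow> holo_at_0 (\<lambda>p. exp (f p))"
  by (rule holo0_comp_field[of f exp UNIV]) (simp_all add: holomorphic_on_exp)

text \<open>Division by \<open>f 0\<close> moves the value at 0 to 1, away from the branch cut of
  \<open>Ln\<close>; the constant \<open>Ln (f 0)\<close> is added back afterwards.\<close>

lemma holo0_log:
  assumes "holo_at_0 f" "f 0 \<noteq> 0"
  obtains l where "holo_at_0 l" "\<forall>\<^sub>F p in nhds 0. exp (l p) = f p" "l 0 = Ln (f 0)"
proof
  let ?l = "\<lambda>p. Ln (f p / f 0) + Ln (f 0)"
  have "holo_at_0 (\<lambda>p. Ln (f p / f 0))"
  proof (rule holo0_comp_field[of "\<lambda>p. f p / f 0" Ln "- \<real>\<^sub>\<le>\<^sub>0"])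
    show "holo_at_0 (\<lambda>p. f p / f 0)" by (rule holo0_divide) (simp_all add: assms)
    show "Ln holomorphic_on - \<real>\<^sub>\<le>\<^sub>0" by (rule holomorphic_on_Ln) simp
    show "f 0 / f 0 \<in> - \<real>\<^sub>\<le>\<^sub>0" using assms by simp
  qed (simp add: open_Compl)
  then show "holo_at_0 ?l" by (rule holo0_add) simp
  show "?l 0 = Ln (f 0)" using assms(2) by simp
  show "\<forall>\<^sub>F p in nhds 0. exp (?l p) = f p"
    using holo0_ne[OF assms] by eventually_elim (use assms(2) in \<open>simp add: exp_add\<close>)
qed

lemma holo0_comp:
  fixes \<phi> :: "complex^'n \<Rightarrow> complex^'m"
  assumes "\<And>i. holo_at_0 (\<lambda>p. \<phi> p $ i)" "\<phi> 0 = 0" "holo_at_0 f"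
  shows "holo_at_0 (\<lambda>p. f (\<phi> p))"
proof -
  have "(\<phi> \<longlongrightarrow> 0) (nhds 0)"
  proof (rule vec_tendstoI)
    show "((\<lambda>p. \<phi> p $ i) \<longlongrightarrow> 0 $ i) (nhds 0)" for i
      using holo0_tendsto[OF assms(1)[of i]] assms(2) by simp
  qed
  then have "\<forall>\<^sub>F p in nhds 0. cdiff f (\<phi> p)"
    using assms(3) unfolding holo_at_0_iff by (rule eventually_compose_filterlim[rotated])
  moreover have "\<forall>\<^sub>F p in nhds 0. \<forall>i. cdiff (\<lambda>p. \<phi> p $ i) p"
    using assms(1) unfolding holo_at_0_iff by (simp add: eventually_all_finite)
  ultimately show ?thesis unfolding holo_at_0_iff
    by eventually_elim (rule cdiff_comp, auto)
qed

section \<open>Complex partial derivatives and their continuity\<close>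

definition pd :: "(complex^'n \<Rightarrow> complex) \<Rightarrow> 'n \<Rightarrow> complex^'n
    \<Rightarrow> complex" where
  "pd f i p = deriv (\<lambda>t. f (p + t *s axis i 1)) 0"

lemma has_derivative_line: "((\<lambda>t. p + t *s v) has_derivative (\<lambda>t. t *s v))
    (at (t::complex))"
proof (rule has_derivative_vec)
  have "((\<lambda>t. p $ i + t * v $ i) has_derivative (\<lambda>t. 0 + t * v $ i)) (at t)" for i
    by (intro has_derivative_add has_derivative_const has_derivative_mult_left has_derivative_ident)
  then show "((\<lambda>t. (p + t *s v) $ i) has_derivative (\<lambda>t. (t *s v) $ i)) (at t)"
      for i by simp
qed

lemma cdiff_line:
  fixes D :: "complex^'n \<Rightarrow> complex"
  assumes "(f has_derivative D) (at (p + t *s v))" "\<And>c v. D (c *s v) = c * D v"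
  shows "((\<lambda>t. f (p + t *s v)) has_field_derivative D v) (at t)"
proof -
  have "((\<lambda>t. f (p + t *s v)) has_derivative (\<lambda>t. D (t *s v))) (at t)"
    by (rule has_derivative_compose[OF has_derivative_line assms(1)])
  moreover have "(\<lambda>t. D (t *s v)) = (*) (D v)" by (auto simp: assms(2))
  ultimately show ?thesis by (simp add: has_field_derivative_def)
qed

lemma vec_expansion: "(h :: complex^'n) = (\<Sum>i\<in>UNIV. h $ i *s axis i 1)"
  by (simp add: vec_eq_iff axis_def if_distrib cong: if_cong)

lemma cdiff_has_derivative:
  assumes "cdiff f p"
  shows "(f has_derivative (\<lambda>h. \<Sum>i\<in>UNIV. h $ i * pd f i p)) (at p)"
proof -
  obtain D where D: "(f has_derivative D) (at p)" "\<And>c v. D (c *s v) = c * D v"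
    using assms unfolding cdiff_def by blast
  have A: "pd f i p = D (axis i 1)" for i
    unfolding pd_def using cdiff_line[of f D p 0 "axis i 1"] D by (auto intro: DERIV_imp_deriv)
  have "D h = (\<Sum>i\<in>UNIV. h $ i * D (axis i 1))" for h
  proof -
    have "D h = D (\<Sum>i\<in>UNIV. h $ i *s axis i 1)" by (simp flip: vec_expansion)
    also have "\<dots> = (\<Sum>i\<in>UNIV. D (h $ i *s axis i 1))"
      by (rule linear_sum[OF has_derivative_linear[OF D(1)]])
    finally show ?thesis by (simp add: D(2))
  qed
  then have "D = (\<lambda>h. \<Sum>i\<in>UNIV. h $ i * pd f i p)" unfolding A by (rule ext)
  with D(1) show ?thesis by simp
qed

lemma pd_eqI:
  assumes "(f has_derivative D) (at p)" "\<And>c v. D (c *s v) = c * D v"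
  shows "pd f i p = D (axis i 1)"
  unfolding pd_def using cdiff_line[of f D p 0 "axis i 1"] assms by (auto intro: DERIV_imp_deriv)

text \<open>Cauchy's inequality on the disc of radius \<open>r\<close> in the complex line through
  \<open>p\<close> parallel to the \<open>i\<close>-th axis.\<close>

lemma cauchy_pd_bound:
  assumes c: "\<And>q. dist q p \<le> r \<Longrightarrow> cdiff f q" and b: "\<And>q. dist q p \<le>
      r \<Longrightarrow> norm (f q) \<le> B"
    and "r > 0"
  shows "norm (pd f i p) \<le> B / r"
proof -
  define g where "g = (\<lambda>t. f (p + t *s axis i 1))"
  have d: "dist (p + t *s axis i 1) p \<le> norm t" for t :: complex
  proof -
    have "t *s axis i 1 = (axis i t :: complex^'a)" by (simp add: vec_eq_iff axis_def)
    then show ?thesis using norm_axis_le[of i t] by (simp add: dist_norm)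
  qed
  have h: "g field_differentiable at t" if "norm t \<le> r" for t
  proof -
    have "cdiff f (p + t *s axis i 1)" by (rule c) (use d[of t] that in linarith)
    then obtain D where "(f has_derivative D) (at (p + t *s axis i 1))" "\<And>c v. D (c *s v) =
        c * D v"
      unfolding cdiff_def by blast
    then show ?thesis unfolding g_def field_differentiable_def using cdiff_line by blast
  qed
  have "norm ((deriv ^^ 1) g 0) \<le> fact 1 * B / r ^ 1"
  proof (rule Cauchy_inequality)
    show "g holomorphic_on ball 0 r" unfolding holomorphic_on_def
      by (auto intro!: field_differentiable_at_within h)
    show "continuous_on (cball 0 r) g"
      by (intro continuous_at_imp_continuous_on ballI field_differentiable_imp_continuous_at h) simp
    show "norm (g t) \<le> B" if "cmod (0 - t) = r" for t
      unfolding g_def by (rule b) (use d[of t] that in simp)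
  qed fact
  then show ?thesis by (simp add: g_def pd_def)
qed

lemma pd_add:
  "cdiff f p \<Longrightarrow> cdiff g p \<Longrightarrow> pd (\<lambda>p. f p + g p) i p =
      pd f i p + pd g i p"
proof -
  assume "cdiff f p" "cdiff g p"
  then obtain D E where *: "(f has_derivative D) (at p)" "\<And>c v. D (c *s v) = c * D v"
    "(g has_derivative E) (at p)" "\<And>c v. E (c *s v) = c * E v"
    unfolding cdiff_def by blast
  have "pd (\<lambda>p. f p + g p) i p = D (axis i 1) + E (axis i 1)"
    by (rule pd_eqI[OF has_derivative_add[OF *(1,3)]]) (simp add: *(2,4) algebra_simps)
  then show ?thesis by (simp add: pd_eqI[OF *(1,2)] pd_eqI[OF *(3,4)])
qed

lemma pd_mult:
  "cdiff f p \<Longrightarrow> cdiff g p \<Longrightarrow> pd (\<lambda>p. f p * g p) i p =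
      f p * pd g i p + pd f i p * g p"
proof -
  assume "cdiff f p" "cdiff g p"
  then obtain D E where *: "(f has_derivative D) (at p)" "\<And>c v. D (c *s v) = c * D v"
    "(g has_derivative E) (at p)" "\<And>c v. E (c *s v) = c * E v"
    unfolding cdiff_def by blast
  have "pd (\<lambda>p. f p * g p) i p = f p * E (axis i 1) + D (axis i 1) * g p"
    by (rule pd_eqI[OF has_derivative_mult[OF *(1,3)]]) (simp add: *(2,4) algebra_simps)
  then show ?thesis by (simp add: pd_eqI[OF *(1,2)] pd_eqI[OF *(3,4)])
qed

lemma pd_const [simp]: "pd (\<lambda>p. c) i p = 0"
  by (simp add: pd_def)

lemma pd_nth: "pd (\<lambda>p. p $ j) i p = (if i = j then 1 else 0)"
  by (subst pd_eqI[OF has_derivative_nth]) (auto simp: axis_def)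

text \<open>Makes a difference of partial derivatives at two points accessible to
  \<open>cauchy_pd_bound\<close>, by turning it into one partial derivative of a difference of
  translates.\<close>

lemma pd_shift_diff:
  assumes "cdiff f q" "cdiff f p"
  shows "pd (\<lambda>x. f (x + (q - p)) - f x) i p = pd f i q - pd f i p"
proof -
  obtain D where D: "(f has_derivative D) (at q)" "\<And>c v. D (c *s v) = c * D v"
    using assms(1) unfolding cdiff_def by blast
  obtain E where E: "(f has_derivative E) (at p)" "\<And>c v. E (c *s v) = c * E v"
    using assms(2) unfolding cdiff_def by blast
  have "((\<lambda>x. x + (q - p)) has_derivative (\<lambda>h. h)) (at p)"
    by (rule has_derivative_add_const) (rule has_derivative_ident)
  moreover have "(f has_derivative D) (at (p + (q - p)))" using D(1) by simp
  ultimately have "((\<lambda>x. f (x + (q - p))) has_derivative (\<lambda>h. D h)) (at p)"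
    by (rule has_derivative_compose)
  then have "((\<lambda>x. f (x + (q - p)) - f x) has_derivative (\<lambda>h. D h - E h)) (at p)"
    by (rule has_derivative_diff) (rule E(1))
  then have "pd (\<lambda>x. f (x + (q - p)) - f x) i p = D (axis i 1) - E (axis i 1)"
    by (rule pd_eqI) (simp add: D(2) E(2) algebra_simps)
  then show ?thesis using pd_eqI[OF D] pd_eqI[OF E] by simp
qed

text \<open>The difference of \<open>f\<close> and a small translate is uniformly small on a compact
  ball, so Cauchy's inequality makes its partial derivatives small. Since \<open>cdiff\<close> asks
  only for differentiability at points, this supplies the continuity of the derivative needed for
  the inverse function theorem.\<close>

lemma pd_continuous:
  assumes "holo_on S f" "open S"
  shows "continuous_on S (pd f i)"
proof (rule continuous_at_imp_continuous_on, rule ballI)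
  fix p assume p: "p \<in> S"
  have cd: "cdiff f q" if "q \<in> S" for q using assms(1) that by (auto simp: holo_on_cdiff)
  obtain R where R: "R > 0" "cball p R \<subseteq> S" using assms(2) p open_contains_cball by blast
  \<comment> \<open>With half the radius, points at distance at most \<open>r\<close> from
    \<open>p\<close> stay in \<open>cball p R\<close> after translation by
    \<open>q - p\<close>.\<close>
  define r where "r = R / 2"
  have r: "r > 0" using R by (simp add: r_def)
  have "continuous_on (cball p R) f"
    using R(2) by (intro continuous_at_imp_continuous_on ballI cdiff_isCont cd) auto
  then have uc: "uniformly_continuous_on (cball p R) f"
    using compact_cball compact_uniformly_continuous by blast
  show "isCont (pd f i) p" unfolding continuous_at_eps_delta
  proof (intro allI impI)
    fix e :: real assume e: "e > 0"
    then obtain d where d: "d > 0"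
      "\<And>x y. x \<in> cball p R \<Longrightarrow> y \<in> cball p R \<Longrightarrow>
          dist x y < d \<Longrightarrow> dist (f x) (f y) < e * r / 2"
      using uc r unfolding uniformly_continuous_on_def by (metis half_gt_zero mult_pos_pos)
    show "\<exists>d>0. \<forall>q. dist q p < d \<longrightarrow> dist (pd f i q) (pd f i p) < e"
    proof (intro exI[of _ "min d r"] conjI allI impI)
      fix q assume q: "dist q p < min d r"
      have q1: "dist (x + (q - p)) p \<le> R" "dist x p \<le> R" if "dist x p \<le> r" for x
      proof -
        have "norm (x + (q - p) - p) \<le> norm (x - p) + norm (q - p)"
          using norm_triangle_ineq[of "x - p" "q - p"] by (simp add: algebra_simps)
        then show "dist (x + (q - p)) p \<le> R" using that q by (simp add: dist_norm r_def)
        show "dist x p \<le> R" using that r by (simp add: r_def)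
      qed
      have "norm (pd (\<lambda>x. f (x + (q - p)) - f x) i p) \<le> (e * r / 2) / r"
      proof (rule cauchy_pd_bound)
        fix x assume x: "dist x p \<le> r"
        have m: "x \<in> cball p R" "x + (q - p) \<in> cball p R"
          using q1[OF x] by (auto simp: dist_commute)
        have "cdiff f (x + (q - p))" using m R(2) cd by blast
        then have "cdiff (\<lambda>x. f (x + (q - p))) x"
          by (intro cdiff_comp[of "\<lambda>x. x + (q - p)" x f]) (simp_all add: cdiff_add)
        moreover have "cdiff (\<lambda>x. - 1 * f x) x" using m R(2) cd by (intro cdiff_mult) auto
        ultimately have "cdiff (\<lambda>x. f (x + (q - p)) + - 1 * f x) x" by (rule cdiff_add)
        then show "cdiff (\<lambda>x. f (x + (q - p)) - f x) x" by simp
        show "norm (f (x + (q - p)) - f x) \<le> e * r / 2"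
          using d(2)[OF m(2) m(1)] q by (simp add: dist_norm)
      qed fact
      also have "\<dots> = e / 2" using r by simp
      also have "\<dots> < e" using e by simp
      finally have "norm (pd (\<lambda>x. f (x + (q - p)) - f x) i p) < e" .
      moreover have "q \<in> S" "p \<in> S" using R q1(1)[of p] r q
          by (auto simp: r_def dist_commute)
      ultimately show "dist (pd f i q) (pd f i p) < e"
        by (simp add: pd_shift_diff cd dist_norm)
    qed (use d r in auto)
  qed
qed

section \<open>Coordinate changes and contact equivalence\<close>

lemma linear_pd: "linear (\<lambda>h :: complex^'n. \<chi> i. \<Sum>j\<in>UNIV. h $ j * a i j)"
  by (rule linearI) (auto simp: vec_eq_iff sum.distrib algebra_simps sum_distrib_left
      scaleR_sum_right)

text \<open>The real inverse function theorem gives a local inverse; it is holomorphic because the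
  inverse of a complex linear bijection is complex linear. Hypothesis \<open>inj\<close> says that
  the Jacobian matrix at 0 has trivial kernel.\<close>

lemma coordinate_changeI:
  fixes \<phi> :: "complex^'n \<Rightarrow> complex^'n"
  assumes 0: "\<phi> 0 = 0" and hol: "\<And>i. holo_at_0 (\<lambda>p. \<phi> p $ i)"
    and inj: "\<And>h. (\<And>i. (\<Sum>j\<in>UNIV. h $ j * pd (\<lambda>p. \<phi> p $ i) j 0) =
        0) \<Longrightarrow> h = 0"
  shows "coordinate_change_at_0 \<phi>"
proof -
  have "\<forall>\<^sub>F p in nhds 0. \<forall>i. cdiff (\<lambda>p. \<phi> p $ i) p"
    using hol unfolding holo_at_0_iff by (simp add: eventually_all_finite)
  then obtain S where S: "open S" "0 \<in> S" "\<And>p i. p \<in> S \<Longrightarrow>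
      cdiff (\<lambda>p. \<phi> p $ i) p"
    unfolding eventually_nhds by blast
  define L
      where "L = (\<lambda>p h. \<chi> i. \<Sum>j\<in>UNIV. h $ j * pd (\<lambda>p. \<phi> p $ i) j
      p)"
  have lin: "linear (L p)" for p unfolding L_def by (rule linear_pd)
  have bl: "bounded_linear (L p)" for p using lin by (simp add: linear_conv_bounded_linear)
  have Lc: "L p (c *s v) = c *s L p v" for p c v
    by (simp add: L_def vec_eq_iff sum_distrib_left algebra_simps)
  have app: "blinfun_apply (Blinfun (L p)) = L p" for p
    by (rule bounded_linear_Blinfun_apply[OF bl])
  have der: "(\<phi> has_derivative blinfun_apply (Blinfun (L p))) (at p)" if "p \<in> S" for p
    unfolding app
  proof (rule has_derivative_vec)
    show "((\<lambda>x. \<phi> x $ i) has_derivative (\<lambda>h. L p h $ i)) (at p)" for i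
      using cdiff_has_derivative[OF S(3)[OF that, of i]] by (simp add: L_def)
  qed
  have cont: "continuous_on S (\<lambda>p. Blinfun (L p))"
    unfolding continuous_on_eq_continuous_within
  proof (intro ballI continuous_blinfun_componentwiseI1)
    fix p and b :: "complex^'n" assume p: "p \<in> S"
    have "continuous_on S (pd (\<lambda>p. \<phi> p $ i) j)" for i j
      by (rule pd_continuous[OF _ S(1)]) (simp add: holo_on_cdiff S(3))
    then have "continuous_on S (\<lambda>p. L p b)"
      unfolding L_def by (intro continuous_on_vec_lambda continuous_on_sum continuous_on_mult_left)
    then show "continuous (at p within S) (\<lambda>x. blinfun_apply (Blinfun (L x)) b)"
      unfolding app continuous_on_eq_continuous_within using p by blast
  qed
  have "inj (L 0)"
  proof (rule linear_injective_0[OF lin, THEN iffD2], intro allI impI)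
    fix h assume "L 0 h = 0"
    then show "h = 0" by (intro inj) (simp add: L_def vec_eq_iff)
  qed
  then obtain M where M: "linear M" "M \<circ> L 0 = id"
    using linear_injective_left_inverse[OF lin] by blast
  have blM: "bounded_linear M" using M(1) by (simp add: linear_conv_bounded_linear)
  have invf: "Blinfun M o\<^sub>L Blinfun (L 0) = id_blinfun"
    using M(2) by (intro blinfun_eqI) (simp add: app bounded_linear_Blinfun_apply[OF blM]
        fun_eq_iff)
  obtain U V g g' where U: "open U" "U \<subseteq> S" "0 \<in> U" "open V" "\<phi> 0 \<in> V"
      "homeomorphism U V \<phi> g"
    "\<And>y. y \<in> V \<Longrightarrow> (g has_derivative (g' y)) (at y)"
    "\<And>y. y \<in> V \<Longrightarrow> g' y = inv_into UNIV (blinfun_apply (Blinfun (L (g y))))"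
    "\<And>y. y \<in> V \<Longrightarrow> bij (blinfun_apply (Blinfun (L (g y))))"
    by (rule inverse_function_theorem[OF S(1) der cont S(2) invf]) blast+
  have "holo_map_on U \<phi>" using U(2) S(3) by (auto simp: holo_map_on_def holo_on_cdiff)
  moreover have "holo_map_on V g"
    unfolding holo_map_on_def holo_on_def
  proof (intro allI ballI)
    fix i y assume y: "y \<in> V"
    have bij: "bij (L (g y))" and g': "g' y = inv_into UNIV (L (g y))" using U(8,9)[OF y]
        by (simp_all add: app)
    have "g' y (c *s v) = c *s g' y v" for c v
    proof -
      have "L (g y) (g' y (c *s v)) = L (g y) (c *s g' y v)"
        unfolding Lc g' by (simp add: bij bij_is_surj surj_f_inv_f)
      then show ?thesis using bij_is_inj[OF bij] by (simp add: inj_eq)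
    qed
    moreover have "((\<lambda>p. g p $ i) has_derivative (\<lambda>h. g' y h $ i)) (at y)"
      by (rule bounded_linear.has_derivative[OF bounded_linear_vec_nth U(7)[OF y]])
    ultimately show "\<exists>D. ((\<lambda>p. g p $ i) has_derivative D) (at y) \<and>
        (\<forall>c v. D (c *s v) = c * D v)"
      by (intro exI[of _ "\<lambda>h. g' y h $ i"]) simp
  qed
  ultimately show ?thesis
    unfolding coordinate_change_at_0_def using 0 U(1,3,4,6) by blast
qed

lemma coordinate_changeE:
  assumes "coordinate_change_at_0 (\<phi> :: complex^'n \<Rightarrow> complex^'n)"
  obtains \<psi> where "coordinate_change_at_0 \<psi>" "\<phi> 0 = 0" "\<psi> 0 = 0"
    "\<And>i. holo_at_0 (\<lambda>p. \<phi> p $ i)" "\<And>i. holo_at_0 (\<lambda>p. \<psi> p $ i)"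
    "\<forall>\<^sub>F p in nhds 0. \<psi> (\<phi> p) = p"
        "\<forall>\<^sub>F p in nhds 0. \<phi> (\<psi> p) = p"
    "filterlim \<phi> (nhds 0) (nhds 0)" "filterlim \<psi> (nhds 0) (nhds 0)"
proof -
  obtain S T \<psi> where *: "\<phi> 0 = 0" "open S" "0 \<in> S" "open T"
      "homeomorphism S T \<phi> \<psi>"
    "holo_map_on S \<phi>" "holo_map_on T \<psi>"
    using assms unfolding coordinate_change_at_0_def by blast
  have T: "0 \<in> T" using *(1,3,5) unfolding homeomorphism_def by (metis image_eqI)
  have \<psi>0: "\<psi> 0 = 0" using *(1,3,5) unfolding homeomorphism_def by metis
  have h: "holo_at_0 (\<lambda>p. \<phi> p $ i)" "holo_at_0 (\<lambda>p. \<psi> p $ i)" for i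
    using * T unfolding holo_at_0_def holo_map_on_def by blast+
  show ?thesis
  proof
    show "coordinate_change_at_0 \<psi>"
      unfolding coordinate_change_at_0_def using \<psi>0 T * homeomorphism_sym by blast
    show "\<phi> 0 = 0" "\<psi> 0 = 0" by fact+
    show "holo_at_0 (\<lambda>p. \<phi> p $ i)" "holo_at_0 (\<lambda>p. \<psi> p $ i)" for i
        by (fact h)+
    show "\<forall>\<^sub>F p in nhds 0. \<psi> (\<phi> p) = p"
      using *(2,3,5) unfolding eventually_nhds homeomorphism_def by blast
    show "\<forall>\<^sub>F p in nhds 0. \<phi> (\<psi> p) = p"
      using *(4,5) T unfolding eventually_nhds homeomorphism_def by blast
    show "filterlim \<phi> (nhds 0) (nhds 0)"
    proof (rule vec_tendstoI)
      show "((\<lambda>p. \<phi> p $ i) \<longlongrightarrow> 0 $ i) (nhds 0)" for i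
        using holo0_tendsto[OF h(1)[of i]] *(1) by simp
    qed
    show "filterlim \<psi> (nhds 0) (nhds 0)"
    proof (rule vec_tendstoI)
      show "((\<lambda>p. \<psi> p $ i) \<longlongrightarrow> 0 $ i) (nhds 0)" for i
        using holo0_tendsto[OF h(2)[of i]] \<psi>0 by simp
    qed
  qed
qed

lemma coordinate_change_comp:
  assumes "coordinate_change_at_0 \<phi>" "coordinate_change_at_0 \<rho>"
  shows "coordinate_change_at_0 (\<rho> \<circ> \<phi>)"
proof -
  obtain S T \<phi>' where *: "\<phi> 0 = 0" "open S" "0 \<in> S" "open T"
      "homeomorphism S T \<phi> \<phi>'"
    "holo_map_on S \<phi>" "holo_map_on T \<phi>'"
    using assms unfolding coordinate_change_at_0_def by blast
  obtain U V \<rho>' where **: "\<rho> 0 = 0" "open U" "0 \<in> U" "open V"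
      "homeomorphism U V \<rho> \<rho>'"
    "holo_map_on U \<rho>" "holo_map_on V \<rho>'"
    using assms unfolding coordinate_change_at_0_def by blast
  \<comment> \<open>The domains of the two homeomorphisms are unrelated; both are cut down so that
    the intermediate points lie in \<open>T \<inter> U\<close>.\<close>
  define S' where "S' = S \<inter> \<phi> -` U"
  define V' where "V' = V \<inter> \<rho>' -` T"
  have o: "open S'" "open V'" unfolding S'_def V'_def
    using * ** by (auto intro!: continuous_open_preimage simp: homeomorphism_def)
  have sub: "\<phi> ` S' \<subseteq> T \<inter> U" "\<rho>' ` V' \<subseteq> T \<inter> U"
    using *(5) **(5) unfolding S'_def V'_def homeomorphism_def by auto
  have "homeomorphism S' V' (\<rho> \<circ> \<phi>) (\<phi>' \<circ> \<rho>')"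
  proof (rule homeomorphismI)
    show "continuous_on S' (\<rho> \<circ> \<phi>)"
      using *(5) **(5) sub unfolding S'_def homeomorphism_def
      by (intro continuous_on_compose) (auto elim: continuous_on_subset)
    show "continuous_on V' (\<phi>' \<circ> \<rho>')"
      using *(5) **(5) sub unfolding V'_def homeomorphism_def
      by (intro continuous_on_compose) (auto elim: continuous_on_subset)
    show "(\<rho> \<circ> \<phi>) ` S' \<subseteq> V'" using *(5) **(5)
        unfolding S'_def V'_def homeomorphism_def by auto
    show "(\<phi>' \<circ> \<rho>') ` V' \<subseteq> S'" using *(5) **(5)
        unfolding S'_def V'_def homeomorphism_def by auto
    show "(\<phi>' \<circ> \<rho>') ((\<rho> \<circ> \<phi>) x) = x" if "x \<in> S'" for x
      using that *(5) **(5) unfolding S'_def homeomorphism_def by auto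
    show "(\<rho> \<circ> \<phi>) ((\<phi>' \<circ> \<rho>') y) = y" if "y \<in> V'" for y
      using that *(5) **(5) unfolding V'_def homeomorphism_def by auto
  qed
  moreover have "holo_map_on S' (\<rho> \<circ> \<phi>)"
    unfolding holo_map_on_def holo_on_cdiff
  proof (intro allI ballI)
    fix i p assume "p \<in> S'"
    then have "cdiff (\<lambda>p. \<phi> p $ j) p" "cdiff (\<lambda>q. \<rho> q $ i) (\<phi> p)"
        for j
      using *(6) **(6) by (auto simp: S'_def holo_map_on_def holo_on_cdiff)
    then have "cdiff (\<lambda>p. \<rho> (\<phi> p) $ i) p" by (rule cdiff_comp)
    then show "cdiff (\<lambda>p. (\<rho> \<circ> \<phi>) p $ i) p" by simp
  qed
  moreover have "holo_map_on V' (\<phi>' \<circ> \<rho>')"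
    unfolding holo_map_on_def holo_on_cdiff
  proof (intro allI ballI)
    fix i p assume "p \<in> V'"
    then have "cdiff (\<lambda>p. \<rho>' p $ j) p" "cdiff (\<lambda>q. \<phi>' q $ i) (\<rho>' p)"
        for j
      using *(7) **(7) by (auto simp: V'_def holo_map_on_def holo_on_cdiff)
    then have "cdiff (\<lambda>p. \<phi>' (\<rho>' p) $ i) p" by (rule cdiff_comp)
    then show "cdiff (\<lambda>p. (\<phi>' \<circ> \<rho>') p $ i) p" by simp
  qed
  moreover have "0 \<in> S'" "(\<rho> \<circ> \<phi>) 0 = 0" using * ** by (auto simp: S'_def)
  ultimately show ?thesis unfolding coordinate_change_at_0_def using o by blast
qed

section \<open>Ideals of germs, and contact equivalence as an equivalence relation\<close>

lemma germ_idealI: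
  "holo_at_0 a \<Longrightarrow> holo_at_0 b \<Longrightarrow> \<forall>\<^sub>F p in nhds 0. g p =
      a p * f1 p + b p * f2 p \<Longrightarrow>
    g \<in> germ_ideal f1 f2"
  unfolding germ_ideal_def by blast

lemma germ_idealE:
  assumes "g \<in> germ_ideal f1 f2"
  obtains a b where "holo_at_0 a" "holo_at_0 b" "\<forall>\<^sub>F p in nhds 0. g p = a p * f1 p +
      b p * f2 p"
  using assms unfolding germ_ideal_def by blast

lemma K_equivalent_trans:
  assumes "K_equivalent F G" "K_equivalent G H"
  shows "K_equivalent F H"
proof -
  obtain \<phi> where \<phi>: "coordinate_change_at_0 \<phi>"
    "\<And>g. g \<circ> \<phi> \<in> germ_ideal (fst F) (snd F) \<longleftrightarrow> g \<in>
        germ_ideal (fst G) (snd G)"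
    using assms(1) unfolding K_equivalent_def by blast
  obtain \<rho> where \<rho>: "coordinate_change_at_0 \<rho>"
    "\<And>g. g \<circ> \<rho> \<in> germ_ideal (fst G) (snd G) \<longleftrightarrow> g \<in>
        germ_ideal (fst H) (snd H)"
    using assms(2) unfolding K_equivalent_def by blast
  have "g \<circ> (\<rho> \<circ> \<phi>) \<in> germ_ideal (fst F) (snd F) \<longleftrightarrow>
      g \<in> germ_ideal (fst H) (snd H)" for g
    using \<phi>(2)[of "g \<circ> \<rho>"] \<rho>(2)[of g] by (simp add: comp_assoc)
  then show ?thesis
    unfolding K_equivalent_def using coordinate_change_comp[OF \<phi>(1) \<rho>(1)] by blast
qed

lemma germ_ideal_cong:
  assumes "\<forall>\<^sub>F p in nhds 0. g p = h p"
  shows "g \<in> germ_ideal f1 f2 \<longleftrightarrow> h \<in> germ_ideal f1 f2"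
proof -
  have "h \<in> germ_ideal f1 f2" if g: "g \<in> germ_ideal f1 f2"
      and e: "\<forall>\<^sub>F p in nhds 0. g p = h p" for g h
  proof -
    obtain a b where ab: "holo_at_0 a" "holo_at_0 b" "\<forall>\<^sub>F p in nhds 0. g p =
        a p * f1 p + b p * f2 p"
      using g by (rule germ_idealE)
    have "\<forall>\<^sub>F p in nhds 0. h p = a p * f1 p + b p * f2 p"
      using ab(3) e by eventually_elim simp
    then show ?thesis by (rule germ_idealI[OF ab(1,2)])
  qed
  then show ?thesis using assms by (auto simp: eq_commute)
qed

lemma K_equivalent_sym:
  assumes "K_equivalent F G"
  shows "K_equivalent G F"
proof -
  obtain \<phi> where \<phi>: "coordinate_change_at_0 \<phi>"
    "\<And>g. g \<circ> \<phi> \<in> germ_ideal (fst F) (snd F) \<longleftrightarrow> g \<in>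
        germ_ideal (fst G) (snd G)"
    using assms(1) unfolding K_equivalent_def by blast
  obtain \<psi> where \<psi>: "coordinate_change_at_0 \<psi>"
      "\<forall>\<^sub>F p in nhds 0. \<psi> (\<phi> p) = p"
    by (rule coordinate_changeE[OF \<phi>(1)])
  have "g \<circ> \<psi> \<in> germ_ideal (fst G) (snd G) \<longleftrightarrow> g \<in>
      germ_ideal (fst F) (snd F)" for g
  proof -
    have "\<forall>\<^sub>F p in nhds 0. (g \<circ> \<psi> \<circ> \<phi>) p = g p" using \<psi>(2)
        by eventually_elim simp
    then show ?thesis using \<phi>(2)[of "g \<circ> \<psi>"] germ_ideal_cong by blast
  qed
  then show ?thesis unfolding K_equivalent_def using \<psi>(1) by blast
qed

lemma germ_ideal_gens: "f1 \<in> germ_ideal f1 f2" "f2 \<in> germ_ideal f1 f2"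
  by (rule germ_idealI[of "\<lambda>_. 1" "\<lambda>_. 0"]; simp)
      (rule germ_idealI[of "\<lambda>_. 0" "\<lambda>_. 1"]; simp)

lemma germ_ideal_mono:
  assumes "g \<in> germ_ideal f1 f2" "f1 \<in> germ_ideal e1 e2" "f2 \<in> germ_ideal e1 e2"
  shows "g \<in> germ_ideal e1 e2"
proof -
  obtain a b where g: "holo_at_0 a" "holo_at_0 b" "\<forall>\<^sub>F p in nhds 0. g p = a p * f1 p +
      b p * f2 p"
    using assms(1) by (rule germ_idealE)
  obtain c d where f1: "holo_at_0 c" "holo_at_0 d" "\<forall>\<^sub>F p in nhds 0. f1 p =
      c p * e1 p + d p * e2 p"
    using assms(2) by (rule germ_idealE)
  obtain c' d' where f2: "holo_at_0 c'" "holo_at_0 d'"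
    "\<forall>\<^sub>F p in nhds 0. f2 p = c' p * e1 p + d' p * e2 p"
    using assms(3) by (rule germ_idealE)
  have "\<forall>\<^sub>F p in nhds 0. g p = (a p * c p + b p * c' p) * e1 p +
      (a p * d p + b p * d' p) * e2 p"
    using g(3) f1(3) f2(3) by eventually_elim (simp add: algebra_simps)
  moreover have "holo_at_0 (\<lambda>p. a p * c p + b p * c' p)" "holo_at_0 (\<lambda>p. a p * d p +
      b p * d' p)"
    using g f1 f2 by (auto intro!: holo0_add holo0_mult)
  ultimately show ?thesis by (intro germ_idealI)
qed

text \<open>The matrix of multipliers is invertible near 0, so by Cramer's rule \<open>F1\<close>,
  \<open>F2\<close> and the pullbacks of \<open>G1\<close>, \<open>G2\<close> generate the same
  ideal. A combination of the pullbacks is carried to one of \<open>G1\<close>, \<open>G2\<close> by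
  composing its coefficients with the inverse coordinate change.\<close>

lemma K_equivalentI:
  assumes \<phi>: "coordinate_change_at_0 \<phi>"
    and hol: "holo_at_0 m11" "holo_at_0 m12" "holo_at_0 m21" "holo_at_0 m22"
    and 1: "\<forall>\<^sub>F p in nhds 0. G1 (\<phi> p) = m11 p * F1 p + m12 p * F2 p"
    and 2: "\<forall>\<^sub>F p in nhds 0. G2 (\<phi> p) = m21 p * F1 p + m22 p * F2 p"
    and det: "m11 0 * m22 0 - m12 0 * m21 0 \<noteq> 0"
  shows "K_equivalent (F1, F2) (G1, G2)"
proof -
  obtain \<psi> where "coordinate_change_at_0 \<psi>" and \<psi>: "\<phi> 0 = 0" "\<psi> 0 = 0"
    "\<And>i. holo_at_0 (\<lambda>p. \<phi> p $ i)" "\<And>i. holo_at_0 (\<lambda>p. \<psi> p $ i)"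
    "\<forall>\<^sub>F p in nhds 0. \<psi> (\<phi> p) = p"
        "\<forall>\<^sub>F p in nhds 0. \<phi> (\<psi> p) = p"
    "filterlim \<phi> (nhds 0) (nhds 0)" "filterlim \<psi> (nhds 0) (nhds 0)"
    by (rule coordinate_changeE[OF \<phi>]) (rule that)
  define d where "d = (\<lambda>p. m11 p * m22 p - m12 p * m21 p)"
  have d: "holo_at_0 d" "d 0 \<noteq> 0" using hol det unfolding d_def
      by (auto intro!: holo0_diff holo0_mult)
  have sub1: "G1 \<circ> \<phi> \<in> germ_ideal F1 F2" "G2 \<circ> \<phi> \<in> germ_ideal F1 F2"
    by (rule germ_idealI[OF hol(1,2)], simp add: 1, rule germ_idealI[OF hol(3,4)], simp add: 2)
  have "\<forall>\<^sub>F p in nhds 0. F1 p = m22 p / d p * (G1 \<circ> \<phi>) p +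
      (- m12 p / d p) * (G2 \<circ> \<phi>) p"
    using 1 2 holo0_ne[OF d]
  proof eventually_elim
    case (elim p)
    have "m22 p * G1 (\<phi> p) - m12 p * G2 (\<phi> p) = d p * F1 p"
      unfolding elim d_def by (simp add: algebra_simps)
    with elim(3) show ?case by (simp add: field_simps)
  qed
  moreover have "\<forall>\<^sub>F p in nhds 0. F2 p = (- m21 p / d p) * (G1 \<circ> \<phi>) p +
      m11 p / d p * (G2 \<circ> \<phi>) p"
    using 1 2 holo0_ne[OF d]
  proof eventually_elim
    case (elim p)
    have "m11 p * G2 (\<phi> p) - m21 p * G1 (\<phi> p) = d p * F2 p"
      unfolding elim d_def by (simp add: algebra_simps)
    with elim(3) show ?case by (simp add: field_simps)
  qed
  moreover have "holo_at_0 (\<lambda>p. m22 p / d p)" "holo_at_0 (\<lambda>p. - m12 p / d p)"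
    "holo_at_0 (\<lambda>p. - m21 p / d p)" "holo_at_0 (\<lambda>p. m11 p / d p)"
    using hol d by (auto intro!: holo0_divide holo0_minus)
  ultimately have sub2: "F1 \<in> germ_ideal (G1 \<circ> \<phi>) (G2 \<circ> \<phi>)"
      "F2 \<in> germ_ideal (G1 \<circ> \<phi>) (G2 \<circ> \<phi>)"
    by (blast intro: germ_idealI)+
  have "g \<circ> \<phi> \<in> germ_ideal F1 F2 \<longleftrightarrow> g \<in> germ_ideal G1 G2"
      for g
  proof
    assume "g \<circ> \<phi> \<in> germ_ideal F1 F2"
    then have "g \<circ> \<phi> \<in> germ_ideal (G1 \<circ> \<phi>) (G2 \<circ> \<phi>)" using sub2
        by (rule germ_ideal_mono)
    then obtain a b where ab: "holo_at_0 a" "holo_at_0 b"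
      "\<forall>\<^sub>F p in nhds 0. g (\<phi> p) = a p * G1 (\<phi> p) + b p * G2 (\<phi> p)"
      by (rule germ_idealE) simp
    have "\<forall>\<^sub>F p in nhds 0. g (\<phi> (\<psi> p)) =
        a (\<psi> p) * G1 (\<phi> (\<psi> p)) + b (\<psi> p) * G2 (\<phi> (\<psi> p))"
      by (rule eventually_compose_filterlim[OF ab(3) \<psi>(8)])
    then have "\<forall>\<^sub>F p in nhds 0. g p = a (\<psi> p) * G1 p + b (\<psi> p) * G2 p"
      using \<psi>(6) by eventually_elim simp
    moreover have "holo_at_0 (\<lambda>p. a (\<psi> p))" "holo_at_0 (\<lambda>p. b (\<psi> p))"
      by (rule holo0_comp[OF \<psi>(4,2)], fact)+
    ultimately show "g \<in> germ_ideal G1 G2" by (intro germ_idealI)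
  next
    assume "g \<in> germ_ideal G1 G2"
    then obtain a b where ab: "holo_at_0 a" "holo_at_0 b"
      "\<forall>\<^sub>F p in nhds 0. g p = a p * G1 p + b p * G2 p"
      by (rule germ_idealE)
    have "\<forall>\<^sub>F p in nhds 0. g (\<phi> p) = a (\<phi> p) * G1 (\<phi> p) +
        b (\<phi> p) * G2 (\<phi> p)"
      by (rule eventually_compose_filterlim[OF ab(3) \<psi>(7)])
    moreover have "holo_at_0 (\<lambda>p. a (\<phi> p))" "holo_at_0 (\<lambda>p. b (\<phi> p))"
      by (rule holo0_comp[OF \<psi>(3,1)], fact)+
    ultimately have "g \<circ> \<phi> \<in> germ_ideal (G1 \<circ> \<phi>) (G2 \<circ> \<phi>)"
        by (intro germ_idealI[of "\<lambda>p. a (\<phi> p)" "\<lambda>p. b (\<phi> p)"]) simp_all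
    then show "g \<circ> \<phi> \<in> germ_ideal F1 F2" using sub1 by (rule germ_ideal_mono)
  qed
  then show ?thesis unfolding K_equivalent_def using \<phi> by auto
qed

section \<open>Normal forms with unit coefficients\<close>

text \<open>Used with \<open>q = z*w\<close> or \<open>q = X*Y\<close>: after a shift by
  \<open>k * q\<close>, the change of a power is a multiple of \<open>q\<close> and can join the
  unit in front of that product. \<open>T 0 = 0\<close> keeps the value of the unit at 0.\<close>

lemma holo0_pow_shift:
  assumes "holo_at_0 a" "holo_at_0 k" "holo_at_0 q" "k 0 = 0"
  obtains T where "holo_at_0 T" "T 0 = 0" "\<And>p. (a p + k p * q p) ^ n = a p ^ n + q p * T p"
proof -
  have "\<exists>T. holo_at_0 T \<and> T 0 = 0 \<and> (\<forall>p. (a p + k p * q p) ^ n = a p ^ n +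
      q p * T p)"
  proof (induction n)
    case 0
    show ?case by (rule exI[of _ "\<lambda>_. 0"]) simp
  next
    case (Suc n)
    then obtain T where T: "holo_at_0 T" "T 0 = 0" "\<And>p. (a p + k p * q p) ^ n = a p ^ n +
        q p * T p"
      by blast
    show ?case
    proof (rule exI[of _ "\<lambda>p. a p * T p + k p * a p ^ n + k p * q p * T p"], intro conjI
        allI)
      show "holo_at_0 (\<lambda>p. a p * T p + k p * a p ^ n + k p * q p * T p)"
        by (intro holo0_add holo0_mult holo0_power assms T)
      show "(a p + k p * q p) ^ Suc n
          = a p ^ Suc n + q p * (a p * T p + k p * a p ^ n + k p * q p * T p)" for p
        by (simp add: T(3) algebra_simps)
    qed (simp add: T assms)
  qed
  then show thesis using that by blast
qed

text \<open>A binary quadratic form near \<open>x * y\<close> splits into linear factors near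
  \<open>x\<close> and \<open>y\<close>. Taking these as new coordinates removes the square terms
  exactly, at the cost of the unit \<open>\<kappa>\<close>.\<close>

lemma holo0_factor:
  assumes "holo_at_0 q" "holo_at_0 \<alpha>" "holo_at_0 \<beta>" "q 0 = 0"
  obtains \<kappa> where "holo_at_0 \<kappa>" "\<kappa> 0 = 1"
    "\<forall>\<^sub>F p in nhds 0. \<forall>x y. \<kappa> p * (x * y - q p * (x^2 * \<alpha> p +
        y^2 * \<beta> p)) =
      (x - \<kappa> p * q p * \<beta> p * y) * (y - \<kappa> p * q p * \<alpha> p * x)"
proof -
  define \<epsilon> where "\<epsilon> = (\<lambda>p. q p * q p * \<alpha> p * \<beta> p)"
  have e: "holo_at_0 \<epsilon>" "\<epsilon> 0 = 0"
    unfolding \<epsilon>_def by (intro holo0_mult assms) (simp add: assms)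
  have "holo_at_0 (\<lambda>p. 1 - 4 * \<epsilon> p)" by (intro holo0_diff holo0_mult holo0_const e)
  then obtain l where l: "holo_at_0 l" "\<forall>\<^sub>F p in nhds 0. exp (l p) =
      1 - 4 * \<epsilon> p"
    "l 0 = Ln (1 - 4 * \<epsilon> 0)"
    by (rule holo0_log) (use e in auto)
  define s where "s = (\<lambda>p. exp (l p * (1/2)))"
  have s: "holo_at_0 s" "s 0 = 1"
    unfolding s_def using l e by (auto intro!: holo0_exp holo0_mult)
  have s2: "\<forall>\<^sub>F p in nhds 0. s p ^ 2 = 1 - 4 * \<epsilon> p"
    using l(2) by eventually_elim (simp add: s_def power2_eq_square flip: exp_add)
  \<comment> \<open>Comparing coefficients of \<open>x * y\<close> requires
    \<open>\<kappa> = 1 + \<epsilon> * \<kappa>^2\<close>. The solution with value 1 at 0 is written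
    with the root in the denominator because \<open>\<epsilon>\<close> vanishes at 0.\<close>
  define \<kappa> where "\<kappa> = (\<lambda>p. 2 / (1 + s p))"
  show thesis
  proof
    show "holo_at_0 \<kappa>" unfolding \<kappa>_def using s
        by (auto intro!: holo0_divide holo0_add)
    show "\<kappa> 0 = 1" by (simp add: \<kappa>_def s)
    have "\<forall>\<^sub>F p in nhds 0. 1 + s p \<noteq> 0"
      by (rule holo0_ne) (use s in \<open>auto intro!: holo0_add\<close>)
    then show "\<forall>\<^sub>F p in nhds 0. \<forall>x y. \<kappa> p *
        (x * y - q p * (x^2 * \<alpha> p + y^2 * \<beta> p)) =
      (x - \<kappa> p * q p * \<beta> p * y) * (y - \<kappa> p * q p * \<alpha> p * x)"
      using s2
    proof eventually_elim
      case (elim p)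
      have "4 * \<epsilon> p = (1 - s p) * (1 + s p)" using elim(2)
          by (simp add: power2_eq_square algebra_simps)
      then have e: "\<epsilon> p * (2 / (1 + s p))^2 = (1 - s p) / (1 + s p)"
        using elim(1) by (simp add: divide_simps power2_eq_square mult.commute)
      have k: "\<kappa> p = 1 + \<epsilon> p * \<kappa> p ^ 2"
        unfolding \<kappa>_def e using elim(1) by (simp add: field_simps)
      have "(x - \<kappa> p * q p * \<beta> p * y) * (y - \<kappa> p * q p * \<alpha> p * x) =
        (1 + \<epsilon> p * \<kappa> p ^ 2) * (x * y) - \<kappa> p * q p * (x^2 * \<alpha> p + y^2 *
            \<beta> p)" for x y
        unfolding \<epsilon>_def by (simp add: algebra_simps power2_eq_square)
      then show ?case unfolding k[symmetric] by (simp add: algebra_simps)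
    qed
  qed
qed

text \<open>Four such germs have an invertible diagonal Jacobian matrix. The condition survives
  adding products of germs vanishing at 0 and multiplying by units, which are the only changes made
  below.\<close>

definition coord_germ :: "4 \<Rightarrow> (complex^4 \<Rightarrow> complex) \<Rightarrow> bool"
    where
  "coord_germ i f \<longleftrightarrow> holo_at_0 f \<and> f 0 = 0 \<and> pd f i 0 \<noteq> 0 \<and>
      (\<forall>j. j \<noteq> i \<longrightarrow> pd f j 0 = 0)"

lemma holo0_cdiff: "holo_at_0 f \<Longrightarrow> cdiff f 0"
  unfolding holo_at_0_iff by (rule eventually_nhds_x_imp_x)

lemma coord_germ_nth: "coord_germ i (\<lambda>p. p $ i)"
  by (auto simp: coord_germ_def pd_nth)

lemma coord_germ_add:
  assumes "coord_germ i f" "holo_at_0 g" "holo_at_0 h" "g 0 = 0" "h 0 = 0"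
  shows "coord_germ i (\<lambda>p. f p + g p * h p)"
proof -
  have "pd (\<lambda>p. f p + g p * h p) j 0 = pd f j 0" for j
    using assms by (simp add: pd_add pd_mult cdiff_mult holo0_cdiff coord_germ_def)
  then show ?thesis using assms by (auto simp: coord_germ_def intro!: holo0_add holo0_mult)
qed

lemma coord_germ_mult:
  assumes "coord_germ i f" "holo_at_0 h" "h 0 \<noteq> 0"
  shows "coord_germ i (\<lambda>p. f p * h p)"
proof -
  have "pd (\<lambda>p. f p * h p) j 0 = pd f j 0 * h 0" for j
    using assms by (simp add: pd_mult holo0_cdiff coord_germ_def)
  then show ?thesis using assms by (auto simp: coord_germ_def intro!: holo0_mult)
qed

lemma coordinate_change_germs:
  assumes "coord_germ 1 x" "coord_germ 2 y" "coord_germ 3 z" "coord_germ 4 w"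
  shows "coordinate_change_at_0 (\<lambda>p. vector [x p, y p, z p, w p] :: complex^4)"
proof (rule coordinate_changeI)
  show "vector [x 0, y 0, z 0, w 0] = (0 :: complex^4)"
    using assms by (simp add: vec_eq_iff forall_4 coord_germ_def)
  have "\<forall>i. holo_at_0 (\<lambda>p. (vector [x p, y p, z p, w p] :: complex^4) $ i)"
    using assms by (simp add: forall_4 coord_germ_def)
  then show "holo_at_0 (\<lambda>p. (vector [x p, y p, z p, w p] :: complex^4) $ i)" for i by blast
  fix h :: "complex^4"
  assume "\<And>i. (\<Sum>j\<in>UNIV. h $ j * pd (\<lambda>p. (vector [x p, y p, z p,
      w p] :: complex^4) $ i) j 0) = 0"
  note * = this[of 1] this[of 2] this[of 3] this[of 4]
  show "h = 0"
    using * assms by (simp add: sum_4 vec_eq_iff forall_4 coord_germ_def)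
qed

text \<open>Put \<open>x = X * exp l1\<close>, and so on. All terms of the first equation get the
  common factor \<open>exp H\<close> and those of the second \<open>exp \<Theta>\<close> if the
  logarithms satisfy six linear equations. Solving four of them for \<open>l1\<close>, ...,
  \<open>l4\<close> leaves \<open>H - t * \<Theta> = k1\<close> and
  \<open>\<Theta> - s * H = k2\<close>, with determinant \<open>1 - s * t\<close>.\<close>

lemma K_equivalent_unit_coefficients:
  assumes xyzw: "coord_germ 1 x" "coord_germ 2 y" "coord_germ 3 z" "coord_germ 4 w"
    and hol: "holo_at_0 u" "holo_at_0 v" "holo_at_0 P" "holo_at_0 Q" "holo_at_0 R" "holo_at_0 S"
    and nz: "u 0 \<noteq> 0" "v 0 \<noteq> 0" "P 0 \<noteq> 0" "Q 0 \<noteq> 0" "R 0 \<noteq> 0"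
        "S 0 \<noteq> 0"
    and pos: "a > 0" "b > 0" "c > 0" "d > 0" and ne: "(a + b) * (c + d) \<noteq> a * b * c * d"
  shows "K_equivalent (\<lambda>p. u p * (x p * y p) + P p * z p ^ a + Q p * w p ^ b,
      \<lambda>p. v p * (z p * w p) + R p * x p ^ c + S p * y p ^ d) (normal_form a b c d)"
proof -
  obtain lu where lu: "holo_at_0 lu" "\<forall>\<^sub>F p in nhds 0. exp (lu p) = u p"
    by (rule holo0_log[OF hol(1) nz(1)])
  \<comment> \<open>\<open>z*w\<close>, \<open>z^a\<close> and \<open>w^b\<close> carry a minus sign
    in the normal form, so the logarithms of the negated units are taken for \<open>v\<close>,
    \<open>P\<close> and \<open>Q\<close>.\<close>
  obtain lv where lv: "holo_at_0 lv" "\<forall>\<^sub>F p in nhds 0. exp (lv p) = - v p"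
    by (rule holo0_log[of "\<lambda>p. - v p"]) (use hol nz in auto)
  obtain lP where lP: "holo_at_0 lP" "\<forall>\<^sub>F p in nhds 0. exp (lP p) = - P p"
    by (rule holo0_log[of "\<lambda>p. - P p"]) (use hol nz in auto)
  obtain lQ where lQ: "holo_at_0 lQ" "\<forall>\<^sub>F p in nhds 0. exp (lQ p) = - Q p"
    by (rule holo0_log[of "\<lambda>p. - Q p"]) (use hol nz in auto)
  obtain lR where lR: "holo_at_0 lR" "\<forall>\<^sub>F p in nhds 0. exp (lR p) = R p"
    by (rule holo0_log[OF hol(5) nz(5)])
  obtain lS where lS: "holo_at_0 lS" "\<forall>\<^sub>F p in nhds 0. exp (lS p) = S p"
    by (rule holo0_log[OF hol(6) nz(6)])
  note l = lu(1) lv(1) lP(1) lQ(1) lR(1) lS(1)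
  define s t :: complex where "s = 1 / of_nat a + 1 / of_nat b" and "t = 1 / of_nat c +
      1 / of_nat d"
  have st: "1 - s * t \<noteq> 0"
  proof
    assume "1 - s * t = 0"
    then have "of_nat ((a + b) * (c + d)) = (of_nat (a * b * c * d) :: complex)"
      using pos by (simp add: s_def t_def divide_simps algebra_simps)
    then show False using ne by (simp only: of_nat_eq_iff)
  qed
  define k1 where "k1 = (\<lambda>p. lu p - lR p / of_nat c - lS p / of_nat d)"
  define k2 where "k2 = (\<lambda>p. lv p - lP p / of_nat a - lQ p / of_nat b)"
  define H where "H = (\<lambda>p. (t * k2 p + k1 p) / (1 - s * t))"
  define \<Theta> where "\<Theta> = (\<lambda>p. s * H p + k2 p)"
  have k: "holo_at_0 k1" "holo_at_0 k2"
    unfolding k1_def k2_def using pos by (auto intro!: holo0_diff holo0_divide l)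
  have H: "holo_at_0 H" unfolding H_def using st by (auto intro!: holo0_divide holo0_add holo0_mult
      k)
  have \<Theta>: "holo_at_0 \<Theta>" unfolding \<Theta>_def
      by (auto intro!: holo0_add holo0_mult k H)
  define l1 l2 l3 l4 where "l1 = (\<lambda>p. (\<Theta> p - lR p) / of_nat c)"
      and "l2 = (\<lambda>p. (\<Theta> p - lS p) / of_nat d)"
    and "l3 = (\<lambda>p. (H p - lP p) / of_nat a)"
        and "l4 = (\<lambda>p. (H p - lQ p) / of_nat b)"
  note ldef = l1_def l2_def l3_def l4_def
  have hl: "holo_at_0 l1" "holo_at_0 l2" "holo_at_0 l3" "holo_at_0 l4"
    unfolding ldef using pos by (auto intro!: holo0_diff holo0_divide l H \<Theta>)
  have e1: "l1 p + l2 p + lu p = H p" for p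
  proof -
    have "l1 p + l2 p + lu p = t * \<Theta> p + k1 p"
      by (simp add: l1_def l2_def t_def k1_def diff_divide_distrib algebra_simps)
    also have "\<dots> = s * t * H p + (t * k2 p + k1 p)" by (simp add: \<Theta>_def algebra_simps)
    also have "t * k2 p + k1 p = (1 - s * t) * H p" using st by (simp add: H_def)
    finally show ?thesis by (simp add: algebra_simps)
  qed
  have e2: "l3 p + l4 p + lv p = \<Theta> p" for p
    by (simp add: l3_def l4_def \<Theta>_def s_def k2_def diff_divide_distrib algebra_simps)
  have e3: "of_nat c * l1 p + lR p = \<Theta> p" "of_nat d * l2 p + lS p = \<Theta> p"
    "of_nat a * l3 p + lP p = H p" "of_nat b * l4 p + lQ p = H p" for p
    using pos by (simp_all add: ldef)
  define X Y Z W where "X = (\<lambda>p. x p * exp (- l1 p))"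
      and "Y = (\<lambda>p. y p * exp (- l2 p))"
    and "Z = (\<lambda>p. z p * exp (- l3 p))" and "W = (\<lambda>p. w p * exp (- l4 p))"
  have xe: "x p = X p * exp (l1 p)" "y p = Y p * exp (l2 p)" "z p = Z p * exp (l3 p)"
    "w p = W p * exp (l4 p)" for p
    by (simp_all add: X_def Y_def Z_def W_def mult.assoc flip: exp_add)
  have "coord_germ 1 X" "coord_germ 2 Y" "coord_germ 3 Z" "coord_germ 4 W"
    unfolding X_def Y_def Z_def W_def by (intro coord_germ_mult xyzw holo0_exp holo0_minus hl;
        simp)+
  then have cc: "coordinate_change_at_0 (\<lambda>p. vector [X p, Y p, Z p, W p] :: complex^4)"
    by (rule coordinate_change_germs)
  show ?thesis unfolding normal_form_def
  proof (rule K_equivalentI[OF cc])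
    show "holo_at_0 (\<lambda>p. exp (- H p))" "holo_at_0 (\<lambda>p. 0)"
        "holo_at_0 (\<lambda>p. 0)" "holo_at_0 (\<lambda>p. exp (- \<Theta> p))"
      by (auto intro!: holo0_exp holo0_minus H \<Theta>)
    show "\<forall>\<^sub>F p in nhds 0. on_C4 (\<lambda>x y z w. x * y - z ^ a - w ^ b)
        (vector [X p, Y p, Z p, W p]) =
       exp (- H p) * (u p * (x p * y p) + P p * z p ^ a + Q p * w p ^ b) +
       0 * (v p * (z p * w p) + R p * x p ^ c + S p * y p ^ d)"
      using lu(2) lP(2) lQ(2)
    proof eventually_elim
      case (elim p)
      have "u p * (x p * y p) = exp (l1 p + l2 p + lu p) * (X p * Y p)"
        unfolding exp_add elim xe by (simp add: algebra_simps)
      moreover have "- P p * z p ^ a = exp (of_nat a * l3 p + lP p) * Z p ^ a"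
        unfolding exp_add elim xe by (simp add: power_mult_distrib exp_of_nat_mult algebra_simps)
      moreover have "- Q p * w p ^ b = exp (of_nat b * l4 p + lQ p) * W p ^ b"
        unfolding exp_add elim xe by (simp add: power_mult_distrib exp_of_nat_mult algebra_simps)
      ultimately have "u p * (x p * y p) - (- P p * z p ^ a) - (- Q p * w p ^ b) =
          exp (H p) * (X p * Y p - Z p ^ a - W p ^ b)"
        unfolding e1 e3 by (simp add: algebra_simps)
      then have "u p * (x p * y p) + P p * z p ^ a + Q p * w p ^ b =
          exp (H p) * (X p * Y p - Z p ^ a - W p ^ b)" by simp
      then show ?case by (simp add: on_C4_def exp_minus)
    qed
    show "\<forall>\<^sub>F p in nhds 0. on_C4 (\<lambda>x y z w. x ^ c +
        y ^ d - z * w) (vector [X p, Y p, Z p, W p]) =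
       0 * (u p * (x p * y p) + P p * z p ^ a + Q p * w p ^ b) +
       exp (- \<Theta> p) * (v p * (z p * w p) + R p * x p ^ c + S p * y p ^ d)"
      using lv(2) lR(2) lS(2)
    proof eventually_elim
      case (elim p)
      have "- v p * (z p * w p) = exp (l3 p + l4 p + lv p) * (Z p * W p)"
        unfolding exp_add elim xe by (simp add: algebra_simps)
      moreover have "R p * x p ^ c = exp (of_nat c * l1 p + lR p) * X p ^ c"
        unfolding exp_add elim xe by (simp add: power_mult_distrib exp_of_nat_mult algebra_simps)
      moreover have "S p * y p ^ d = exp (of_nat d * l2 p + lS p) * Y p ^ d"
        unfolding exp_add elim xe by (simp add: power_mult_distrib exp_of_nat_mult algebra_simps)
      ultimately have "R p * x p ^ c + S p * y p ^ d - (- v p * (z p * w p)) =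
          exp (\<Theta> p) * (X p ^ c + Y p ^ d - Z p * W p)"
        unfolding e2 e3 by (simp add: algebra_simps)
      then have "v p * (z p * w p) + R p * x p ^ c + S p * y p ^ d =
          exp (\<Theta> p) * (X p ^ c + Y p ^ d - Z p * W p)" by (simp add: algebra_simps)
      then show ?case by (simp add: on_C4_def exp_minus)
    qed
  qed simp
qed

lemma coordinate_change_id: "coordinate_change_at_0 (\<lambda>p :: complex^4. p)"
  by (rule coordinate_changeI) (auto simp: pd_nth sum.delta vec_eq_iff if_distrib cong: if_cong)

text \<open>A term divisible by \<open>x^(c+2)\<close> in the first equation is traded, modulo the second one, for a
  multiple of \<open>x^2 * (z*w)\<close>. It then disappears in a shift of \<open>x\<close> and \<open>y\<close> by multiples of \<open>z*w\<close>,
  which only affects the unit in front of \<open>z*w\<close> in the second equation.\<close>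

lemma K_equivalent_normal_form_remainder:
  fixes P Q R S \<mu> \<nu> \<mu>' \<nu>' :: "complex^4 \<Rightarrow> complex"
  assumes hol: "holo_at_0 P" "holo_at_0 Q" "holo_at_0 R" "holo_at_0 S"
    "holo_at_0 \<mu>" "holo_at_0 \<nu>" "holo_at_0 \<mu>'" "holo_at_0 \<nu>'"
    and nz: "P 0 \<noteq> 0" "Q 0 \<noteq> 0" "R 0 \<noteq> 0" "S 0 \<noteq> 0"
    and pos: "a > 0" "b > 0" "c > 0" "d > 0" and ne: "(a + b) * (c + d) \<noteq> a * b * c * d"
    and F1: "F1 = (\<lambda>p. p$1 * p$2 + p$3^a * P p + p$4^b * Q p + p$1^(c+2) * \<mu> p +
        p$2^(d+2) * \<nu> p)"
    and F2: "F2 = (\<lambda>p. p$3 * p$4 + p$1^c * R p + p$2^d * S p + p$3^(a+2) * \<mu>' p +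
        p$4^(b+2) * \<nu>' p)"
  shows "K_equivalent (F1, F2) (normal_form a b c d)"
proof -
  obtain a' b' c' d' where Suc: "a = Suc a'" "b = Suc b'" "c = Suc c'" "d = Suc d'"
    using pos by (metis gr0_implies_Suc)
  define x y z w :: "complex^4 \<Rightarrow> complex" where "x = (\<lambda>p. p$1)"
      and "y = (\<lambda>p. p$2)"
    and "z = (\<lambda>p. p$3)" and "w = (\<lambda>p. p$4)"
  have cg: "coord_germ 1 x" "coord_germ 2 y" "coord_germ 3 z" "coord_germ 4 w"
    unfolding x_def y_def z_def w_def by (rule coord_germ_nth)+
  have hc: "holo_at_0 x" "holo_at_0 y" "holo_at_0 z" "holo_at_0 w" using cg
      by (auto simp: coord_germ_def)
  have c0: "x 0 = 0" "y 0 = 0" "z 0 = 0" "w 0 = 0" using cg by (auto simp: coord_germ_def)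
  \<comment> \<open>Subtracting \<open>s * F2\<close> from \<open>F1\<close> cancels the terms with
    \<open>\<mu>\<close> and \<open>\<nu>\<close>. The mixed products of \<open>x^2\<close> with
    \<open>y^d\<close> and of \<open>y^2\<close> with \<open>x^c\<close> are multiples of
    \<open>x * y\<close> and go into \<open>u\<close>; what is left is \<open>- z * w * s\<close>.
    Likewise for \<open>s'\<close> and \<open>v\<close>.\<close>
  define s s' where "s = (\<lambda>p. x p^2 * \<mu> p / R p + y p^2 * \<nu> p / S p)"
    and "s' = (\<lambda>p. z p^2 * \<mu>' p / P p + w p^2 * \<nu>' p / Q p)"
  have hs: "holo_at_0 s" "holo_at_0 s'"
    unfolding s_def s'_def by (intro holo0_add holo0_divide holo0_mult holo0_power hol hc nz)+
  have s0: "s 0 = 0" "s' 0 = 0" by (simp_all add: s_def s'_def c0)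
  define u v where "u = (\<lambda>p. 1 - x p * y p^d' * \<mu> p * S p / R p - y p * x p^c' * \<nu> p
      * R p / S p)"
    and "v = (\<lambda>p. 1 - z p * w p^b' * \<mu>' p * Q p / P p - w p * z p^a' * \<nu>' p * P p /
        Q p)"
  have hu: "holo_at_0 u" "holo_at_0 v"
    unfolding u_def v_def
    by (intro holo0_diff holo0_const holo0_divide holo0_mult holo0_power hol hc nz)+
  have u0: "u 0 = 1" "v 0 = 1" by (simp_all add: u_def v_def c0)
  have u_ne: "\<forall>\<^sub>F p in nhds 0. u p \<noteq> 0"
      by (rule holo0_ne) (simp_all add: hu u0)
  define P1 Q1 R1 S1 where "P1 = (\<lambda>p. P p - s p * z p^2 * \<mu>' p)"
      and "Q1 = (\<lambda>p. Q p - s p * w p^2 * \<nu>' p)"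
    and "R1 = (\<lambda>p. R p - s' p * x p^2 * \<mu> p)"
        and "S1 = (\<lambda>p. S p - s' p * y p^2 * \<nu> p)"
  note def1 = P1_def Q1_def R1_def S1_def
  have h1: "holo_at_0 P1" "holo_at_0 Q1" "holo_at_0 R1" "holo_at_0 S1"
    unfolding def1 by (intro holo0_diff holo0_mult holo0_power hol hc hs)+
  have nz1: "P1 0 \<noteq> 0" "Q1 0 \<noteq> 0" "R1 0 \<noteq> 0" "S1 0 \<noteq> 0" using nz
      by (simp_all add: def1 c0)
  have G1: "\<forall>\<^sub>F p in nhds 0. F1 p - s p * F2 p =
      u p * (x p * y p) + z p^a * P1 p + w p^b * Q1 p - z p * w p * s p"
    using holo0_ne[OF hol(3) nz(3)] holo0_ne[OF hol(4) nz(4)]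
  proof eventually_elim
    case (elim p)
    have "s p * (x p^c * R p + y p^d * S p) = x p^(c+2) * \<mu> p + y p^(d+2) * \<nu> p
       + x p * y p * (x p * y p^d' * \<mu> p * S p / R p + y p * x p^c' * \<nu> p * R p / S p)"
      using elim unfolding s_def Suc by (simp add: field_simps power2_eq_square)
    then show ?case
      unfolding F1 F2 P1_def Q1_def u_def
      by (simp add: x_def y_def z_def w_def algebra_simps power2_eq_square)
  qed
  have G2: "\<forall>\<^sub>F p in nhds 0. F2 p - s' p * F1 p =
      v p * (z p * w p) + x p^c * R1 p + y p^d * S1 p - x p * y p * s' p"
    using holo0_ne[OF hol(1) nz(1)] holo0_ne[OF hol(2) nz(2)]
  proof eventually_elim
    case (elim p)
    have "s' p * (z p^a * P p + w p^b * Q p) = z p^(a+2) * \<mu>' p + w p^(b+2) * \<nu>' p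
       + z p * w p * (z p * w p^b' * \<mu>' p * Q p / P p + w p * z p^a' * \<nu>' p * P p / Q p)"
      using elim unfolding s'_def Suc by (simp add: field_simps power2_eq_square)
    then show ?case
      unfolding F1 F2 R1_def S1_def v_def
      by (simp add: x_def y_def z_def w_def algebra_simps power2_eq_square)
  qed
  \<comment> \<open>Division by \<open>u\<close> makes
    \<open>s = u * (x^2 * \<alpha> + y^2 * \<beta>)\<close>, so that
    \<open>u * (x*y) - z*w*s\<close> is \<open>u\<close> times the form factored by
    \<open>holo0_factor\<close>.\<close>
  define q \<alpha> \<beta> where "q = (\<lambda>p. z p * w p)"
      and "\<alpha> = (\<lambda>p. \<mu> p / (R p * u p))"
    and "\<beta> = (\<lambda>p. \<nu> p / (S p * u p))"
  have hq: "holo_at_0 q" "holo_at_0 \<alpha>" "holo_at_0 \<beta>" "q 0 = 0"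
    unfolding q_def \<alpha>_def \<beta>_def using nz u0
    by (auto intro!: holo0_divide holo0_mult hol hc hu simp: c0)
  obtain \<kappa> where \<kappa>: "holo_at_0 \<kappa>" "\<kappa> 0 = 1"
    "\<forall>\<^sub>F p in nhds 0. \<forall>x y. \<kappa> p * (x * y - q p * (x^2 * \<alpha> p +
        y^2 * \<beta> p)) =
      (x - \<kappa> p * q p * \<beta> p * y) * (y - \<kappa> p * q p * \<alpha> p * x)"
    by (rule holo0_factor[OF hq])
  define kx ky where "kx = (\<lambda>p. \<kappa> p * \<beta> p * y p)"
      and "ky = (\<lambda>p. \<kappa> p * \<alpha> p * x p)"
  have hk: "holo_at_0 kx" "holo_at_0 ky" "kx 0 = 0" "ky 0 = 0"
    unfolding kx_def ky_def by (auto intro!: holo0_mult \<kappa> hq hc simp: c0)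
  define X Y where "X = (\<lambda>p. x p + (- kx p) * q p)"
      and "Y = (\<lambda>p. y p + (- ky p) * q p)"
  have cX: "coord_germ 1 X" "coord_germ 2 Y"
    unfolding X_def Y_def by (intro coord_germ_add cg holo0_minus hk hq; simp add: hk hq)+
  then have hX: "holo_at_0 X" "holo_at_0 Y" "X 0 = 0" "Y 0 = 0" by (auto simp: coord_germ_def)
  obtain T1 where T1: "holo_at_0 T1" "T1 0 = 0" "\<And>p. (X p + kx p * q p) ^ c = X p ^ c +
      q p * T1 p"
    by (rule holo0_pow_shift[OF hX(1) hk(1) hq(1) hk(3)]) blast
  obtain T2 where T2: "holo_at_0 T2" "T2 0 = 0" "\<And>p. (Y p + ky p * q p) ^ d = Y p ^ d +
      q p * T2 p"
    by (rule holo0_pow_shift[OF hX(2) hk(2) hq(1) hk(4)]) blast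
  have xX: "x p = X p + kx p * q p" "y p = Y p + ky p * q p" for p by (simp_all add: X_def Y_def)
  have XY: "\<forall>\<^sub>F p in nhds 0. X p * Y p =
      \<kappa> p * (x p * y p - q p * (x p^2 * \<alpha> p + y p^2 * \<beta> p))"
    using \<kappa>(3)
  proof eventually_elim
    case (elim p)
    from elim[rule_format, of "x p" "y p"] show ?case
      by (simp add: X_def Y_def kx_def ky_def mult_ac)
  qed
  have su: "\<forall>\<^sub>F p in nhds 0. s p = u p * (x p^2 * \<alpha> p + y p^2 * \<beta> p)"
    using u_ne holo0_ne[OF hol(3) nz(3)] holo0_ne[OF hol(4) nz(4)]
    by eventually_elim (simp add: s_def \<alpha>_def \<beta>_def field_simps)
  \<comment> \<open>Rewriting \<open>x^c\<close>, \<open>y^d\<close> and \<open>x * y\<close> in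
    \<open>X\<close>, \<open>Y\<close> produces several multiples of \<open>z * w\<close> in the
    second equation; \<open>v2\<close> collects their coefficients. Only the multiple
    \<open>- s' / \<kappa>\<close> of \<open>X * Y\<close> remains, to be removed by factoring in
    \<open>z\<close>, \<open>w\<close>.\<close>
  define v2 where "v2 = (\<lambda>p. v p + R1 p * T1 p + S1 p * T2 p - s' p * (x p^2 * \<alpha> p +
      y p^2 * \<beta> p))"
  have v2: "holo_at_0 v2" "v2 0 = 1"
    unfolding v2_def by (auto intro!: holo0_add holo0_diff holo0_mult holo0_power hu h1 T1 T2 hs hc
        hq
      simp: u0 T1 T2 s0)
  have v2_ne: "\<forall>\<^sub>F p in nhds 0. v2 p \<noteq> 0" by (rule holo0_ne) (simp_all add: v2)
  have \<kappa>_ne: "\<forall>\<^sub>F p in nhds 0. \<kappa> p \<noteq> 0"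
      by (rule holo0_ne) (simp_all add: \<kappa>)
  define \<gamma> \<delta> q' where "\<gamma> = (\<lambda>p. \<mu>' p / (P p * v2 p * \<kappa> p))"
      and "\<delta> = (\<lambda>p. \<nu>' p / (Q p * v2 p * \<kappa> p))"
    and "q' = (\<lambda>p. X p * Y p)"
  have hq': "holo_at_0 q'" "holo_at_0 \<gamma>" "holo_at_0 \<delta>" "q' 0 = 0"
    unfolding q'_def \<gamma>_def \<delta>_def using nz v2(2) \<kappa>(2)
    by (auto intro!: holo0_divide holo0_mult hol hX v2(1) \<kappa>(1) simp: hX)
  have su': "\<forall>\<^sub>F p in nhds 0. s' p = \<kappa> p * v2 p * (z p^2 * \<gamma> p +
      w p^2 * \<delta> p)"
    using v2_ne \<kappa>_ne holo0_ne[OF hol(1) nz(1)] holo0_ne[OF hol(2) nz(2)]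
    by eventually_elim (simp add: s'_def \<gamma>_def \<delta>_def field_simps)
  obtain \<kappa>' where \<kappa>': "holo_at_0 \<kappa>'" "\<kappa>' 0 = 1"
    "\<forall>\<^sub>F p in nhds 0. \<forall>x y. \<kappa>' p * (x * y - q' p * (x^2 * \<gamma> p +
        y^2 * \<delta> p)) =
      (x - \<kappa>' p * q' p * \<delta> p * y) * (y - \<kappa>' p * q' p * \<gamma> p * x)"
    by (rule holo0_factor[OF hq'])
  define kz kw where "kz = (\<lambda>p. \<kappa>' p * \<delta> p * w p)"
      and "kw = (\<lambda>p. \<kappa>' p * \<gamma> p * z p)"
  have hk': "holo_at_0 kz" "holo_at_0 kw" "kz 0 = 0" "kw 0 = 0"
    unfolding kz_def kw_def by (auto intro!: holo0_mult \<kappa>' hq' hc simp: c0)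
  define Z W where "Z = (\<lambda>p. z p + (- kz p) * q' p)"
      and "W = (\<lambda>p. w p + (- kw p) * q' p)"
  have cZ: "coord_germ 3 Z" "coord_germ 4 W"
    unfolding Z_def W_def by (intro coord_germ_add cg holo0_minus hk' hq'; simp add: hk' hq')+
  then have hZ: "holo_at_0 Z" "holo_at_0 W" "Z 0 = 0" "W 0 = 0" by (auto simp: coord_germ_def)
  obtain T3 where T3: "holo_at_0 T3" "T3 0 = 0" "\<And>p. (Z p + kz p * q' p) ^ a = Z p ^ a +
      q' p * T3 p"
    by (rule holo0_pow_shift[OF hZ(1) hk'(1) hq'(1) hk'(3)]) blast
  obtain T4 where T4: "holo_at_0 T4" "T4 0 = 0" "\<And>p. (W p + kw p * q' p) ^ b = W p ^ b +
      q' p * T4 p"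
    by (rule holo0_pow_shift[OF hZ(2) hk'(2) hq'(1) hk'(4)]) blast
  have zZ: "z p = Z p + kz p * q' p" "w p = W p + kw p * q' p" for p by (simp_all add: Z_def W_def)
  have ZW: "\<forall>\<^sub>F p in nhds 0. Z p * W p =
      \<kappa>' p * (z p * w p - q' p * (z p^2 * \<gamma> p + w p^2 * \<delta> p))"
    using \<kappa>'(3)
  proof eventually_elim
    case (elim p)
    from elim[rule_format, of "z p" "w p"] show ?case
      by (simp add: Z_def W_def kz_def kw_def mult_ac)
  qed
  define P2 Q2 R3 S3 where "P2 = (\<lambda>p. \<kappa> p * P1 p / u p)"
      and "Q2 = (\<lambda>p. \<kappa> p * Q1 p / u p)"
    and "R3 = (\<lambda>p. \<kappa>' p * R1 p / v2 p)"
        and "S3 = (\<lambda>p. \<kappa>' p * S1 p / v2 p)"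
  note def2 = P2_def Q2_def R3_def S3_def
  have h2: "holo_at_0 P2" "holo_at_0 Q2" "holo_at_0 R3" "holo_at_0 S3"
    unfolding def2 using u0 v2(2) by (auto intro!: holo0_divide holo0_mult \<kappa>(1) \<kappa>'(1)
        h1 hu v2(1))
  have nz2: "P2 0 \<noteq> 0" "Q2 0 \<noteq> 0" "R3 0 \<noteq> 0" "S3 0 \<noteq> 0"
    using nz1 by (simp_all add: def2 u0 v2 \<kappa> \<kappa>')
  define u3 where "u3 = (\<lambda>p. 1 + P2 p * T3 p + Q2 p * T4 p)"
  have u3: "holo_at_0 u3" "u3 0 = 1"
    unfolding u3_def by (auto intro!: holo0_add holo0_mult h2 T3 T4 simp: T3 T4)
  have "K_equivalent (F1, F2) (\<lambda>p. u3 p * (X p * Y p) + P2 p * Z p ^ a + Q2 p * W p ^ b,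
      \<lambda>p. 1 * (Z p * W p) + R3 p * X p ^ c + S3 p * Y p ^ d)"
  proof (rule K_equivalentI[OF coordinate_change_id])
    show "holo_at_0 (\<lambda>p. \<kappa> p / u p)"
        "holo_at_0 (\<lambda>p. - (\<kappa> p / u p * s p))"
      "holo_at_0 (\<lambda>p. - (\<kappa>' p / v2 p * s' p))"
          "holo_at_0 (\<lambda>p. \<kappa>' p / v2 p)"
      using u0 v2(2) by (auto intro!: holo0_divide holo0_mult holo0_minus \<kappa>(1) \<kappa>'(1)
          hu v2(1) hs)
    show "\<forall>\<^sub>F p in nhds 0. u3 p * (X p * Y p) + P2 p * Z p ^ a + Q2 p * W p ^ b =
        \<kappa> p / u p * F1 p + - (\<kappa> p / u p * s p) * F2 p"
      using G1 XY su u_ne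
    proof eventually_elim
      case (elim p)
      have u: "u p \<noteq> 0" by (fact elim(4))
      have "\<kappa> p / u p * F1 p + - (\<kappa> p / u p * s p) * F2 p =
          \<kappa> p / u p * (F1 p - s p * F2 p)"
        by (simp add: algebra_simps)
      also have "\<dots> = \<kappa> p / u p * (u p * (x p * y p - q p * (x p^2 * \<alpha> p +
          y p^2 * \<beta> p)))
           + P2 p * z p^a + Q2 p * w p^b"
        unfolding elim(1) unfolding elim(3) by (simp add: q_def P2_def Q2_def algebra_simps)
      also have "\<kappa> p / u p * (u p * (x p * y p - q p * (x p^2 * \<alpha> p +
          y p^2 * \<beta> p))) = X p * Y p"
        unfolding elim(2) using u by simp
      also have "z p^a = Z p^a + q' p * T3 p" using T3(3)[of p] by (simp flip: zZ)
      also have "w p^b = W p^b + q' p * T4 p" using T4(3)[of p] by (simp flip: zZ)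
      finally show ?case by (simp add: u3_def q'_def algebra_simps)
    qed
    show "\<forall>\<^sub>F p in nhds 0. 1 * (Z p * W p) + R3 p * X p ^ c + S3 p * Y p ^ d =
        - (\<kappa>' p / v2 p * s' p) * F1 p + \<kappa>' p / v2 p * F2 p"
      using G2 ZW XY su' v2_ne \<kappa>_ne
    proof eventually_elim
      case (elim p)
      have u: "v2 p \<noteq> 0" "\<kappa> p \<noteq> 0" by (fact elim)+
      have "x p * y p = q' p / \<kappa> p + q p * (x p^2 * \<alpha> p + y p^2 * \<beta> p)"
        using elim(3) u by (simp add: q'_def field_simps)
      then have "x p * y p * s' p = s' p / \<kappa> p * q' p + q p * s' p * (x p^2 * \<alpha> p +
          y p^2 * \<beta> p)"
        by (simp add: algebra_simps)
      moreover have "x p^c = X p^c + q p * T1 p" using T1(3)[of p] by (simp flip: xX)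
      moreover have "y p^d = Y p^d + q p * T2 p" using T2(3)[of p] by (simp flip: xX)
      ultimately have "F2 p - s' p * F1 p = v2 p * (z p * w p) - s' p / \<kappa> p * q' p +
          X p^c * R1 p + Y p^d * S1 p"
        unfolding elim(1) v2_def q_def by (simp add: algebra_simps)
      moreover have "s' p / \<kappa> p = v2 p * (z p^2 * \<gamma> p + w p^2 * \<delta> p)"
          using elim(4) u by simp
      ultimately have A: "F2 p - s' p * F1 p =
          v2 p * (z p * w p - q' p * (z p^2 * \<gamma> p + w p^2 * \<delta> p)) + X p^c * R1 p + Y
              p^d * S1 p"
        by (simp add: algebra_simps)
      have "\<kappa>' p / v2 p * (B + X p^c * R1 p + Y p^d * S1 p) =
          \<kappa>' p / v2 p * B + R3 p * X p^c + S3 p * Y p^d" for B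
        using u by (simp add: R3_def S3_def field_simps)
      then have "\<kappa>' p / v2 p * (F2 p - s' p * F1 p) =
          \<kappa>' p / v2 p * (v2 p * (z p * w p - q' p * (z p^2 * \<gamma> p + w p^2 * \<delta>
              p))) + R3 p * X p^c + S3 p * Y p^d"
        unfolding A by this
      also have "\<kappa>' p / v2 p * (v2 p * (z p * w p - q' p * (z p^2 * \<gamma> p +
          w p^2 * \<delta> p))) = Z p * W p"
        unfolding elim(2) using u by simp
      finally show ?case by (simp add: algebra_simps)
    qed
  qed (simp add: u0 v2 \<kappa> \<kappa>' s0)
  moreover have "K_equivalent (\<lambda>p. u3 p * (X p * Y p) + P2 p * Z p ^ a + Q2 p * W p ^ b,
      \<lambda>p. 1 * (Z p * W p) + R3 p * X p ^ c + S3 p * Y p ^ d) (normal_form a b c d)"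
    by (rule K_equivalent_unit_coefficients) (use cX cZ h2 nz2 u3 pos ne in simp_all)
  ultimately show ?thesis by (rule K_equivalent_trans)
qed

section \<open>Weighted filtrations\<close>

text \<open>The polynomial functions all of whose monomials have weight at least \<open>K\<close>.
  Generating them inductively makes products and substitutions a matter of induction, without a
  choice of coefficients.\<close>

inductive wge :: "(4 \<Rightarrow> nat) \<Rightarrow> nat \<Rightarrow> (complex^4 \<Rightarrow>
    complex) \<Rightarrow> bool" for wt where
  zero: "wge wt K (\<lambda>p. 0)"
| const: "wge wt 0 (\<lambda>p. c)"
| coord: "wge wt (wt i) (\<lambda>p. p $ i)"
| add: "wge wt K f \<Longrightarrow> wge wt K g \<Longrightarrow> wge wt K (\<lambda>p. f p + g p)"
| mult: "wge wt K f \<Longrightarrow> wge wt L g \<Longrightarrow>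
    wge wt (K + L) (\<lambda>p. f p * g p)"
| mono: "wge wt K f \<Longrightarrow> L \<le> K \<Longrightarrow> wge wt L f"

lemma wge_mult: "wge wt K f \<Longrightarrow> wge wt L g \<Longrightarrow> M \<le> K +
    L \<Longrightarrow> wge wt M (\<lambda>p. f p * g p)"
  by (rule wge.mono[OF wge.mult])

lemma wge_cmult: "wge wt K f \<Longrightarrow> wge wt K (\<lambda>p. c * f p)"
  using wge.mult[OF wge.const[of wt c], of K f] by simp

lemma wge_minus: "wge wt K f \<Longrightarrow> wge wt K (\<lambda>p. - f p)"
  using wge_cmult[of wt K f "-1"] by simp

lemma wge_diff: "wge wt K f \<Longrightarrow> wge wt K g \<Longrightarrow>
    wge wt K (\<lambda>p. f p - g p)"
  using wge.add[OF _ wge_minus[of wt K g]] by simp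

lemma wge_0: "wge wt K f \<Longrightarrow> K > 0 \<Longrightarrow> f 0 = 0"
  by (induction rule: wge.induct) auto

lemma wge_holo0: "wge wt K f \<Longrightarrow> holo_at_0 f"
  by (induction rule: wge.induct) (simp_all add: holo0_add holo0_mult)

text \<open>Only the monomial \<open>p $ j\<close>, of weight \<open>wt j\<close>, contributes to
  this derivative at 0, and it is too light to occur.\<close>

lemma wge_pd_eq_0: "wge wt K f \<Longrightarrow> K > wt j \<Longrightarrow> pd f j 0 = 0"
proof (induction rule: wge.induct)
  case (coord i)
  then show ?case by (auto simp: pd_nth)
next
  case (add K f g)
  then show ?case by (simp add: pd_add holo0_cdiff[OF wge_holo0])
next
  case (mult K f L g)
  have A: "f 0 * pd g j 0 = 0"
    using wge_0[OF mult(1)] mult by (cases "K = 0") auto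
  have B: "pd f j 0 * g 0 = 0"
    using wge_0[OF mult(2)] mult by (cases "L = 0") auto
  have "pd (\<lambda>p. f p * g p) j 0 = f 0 * pd g j 0 + pd f j 0 * g 0"
    by (rule pd_mult[OF holo0_cdiff[OF wge_holo0[OF mult(1)]]
        holo0_cdiff[OF wge_holo0[OF mult(2)]]])
  then show ?case unfolding A B by simp
qed auto

definition rz :: "4 \<Rightarrow> complex^4 \<Rightarrow> complex^4" where
  "rz i p = (\<chi> j. if j = i then 0 else p $ j)"

lemma rz_nth [simp]: "rz i p $ j = (if j = i then 0 else p $ j)"
  by (simp add: rz_def)

definition ax :: "4 \<Rightarrow> complex^4 \<Rightarrow> complex^4" where
  "ax i p = (\<chi> j. if j = i then p $ j else 0)"

lemma ax_nth [simp]: "ax i p $ j = (if j = i then p $ j else 0)"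
  by (simp add: ax_def)

lemma wge_rz: "wge wt K f \<Longrightarrow> wge wt K (\<lambda>p. f (rz i p))"
proof (induction rule: wge.induct)
  case (coord j)
  show ?case by (cases "j = i") (simp_all add: wge.zero wge.coord)
qed (simp_all add: wge.zero wge.const wge.add wge.mult, rule wge.mono)

lemma wge_ax: "wge wt K f \<Longrightarrow> wge wt K (\<lambda>p. f (ax i p))"
proof (induction rule: wge.induct)
  case (coord j)
  show ?case by (cases "j = i") (simp_all add: wge.zero wge.coord)
qed (simp_all add: wge.zero wge.const wge.add wge.mult, rule wge.mono)

text \<open>Division by a coordinate; the remainder is the restriction to \<open>p $ i = 0\<close>.
  For \<open>K < wt i\<close> the truncated difference is 0, a bound that every function of this
  class satisfies.\<close>

lemma wge_divide:
  assumes "wge wt K f"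
  shows "\<exists>A. wge wt (K - wt i) A \<and> (\<forall>p. f p = p $ i * A p + f (rz i p))"
  using assms
proof (induction rule: wge.induct)
  case (zero K)
  show ?case by (rule exI[of _ "\<lambda>_. 0"]) (simp add: wge.zero)
next
  case (const c)
  show ?case by (rule exI[of _ "\<lambda>_. 0"]) (simp add: wge.zero)
next
  case (coord j)
  show ?case
    by (rule exI[of _ "\<lambda>_. if j = i then 1 else 0"]) (auto simp: wge.zero wge.const)
next
  case (add K f g)
  then obtain A B where "wge wt (K - wt i) A" "\<And>p. f p = p $ i * A p + f (rz i p)"
    "wge wt (K - wt i) B" "\<And>p. g p = p $ i * B p + g (rz i p)" by blast
  note AB = this
  have "wge wt (K - wt i) (\<lambda>p. A p + B p)" using AB(1,3) by (rule wge.add)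
  moreover have "f p + g p = p $ i * (A p + B p) + (f (rz i p) + g (rz i p))" for p
    using AB(2)[of p] AB(4)[of p] by (simp add: distrib_left)
  ultimately show ?case by blast
next
  case (mult K f L g)
  then obtain A B where AB: "wge wt (K - wt i) A" "\<And>p. f p = p $ i * A p + f (rz i p)"
    "wge wt (L - wt i) B" "\<And>p. g p = p $ i * B p + g (rz i p)" by blast
  have h1: "wge wt (K + L - wt i) (\<lambda>p. A p * g p + f (rz i p) * B p)"
    by (intro wge.add wge_mult[OF AB(1) mult(2)] wge_mult[OF wge_rz[OF mult(1)] AB(3)]) auto
  have h2: "f p * g p = p $ i * (A p * g p + f (rz i p) * B p) + f (rz i p) * g (rz i p)" for p
  proof -
    have "f p * g p = p $ i * A p * g p + f (rz i p) * g p"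
      by (simp only: AB(2)[of p] ring_distribs)
    also have "f (rz i p) * g p = f (rz i p) * (p $ i * B p + g (rz i p))"
      by (simp only: AB(4)[of p])
    finally show ?thesis by (simp add: algebra_simps)
  qed
  show ?case
    by (rule exI[of _ "\<lambda>p. A p * g p + f (rz i p) * B p"], rule conjI, rule h1, rule allI,
        rule h2)
next
  case (mono K f L)
  then obtain A where "wge wt (K - wt i) A" "\<And>p. f p = p $ i * A p + f (rz i p)" by blast
  moreover from this(1) have "wge wt (L - wt i) A" by (rule wge.mono) (use mono(2) in simp)
  ultimately show ?case by blast
qed

text \<open>If a substitution alters each coordinate by terms heavier by \<open>E\<close>, any
  polynomial changes by terms heavier by \<open>E\<close>. The two claims are proved together
  because the product rule for differences also needs the bound on
  \<open>f \<circ> \<phi>\<close>.\<close>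

lemma wge_subst:
  assumes "wge wt K f" "\<And>j. wge wt (wt j + E) (\<lambda>p. \<phi> p $ j - p $ j)"
  shows "wge wt (K + E) (\<lambda>p. f (\<phi> p) - f p) \<and> wge wt K (\<lambda>p. f (\<phi> p))"
  using assms(1)
proof (induction rule: wge.induct)
  case (coord j)
  have "wge wt (wt j) (\<lambda>p. (\<phi> p $ j - p $ j) + p $ j)"
    by (rule wge.add[OF wge.mono[OF assms(2)] wge.coord]) simp
  then show ?case using assms(2)[of j] by simp
next
  case (add K f g)
  have "wge wt (K + E) (\<lambda>p. (f (\<phi> p) - f p) + (g (\<phi> p) - g p))"
    using add by (intro wge.add) auto
  then show ?case using add by (auto intro: wge.add simp: algebra_simps)
next
  case (mult K f L g)
  have "wge wt (K + L + E) (\<lambda>p. f (\<phi> p) * (g (\<phi> p) - g p) +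
      (f (\<phi> p) - f p) * g p)"
    by (intro wge.add wge_mult[OF conjunct2[OF mult.IH(1)] conjunct1[OF mult.IH(2)]]
      wge_mult[OF conjunct1[OF mult.IH(1)] mult(2)]) auto
  moreover have "(\<lambda>p. f (\<phi> p) * (g (\<phi> p) - g p) + (f (\<phi> p) - f p) * g p) =
      (\<lambda>p. f (\<phi> p) * g (\<phi> p) - f p * g p)" by (auto simp: algebra_simps)
  moreover have "wge wt (K + L) (\<lambda>p. f (\<phi> p) * g (\<phi> p))" using mult.IH
      by (auto intro: wge.mult)
  ultimately show ?case by simp
next
  case (mono K f L)
  then show ?case by (auto intro: wge.mono)
qed (simp_all add: wge.zero wge.const)

text \<open>Explicit sums of monomials. Divisibility by powers must be read off from single
  monomials, which \<open>wge\<close> does not display.\<close>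

inductive mspan :: "(4 \<Rightarrow> nat) \<Rightarrow> nat \<Rightarrow> (complex^4 \<Rightarrow>
    complex) \<Rightarrow> bool" for wt K where
  mzero: "mspan wt K (\<lambda>p. 0)"
| mstep: "K \<le> (\<Sum>i\<in>UNIV. n i * wt i) \<Longrightarrow> mspan wt K f \<Longrightarrow>
    mspan wt K (\<lambda>p. c * (\<Prod>i\<in>UNIV. p $ i ^ n i) + f p)"

lemma mspan_add: "mspan wt K f \<Longrightarrow> mspan wt K g \<Longrightarrow>
    mspan wt K (\<lambda>p. f p + g p)"
proof (induction rule: mspan.induct)
  case (mstep n f c)
  then have "mspan wt K (\<lambda>p. c * (\<Prod>i\<in>UNIV. p $ i ^ n i) + (f p + g p))"
    by (intro mspan.mstep) auto
  then show ?case by (simp add: add.assoc)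
qed simp

lemma mspan_mono: "mspan wt K f \<Longrightarrow> L \<le> K \<Longrightarrow> mspan wt L f"
  by (induction rule: mspan.induct) (auto intro: mspan.intros)

lemma mspan_monomial: "K \<le> (\<Sum>i\<in>UNIV. n i * wt i) \<Longrightarrow>
    mspan wt K (\<lambda>p. c * (\<Prod>i\<in>UNIV. p $ i ^ n i))"
  using mspan.mstep[OF _ mspan.mzero, where n=n and wt=wt and c=c] by simp

lemma mspan_mult_monomial:
  "mspan wt K f \<Longrightarrow> L \<le> (\<Sum>i\<in>UNIV. n i * wt i) \<Longrightarrow>
    mspan wt (L + K) (\<lambda>p. c * (\<Prod>i\<in>UNIV. p $ i ^ n i) * f p)"
proof (induction rule: mspan.induct)
  case (mstep m f c')
  have "mspan wt (L + K) (\<lambda>p. (c * c') * (\<Prod>i\<in>UNIV. p $ i ^ (n i + m i)) +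
      c * (\<Prod>i\<in>UNIV. p $ i ^ n i) * f p)"
    using mstep by (intro mspan.mstep) (auto simp: algebra_simps sum.distrib)
  then show ?case by (simp add: algebra_simps power_add prod.distrib)
qed (simp add: mspan.mzero)

lemma mspan_mult: "mspan wt K f \<Longrightarrow> mspan wt L g \<Longrightarrow>
    mspan wt (K + L) (\<lambda>p. f p * g p)"
proof (induction rule: mspan.induct)
  case (mstep n f c)
  have "mspan wt (K + L) (\<lambda>p. c * (\<Prod>i\<in>UNIV. p $ i ^ n i) * g p + f p * g p)"
    by (rule mspan_add[OF mspan_mult_monomial mstep.IH]) (use mstep in auto)
  then show ?case by (simp add: algebra_simps)
qed (simp add: mspan.mzero)

lemma wge_mspan: "wge wt K f \<Longrightarrow> mspan wt K f"
proof (induction rule: wge.induct)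
  case (const c)
  show ?case using mspan_monomial[where K=0 and n="\<lambda>_. 0" and wt=wt and c=c] by simp
next
  case (coord i)
  show ?case using mspan_monomial[where K="wt i" and n="\<lambda>j. if j = i then 1 else 0"
      and wt=wt and c=1]
    by (simp add: if_distrib if_distribR cong: if_cong)
qed (auto intro: mspan.intros mspan_add mspan_mult mspan_mono)

text \<open>A monomial with every exponent \<open>n i\<close> below \<open>m i\<close> would weigh
  at most the sum of the \<open>m i * wt i\<close>. So each monomial of \<open>f\<close> is
  divisible by some \<open>p $ i ^ m i\<close>.\<close>

lemma wge_ideal:
  assumes "wge wt K f" "K > (\<Sum>i\<in>UNIV. m i * wt i)"
  shows "\<exists>A. (\<forall>i. holo_at_0 (A i)) \<and>
      (\<forall>p. f p = (\<Sum>i\<in>UNIV. p $ i ^ m i * A i p))"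
  using wge_mspan[OF assms(1)] assms(2)
proof (induction rule: mspan.induct)
  case mzero
  show ?case by (rule exI[of _ "\<lambda>_ _. 0"]) simp
next
  case (mstep n f c)
  then obtain A where A: "\<And>i. holo_at_0 (A i)" "\<And>p. f p =
      (\<Sum>i\<in>UNIV. p $ i ^ m i * A i p)" by blast
  have "\<exists>i. m i \<le> n i"
  proof (rule ccontr)
    assume "\<not> (\<exists>i. m i \<le> n i)"
    then have "(\<Sum>i\<in>UNIV. n i * wt i) \<le> (\<Sum>i\<in>UNIV. m i * wt i)"
      by (intro sum_mono mult_right_mono) (auto simp: not_le less_imp_le)
    with mstep show False by linarith
  qed
  then obtain i where i: "m i \<le> n i" by blast
  define r
      where "r =
      (\<lambda>p :: complex^4. c * (p $ i ^ (n i - m i) * (\<Prod>j\<in>UNIV - {i}. p $ j ^ n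
      j)))"
  have "holo_at_0 (\<lambda>p :: complex^4. \<Prod>j\<in>J. p $ j ^ n j)" for J
    by (induction J rule: infinite_finite_induct) (auto intro!: holo0_mult holo0_power)
  then have r: "holo_at_0 r" unfolding r_def by (intro holo0_mult holo0_const holo0_power holo0_nth)
  have rp: "c * (\<Prod>j\<in>UNIV. p $ j ^ n j) = p $ i ^ m i * r p" for p :: "complex^4"
  proof -
    have "(\<Prod>j\<in>UNIV. p $ j ^ n j) = p $ i ^ n i * (\<Prod>j\<in>UNIV - {i}. p $ j ^ n j)"
      by (rule prod.remove) auto
    also have "p $ i ^ n i = p $ i ^ m i * p $ i ^ (n i - m i)" using i by (simp flip: power_add)
    finally show ?thesis by (simp add: r_def)
  qed
  show ?case
  proof (rule exI[of _ "A(i := \<lambda>p. A i p + r p)"], intro conjI allI)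
    show "holo_at_0 ((A(i := \<lambda>p. A i p + r p)) j)" for j using A(1) r
        by (auto intro: holo0_add)
    fix p :: "complex^4"
    have "(\<Sum>j\<in>UNIV. p $ j ^ m j * (A(i := \<lambda>p. A i p + r p)) j p) =
        (\<Sum>j\<in>UNIV. p $ j ^ m j * A j p + (if j = i then p $ i ^ m i * r p else 0))"
      by (rule sum.cong) (auto simp: algebra_simps)
    then show "c * (\<Prod>j\<in>UNIV. p $ j ^ n j) + f p =
        (\<Sum>j\<in>UNIV. p $ j ^ m j * (A(i := \<lambda>p. A i p + r p)) j p)"
      by (simp add: sum.distrib rp A(2))
  qed
qed

text \<open>On the axis only powers of \<open>p $ i\<close> survive, and weight above
  \<open>m * wt i\<close> forces exponent at least \<open>Suc m\<close>.\<close>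

lemma wge_axis:
  assumes "wge wt K f" "K > m * wt i"
  shows "\<exists>r. holo_at_0 r \<and> (\<forall>p. f (ax i p) = p $ i ^ Suc m * r p)"
  using wge_mspan[OF assms(1)] assms(2)
proof (induction rule: mspan.induct)
  case mzero
  show ?case by (rule exI[of _ "\<lambda>_. 0"]) simp
next
  case (mstep n f c)
  then obtain r where r: "holo_at_0 r" "\<And>p. f (ax i p) = p $ i ^ Suc m * r p" by blast
  have pr: "(\<Prod>j\<in>UNIV. ax i p $ j ^ n j) =
      p $ i ^ n i * (\<Prod>j\<in>UNIV - {i}. 0 ^ n j)" for p
    by (subst prod.remove[of _ i]) (auto intro!: prod.cong)
  show ?case
  proof (cases "\<forall>j. j \<noteq> i \<longrightarrow> n j = 0")
    case True
    then have "(\<Sum>j\<in>UNIV. n j * wt j) = n i * wt i"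
      by (subst sum.remove[of _ i]) auto
    with mstep have "m * wt i < n i * wt i" by linarith
    then have "Suc m \<le> n i" by (metis mult_less_cancel2 Suc_leI)
    then have *: "p $ i ^ n i = p $ i ^ Suc m * p $ i ^ (n i - Suc m)" for p :: "complex^4"
      by (metis le_add_diff_inverse power_add)
    have "(\<Prod>j\<in>UNIV - {i}. 0 ^ n j) = (1 :: complex)" using True
        by (intro prod.neutral) auto
    then have "c * (\<Prod>j\<in>UNIV. ax i p $ j ^ n j) + f (ax i p) =
        p $ i ^ Suc m * (c * p $ i ^ (n i - Suc m) + r p)" for p
      unfolding pr r(2) using *[of p] by (simp add: algebra_simps)
    moreover have "holo_at_0 (\<lambda>p. c * p $ i ^ (n i - Suc m) + r p)"
      by (intro holo0_add holo0_mult holo0_power r holo0_const holo0_nth)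
    ultimately show ?thesis by blast
  next
    case False
    then obtain j where "j \<noteq> i" "n j \<noteq> 0" by blast
    then have z: "(\<Prod>j\<in>UNIV - {i}. 0 ^ n j) = (0 :: complex)" by (intro prod_zero) auto
    show ?thesis unfolding pr z mult_zero_right add_0_left using r by blast
  qed
qed

text \<open>Terms divisible by \<open>p $ i1\<close> are split off, then those divisible by
  \<open>p $ i2\<close>, then the mixed terms in the last two coordinates; pure powers of these are
  left. Abstract indices allow both equations to be treated.\<close>

lemma wge_decompose:
  assumes "wge wt K f" "K > 0"
    and i: "i1 \<noteq> i2" "i3 \<noteq> i4" "i1 \<noteq> i3" "i1 \<noteq> i4" "i2 \<noteq> i3"
        "i2 \<noteq> i4"
    and cover: "\<And>j. j = i1 \<or> j = i2 \<or> j = i3 \<or> j = i4"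
  obtains A B C where "wge wt (K - wt i1) A" "wge wt (K - wt i2) B" "wge wt (K - wt i3 - wt i4) C"
    "\<And>p. f p = p$i1 * A p + p$i2 * B p + p$i3 * p$i4 * C p + f (ax i3 p) + f (ax i4 p)"
proof -
  obtain A where A: "wge wt (K - wt i1) A" "\<And>p. f p = p $ i1 * A p + f (rz i1 p)"
    using wge_divide[OF assms(1)] by metis
  define f1 where "f1 = (\<lambda>p. f (rz i1 p))"
  have f1: "wge wt K f1" unfolding f1_def by (rule wge_rz[OF assms(1)])
  obtain B where B: "wge wt (K - wt i2) B" "\<And>p. f1 p = p $ i2 * B p + f1 (rz i2 p)"
    using wge_divide[OF f1] by metis
  define f2 where "f2 = (\<lambda>p. f1 (rz i2 p))"
  have f2: "wge wt K f2" unfolding f2_def by (rule wge_rz[OF f1])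
  obtain D where D: "wge wt (K - wt i3) D" "\<And>p. f2 p = p $ i3 * D p + f2 (rz i3 p)"
    using wge_divide[OF f2] by metis
  obtain C where C: "wge wt (K - wt i3 - wt i4) C" "\<And>p. D p = p $ i4 * C p + D (rz i4 p)"
    using wge_divide[OF D(1)] by metis
  have "rz i1 (rz i2 (rz i3 p)) = ax i4 p" "rz i1 (rz i2 (rz i4 p)) = ax i3 p"
    "rz i1 (rz i2 (rz i3 (rz i4 p))) = 0" for p
    using i cover by (auto simp: vec_eq_iff)
  then have f2e: "f2 (rz i3 p) = f (ax i4 p)" "f2 (rz i4 p) = f (ax i3 p)" "f2 (rz i3 (rz i4 p)) =
      f 0" for p
    unfolding f2_def f1_def by simp_all
  then have "p $ i3 * D (rz i4 p) = f (ax i3 p)" for p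
    using D(2)[of "rz i4 p"] wge_0[OF assms(1,2)] i by (simp add: f2e)
  then have "p $ i3 * D p = p $ i3 * p $ i4 * C p + f (ax i3 p)" for p
    unfolding C(2)[of p] distrib_left by simp
  moreover have "f p = p $ i1 * A p + f1 p" for p unfolding f1_def by (rule A(2))
  moreover have "f1 p = p $ i2 * B p + f2 p" for p unfolding f2_def by (rule B(2))
  ultimately have "f p = p$ i1 * A p + p$ i2 * B p + p$ i3 * p$ i4 * C p + f (ax i3 p) +
      f (ax i4 p)" for p
    using D(2)[of p] by (simp add: f2e)
  with A(1) B(1) C(1) show thesis by (rule that)
qed

text \<open>At 0 the \<open>i\<close>-th coordinate of \<open>\<phi>\<close> has, besides
  \<open>p $ i\<close>, only linear terms in coordinates heavier than \<open>p $ i\<close>: the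
  Jacobian is unipotent when ordered by weight. A kernel vector is refuted at a nonzero entry of
  maximal weight.\<close>

lemma wge_coordinate_change:
  assumes "\<And>j. wge wt (wt j + E) (\<lambda>p. \<phi> p $ j - p $ j)" "E > 0"
  shows "coordinate_change_at_0 \<phi>"
proof (rule coordinate_changeI)
  define \<delta> where "\<delta> = (\<lambda>j p. \<phi> p $ j - p $ j)"
  have d: "wge wt (wt j + E) (\<delta> j)" for j using assms(1) by (simp add: \<delta>_def)
  have \<phi>: "(\<lambda>p. \<phi> p $ j) = (\<lambda>p. p $ j + \<delta> j p)" for j
      by (simp add: \<delta>_def)
  show "holo_at_0 (\<lambda>p. \<phi> p $ j)" for j
    unfolding \<phi> by (intro holo0_add holo0_nth wge_holo0[OF d])
  have "\<delta> j 0 = 0" for j by (rule wge_0[OF d]) (use assms(2) in simp)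
  then show "\<phi> 0 = 0" by (simp add: \<delta>_def vec_eq_iff)
  fix h :: "complex^4"
  assume h: "\<And>i. (\<Sum>j\<in>UNIV. h $ j * pd (\<lambda>p. \<phi> p $ i) j 0) = 0"
  show "h = 0"
  proof (rule ccontr)
    assume "h \<noteq> 0"
    then have ne: "wt ` {j. h $ j \<noteq> 0} \<noteq> {}" by (auto simp: vec_eq_iff)
    have "Max (wt ` {j. h $ j \<noteq> 0}) \<in> wt ` {j. h $ j \<noteq> 0}"
        by (rule Max_in) (use ne in auto)
    then obtain i where i: "h $ i \<noteq> 0" "wt i = Max (wt ` {j. h $ j \<noteq> 0})" by auto
    have le: "wt j \<le> wt i" if "h $ j \<noteq> 0" for j
      unfolding i(2) using that by (intro Max_ge) auto
    have "h $ j * pd (\<lambda>p. \<phi> p $ i) j 0 = (if j = i then h $ i else 0)" for j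
    proof (cases "h $ j = 0")
      case False
      then have "pd (\<delta> i) j 0 = 0"
        using le[OF False] assms(2) by (intro wge_pd_eq_0[OF d]) auto
      then show ?thesis
        unfolding \<phi> by (simp add: pd_add pd_nth holo0_cdiff[OF wge_holo0[OF d]])
    qed (use i in auto)
    then have "(\<Sum>j\<in>UNIV. h $ j * pd (\<lambda>p. \<phi> p $ i) j 0) = h $ i" by simp
    with h i show False by simp
  qed
qed

lemma K_equivalent_subst:
  fixes \<phi> :: "complex^4 \<Rightarrow> complex^4"
  assumes "coordinate_change_at_0 \<phi>" "holo_at_0 C" "holo_at_0 C'" "C 0 = 0 \<or> C' 0 = 0"
    and "\<And>p. E1 p = F1 (\<phi> p) - C p * F2 (\<phi> p)" "\<And>p. E2 p =
        F2 (\<phi> p) - C' p * F1 (\<phi> p)"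
  shows "K_equivalent (F1, F2) (E1, E2)"
proof -
  have "K_equivalent (\<lambda>p. F1 (\<phi> p), \<lambda>p. F2 (\<phi> p)) (F1, F2)"
    by (rule K_equivalentI[of \<phi> "\<lambda>_. 1" "\<lambda>_. 0" "\<lambda>_. 0"
        "\<lambda>_. 1", OF assms(1)]) simp_all
  moreover have "K_equivalent (\<lambda>p. F1 (\<phi> p), \<lambda>p. F2 (\<phi> p)) (E1, E2)"
    by (rule K_equivalentI[of "\<lambda>p. p" "\<lambda>_. 1" "\<lambda>p. - C p"
        "\<lambda>p. - C' p" "\<lambda>_. 1",
      OF coordinate_change_id]) (use assms(2-) in \<open>auto intro: holo0_minus\<close>)
  ultimately show ?thesis using K_equivalent_sym K_equivalent_trans by blast
qed

text \<open>\<open>e\<close> bounds the excess of the weight over that of \<open>x*y\<close> resp. \<open>z*w\<close>; removing all terms of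
  excess \<open>n*e\<close> other than powers of one coordinate leaves an error of excess \<open>(n+1)*e\<close>.\<close>

locale weighted_pair =
  fixes wt :: "4 \<Rightarrow> nat" and e a b c d :: nat
  assumes e: "e > 0"
    and abcd: "a > 0" "b > 0" "c > 0" "d > 0" "(a + b) * (c + d) \<noteq> a * b * c * d"
    and excess: "a * wt 3 < wt 1 + wt 2 + 2 * e" "b * wt 4 < wt 1 + wt 2 + 2 * e"
      "c * wt 1 < wt 3 + wt 4 + 2 * e" "d * wt 2 < wt 3 + wt 4 + 2 * e"
begin

definition leading :: "4 \<Rightarrow> nat \<Rightarrow> (complex^4 \<Rightarrow> complex)
    \<Rightarrow> bool" where
  "leading i k F \<longleftrightarrow> (\<exists>G. holo_at_0 G \<and> G 0 \<noteq> 0 \<and>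
      (\<forall>p. F (ax i p) = p $ i ^ k * G p))"

lemma leading_add:
  assumes "leading i k F" "wge wt K r" "K > k * wt i" "\<And>p. E (ax i p) = F (ax i p) +
      r (ax i p)"
  shows "leading i k E"
proof -
  obtain G where G: "holo_at_0 G" "G 0 \<noteq> 0" "\<And>p. F (ax i p) = p $ i ^ k * G p"
    using assms(1) unfolding leading_def by blast
  obtain r' where r': "holo_at_0 r'" "\<And>p. r (ax i p) = p $ i ^ Suc k * r' p"
    using wge_axis[OF assms(2,3)] by blast
  have "holo_at_0 (\<lambda>p. G p + p $ i * r' p)" by (intro holo0_add holo0_mult G r' holo0_nth)
  then show ?thesis unfolding leading_def
    by (intro exI[of _ "\<lambda>p. G p + p $ i * r' p"]) (simp add: G assms(4) r' algebra_simps)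
qed

lemma ax_ax [simp]: "i \<noteq> j \<Longrightarrow> ax i (ax j p) = 0" "ax i (ax i p) = ax i p"
  by (auto simp: vec_eq_iff)

text \<open>\<open>g3\<close>, \<open>g4\<close>, \<open>g1\<close>, \<open>g2\<close> enter through
  \<open>ax\<close> only, so they stand for pure powers, which are tolerated at any excess from
  \<open>e\<close> on. Everything else has reached excess \<open>n * e\<close>.\<close>

definition partially_normal :: "nat \<Rightarrow> (complex^4 \<Rightarrow> complex) \<Rightarrow>
    (complex^4 \<Rightarrow> complex) \<Rightarrow> bool" where
  "partially_normal n F1 F2 \<longleftrightarrow>
    leading 3 a F1 \<and> leading 4 b F1 \<and> leading 1 c F2 \<and> leading 2 d F2 \<and>
    (\<exists>g3 g4 f1. wge wt (wt 1 + wt 2 + e) g3 \<and> wge wt (wt 1 + wt 2 + e) g4 \<and>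
       wge wt (wt 1 + wt 2 + n * e) f1 \<and> F1 = (\<lambda>p. p$1 * p$2 + g3 (ax 3 p) + g4
           (ax 4 p) + f1 p)) \<and>
    (\<exists>g1 g2 f2. wge wt (wt 3 + wt 4 + e) g1 \<and> wge wt (wt 3 + wt 4 + e) g2 \<and>
       wge wt (wt 3 + wt 4 + n * e) f2 \<and> F2 = (\<lambda>p. p$3 * p$4 + g1 (ax 1 p) + g2
           (ax 2 p) + f2 p))"

text \<open>One round for one equation, with indices left open so that it applies to both. The
  shifts by \<open>B\<close> and \<open>A\<close> cancel \<open>p$i1 * A\<close> and
  \<open>p$i2 * B\<close>, and \<open>C * F2\<close> cancels the mixed term. The new error
  \<open>r\<close> consists of \<open>A * B\<close> and of changes caused by the substitution or by
  the tail of \<open>F2\<close>; each gains at least another \<open>e\<close>.\<close>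

lemma remove_error:
  assumes i: "i1 \<noteq> i2" "i3 \<noteq> i4" "i1 \<noteq> i3" "i1 \<noteq> i4" "i2 \<noteq> i3"
      "i2 \<noteq> i4" and n: "n \<ge> 1"
    and \<phi>: "\<And>j. wge wt (wt j + n * e) (\<lambda>p. \<phi> p $ j - p $ j)"
      "\<And>p. \<phi> p $ i1 = p $ i1 - B p" "\<And>p. \<phi> p $ i2 = p $ i2 - A p"
    and g: "wge wt (wt i1 + wt i2 + e) g3" "wge wt (wt i1 + wt i2 + e) g4"
    and f1: "wge wt (wt i1 + wt i2 + n * e) f1"
    and F1: "F1 = (\<lambda>p. p$i1 * p$i2 + g3 (ax i3 p) + g4 (ax i4 p) + f1 p)"
    and f1_eq: "\<And>p. f1 p = p$i1 * A p + p$i2 * B p + p$i3 * p$i4 * C p + f1 (ax i3 p) +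
        f1 (ax i4 p)"
    and C: "wge wt (wt i1 + wt i2 + n * e - wt i3 - wt i4) C"
    and F2: "wge wt (wt i3 + wt i4 + e) (\<lambda>p. F2 p - p$i3 * p$i4)"
    and lead: "leading i3 a' F1" "leading i4 b' F1"
    and exc: "a' * wt i3 < wt i1 + wt i2 + 2 * e" "b' * wt i4 < wt i1 + wt i2 + 2 * e"
    and E1: "E1 = (\<lambda>p. F1 (\<phi> p) - C p * F2 (\<phi> p))"
  shows "leading i3 a' E1" "leading i4 b' E1"
    "\<exists>g3 g4 f1. wge wt (wt i1 + wt i2 + e) g3 \<and> wge wt (wt i1 + wt i2 + e) g4 \<and>
       wge wt (wt i1 + wt i2 + Suc n * e) f1 \<and> E1 = (\<lambda>p. p$i1 * p$i2 + g3 (ax i3 p) +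
           g4 (ax i4 p) + f1 p)"
proof -
  let ?w1 = "wt i1 + wt i2" and ?w2 = "wt i3 + wt i4"
  have ne: "e \<le> n * e" using n by simp
  define r where "r = (\<lambda>p. A p * B p + (g3 (ax i3 (\<phi> p)) - g3 (ax i3 p)) +
      (g4 (ax i4 (\<phi> p)) - g4 (ax i4 p))
     + (f1 (\<phi> p) - f1 p) - C p * ((F2 (\<phi> p) - F2 p) + (F2 p - p$i3 * p$i4)))"
  have AB: "wge wt (wt i2 + n * e) A" "wge wt (wt i1 + n * e) B"
    using wge_minus[OF \<phi>(1)[of i1]] wge_minus[OF \<phi>(1)[of i2]] \<phi>(2,3) by simp_all
  have F2w: "wge wt ?w2 F2"
  proof -
    have "wge wt ?w2 (\<lambda>p. (F2 p - p$i3 * p$i4) + p$i3 * p$i4)"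
      by (intro wge.add wge.mono[OF F2] wge.mult wge.coord) simp
    then show ?thesis by simp
  qed
  have s: "wge wt (K + n * e) (\<lambda>p. f (\<phi> p) - f p)" if "wge wt K f" for K f
    using wge_subst[OF that \<phi>(1)] by blast
  have "wge wt (?w1 + Suc n * e) r"
    unfolding r_def
  proof (rule wge_diff, rule wge.add, rule wge.add, rule wge.add)
    show "wge wt (?w1 + Suc n * e) (\<lambda>p. A p * B p)"
      by (rule wge_mult[OF AB]) (use ne in simp)
    show "wge wt (?w1 + Suc n * e) (\<lambda>p. g3 (ax i3 (\<phi> p)) - g3 (ax i3 p))"
      by (rule wge.mono[OF s[OF wge_ax[OF g(1)]]]) simp
    show "wge wt (?w1 + Suc n * e) (\<lambda>p. g4 (ax i4 (\<phi> p)) - g4 (ax i4 p))"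
      by (rule wge.mono[OF s[OF wge_ax[OF g(2)]]]) simp
    show "wge wt (?w1 + Suc n * e) (\<lambda>p. f1 (\<phi> p) - f1 p)"
      by (rule wge.mono[OF s[OF f1]]) (use ne in simp)
    have "wge wt (?w2 + e) (\<lambda>p. (F2 (\<phi> p) - F2 p) + (F2 p - p$i3 * p$i4))"
      by (intro wge.add F2 wge.mono[OF s[OF F2w]]) (use ne in simp)
    then show "wge wt (?w1 + Suc n * e) (\<lambda>p. C p * ((F2 (\<phi> p) - F2 p) +
        (F2 p - p$i3 * p$i4)))"
      by (rule wge_mult[OF C]) simp
  qed
  note r = this
  have E1_eq: "E1 p = p$i1 * p$i2 + (g3 (ax i3 p) + f1 (ax i3 p)) + (g4 (ax i4 p) + f1 (ax i4 p)) +
      r p" for p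
  proof -
    have "E1 p = (p$i1 - B p) * (p$i2 - A p) + g3 (ax i3 (\<phi> p)) + g4 (ax i4 (\<phi> p)) +
        f1 (\<phi> p) - C p * F2 (\<phi> p)"
      unfolding E1 F1 by (simp add: \<phi>(2,3))
    also have "\<dots> = p$i1 * p$i2 + g3 (ax i3 p) + g4 (ax i4 p) + r p +
        (f1 p - p$i1 * A p - p$i2 * B p - p$i3 * p$i4 * C p)"
      by (simp add: r_def algebra_simps)
    also have "f1 p - p$i1 * A p - p$i2 * B p - p$i3 * p$i4 * C p = f1 (ax i3 p) + f1 (ax i4 p)"
      using f1_eq[of p] by (simp add: algebra_simps)
    finally show ?thesis by simp
  qed
  have z: "g3 0 = 0" "g4 0 = 0" "f1 0 = 0" using wge_0[OF g(1)] wge_0[OF g(2)] wge_0[OF f1] e n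
      by simp_all
  \<comment> \<open>Because \<open>n \<ge> 1\<close>, the new error has excess at least
    \<open>2 * e\<close>. The bounds \<open>exc\<close> place it beyond the leading powers, which
    therefore keep their nonzero coefficients.\<close>
  have gt: "a' * wt i3 < ?w1 + Suc n * e" "b' * wt i4 < ?w1 + Suc n * e"
    using exc mult_le_mono1[of 2 "Suc n" e] n by linarith+
  have E3: "E1 (ax i3 p) = F1 (ax i3 p) + r (ax i3 p)" "E1 (ax i4 p) = F1 (ax i4 p) + r (ax i4 p)"
      for p
    unfolding E1_eq F1 using i z by simp_all
  show "leading i3 a' E1" "leading i4 b' E1"
    by (rule leading_add[OF lead(1) r gt(1) E3(1)], rule leading_add[OF lead(2) r gt(2) E3(2)])
  show "\<exists>g3 g4 f1. wge wt (wt i1 + wt i2 + e) g3 \<and> wge wt (wt i1 + wt i2 + e) g4 \<and>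
       wge wt (wt i1 + wt i2 + Suc n * e) f1 \<and> E1 = (\<lambda>p. p$i1 * p$i2 + g3 (ax i3 p) +
           g4 (ax i4 p) + f1 p)"
  proof (intro exI conjI)
    have f1': "wge wt (?w1 + e) f1" by (rule wge.mono[OF f1]) (use ne in simp)
    show "wge wt (?w1 + e) (\<lambda>p. g3 p + f1 p)" "wge wt (?w1 + e) (\<lambda>p. g4 p + f1 p)"
      by (rule wge.add[OF g(1) f1'], rule wge.add[OF g(2) f1'])
    show "wge wt (?w1 + Suc n * e) r" by (fact r)
    show "E1 = (\<lambda>p. p$i1 * p$i2 + (g3 (ax i3 p) + f1 (ax i3 p)) +
        (g4 (ax i4 p) + f1 (ax i4 p)) + r p)"
      by (rule ext) (rule E1_eq)
  qed
qed

lemma partially_normal_step: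
  assumes "partially_normal n F1 F2" "n \<ge> 1"
  shows "\<exists>E1 E2. partially_normal (Suc n) E1 E2 \<and> K_equivalent (F1, F2) (E1, E2)"
proof -
  let ?w1 = "wt 1 + wt 2" and ?w2 = "wt 3 + wt 4"
  have ne: "e \<le> n * e" "n * e > 0" using assms(2) e by simp_all
  have lead: "leading 3 a F1" "leading 4 b F1" "leading 1 c F2" "leading 2 d F2"
    using assms(1) by (auto simp: partially_normal_def)
  obtain g3 g4 f1 where g: "wge wt (?w1 + e) g3" "wge wt (?w1 + e) g4"
      and f1: "wge wt (?w1 + n * e) f1"
    and F1: "F1 = (\<lambda>p. p$1 * p$2 + g3 (ax 3 p) + g4 (ax 4 p) + f1 p)"
    using assms(1) unfolding partially_normal_def by blast
  obtain g1 g2 f2 where g': "wge wt (?w2 + e) g1" "wge wt (?w2 + e) g2"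
      and f2: "wge wt (?w2 + n * e) f2"
    and F2: "F2 = (\<lambda>p. p$3 * p$4 + g1 (ax 1 p) + g2 (ax 2 p) + f2 p)"
    using assms(1) unfolding partially_normal_def by blast
  have exh': "j = 3 \<or> j = 4 \<or> j = 1 \<or> j = 2" for j :: 4 using exhaust_4[of j] by blast
  have exh: "j = 1 \<or> j = 2 \<or> j = 3 \<or> j = 4" for j :: 4 by (rule exhaust_4)
  obtain A B C where A: "wge wt (?w1 + n * e - wt 1) A" and B: "wge wt (?w1 + n * e - wt 2) B"
    and C: "wge wt (?w1 + n * e - wt 3 - wt 4) C"
    and f1_eq: "\<And>p. f1 p = p$1 * A p + p$2 * B p + p$3 * p$4 * C p + f1 (ax 3 p) + f1 (ax 4 p)"
    by (rule wge_decompose[OF f1 _ _ _ _ _ _ _ exh])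
      (use ne(2) in simp, simp, simp, simp, simp, simp, simp, rule that)
  obtain A' B' C' where A': "wge wt (?w2 + n * e - wt 3) A'"
      and B': "wge wt (?w2 + n * e - wt 4) B'"
    and C': "wge wt (?w2 + n * e - wt 1 - wt 2) C'"
    and f2_eq: "\<And>p. f2 p = p$3 * A' p + p$4 * B' p + p$1 * p$2 * C' p + f2 (ax 1 p) +
        f2 (ax 2 p)"
    by (rule wge_decompose[OF f2 _ _ _ _ _ _ _ exh'])
      (use ne(2) in simp, simp, simp, simp, simp, simp, simp, rule that)
  define \<phi> :: "complex^4 \<Rightarrow> complex^4"
    where "\<phi> = (\<lambda>p. vector [p$1 - B p, p$2 - A p, p$3 - B' p, p$4 - A' p])"
  have \<phi>_nth: "\<phi> p $ 1 = p$1 - B p" "\<phi> p $ 2 = p$2 - A p" "\<phi> p $ 3 = p$3 - B' p"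
      "\<phi> p $ 4 = p$4 - A' p" for p
    by (simp_all add: \<phi>_def)
  have \<phi>: "wge wt (wt j + n * e) (\<lambda>p. \<phi> p $ j - p $ j)" for j
    using exh[of j] wge_minus[OF A] wge_minus[OF B] wge_minus[OF A'] wge_minus[OF B']
    by (auto simp: \<phi>_nth)
  define E1 E2 where "E1 = (\<lambda>p. F1 (\<phi> p) - C p * F2 (\<phi> p))"
      and "E2 = (\<lambda>p. F2 (\<phi> p) - C' p * F1 (\<phi> p))"
  have w2: "wge wt (?w2 + e) (\<lambda>p. F2 p - p$3 * p$4)"
    unfolding F2 using wge.add[OF wge.add[OF wge_ax[OF g'(1), of 1] wge_ax[OF g'(2), of 2]]
        wge.mono[OF f2, of "?w2 + e"]] ne
    by (simp add: algebra_simps)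
  have w1: "wge wt (?w1 + e) (\<lambda>p. F1 p - p$1 * p$2)"
    unfolding F1 using wge.add[OF wge.add[OF wge_ax[OF g(1), of 3] wge_ax[OF g(2), of 4]]
        wge.mono[OF f1, of "?w1 + e"]] ne
    by (simp add: algebra_simps)
  have "partially_normal (Suc n) E1 E2"
    unfolding partially_normal_def
    using remove_error[OF _ _ _ _ _ _ assms(2) \<phi> \<phi>_nth(1,2) g f1 F1 f1_eq C w2 lead(1,2)
        excess(1,2) E1_def]
      remove_error[OF _ _ _ _ _ _ assms(2) \<phi> \<phi>_nth(3,4) g' f2 F2 f2_eq C' w1 lead(3,4)
          excess(3,4) E2_def]
    by simp
  moreover have "K_equivalent (F1, F2) (E1, E2)"
  proof (rule K_equivalent_subst[of \<phi> C C'])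
    show "coordinate_change_at_0 \<phi>" by (rule wge_coordinate_change[OF \<phi> ne(2)])
    show "holo_at_0 C" "holo_at_0 C'" using C C' by (auto intro: wge_holo0)
    \<comment> \<open>The weight bounds of \<open>C\<close> and \<open>C'\<close> are
      \<open>n * e\<close> plus and minus the difference of \<open>?w1\<close> and
      \<open>?w2\<close>, so at least one is positive and the multiplier matrix is invertible at
      0.\<close>
    show "C 0 = 0 \<or> C' 0 = 0"
    proof (cases "?w1 + n * e > ?w2")
      case True
      then show ?thesis using wge_0[OF C] by simp
    next
      case False
      then show ?thesis using wge_0[OF C'] ne(2) by simp
    qed
  qed (simp_all add: E1_def E2_def)
  ultimately show ?thesis by blast
qed

lemma partially_normal_K_equivalent:
  assumes "partially_normal n F1 F2"
    and big: "n * e > (c + 2) * wt 1 + (d + 2) * wt 2 + (a + 2) * wt 3 + (b + 2) * wt 4"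
  shows "K_equivalent (F1, F2) (normal_form a b c d)"
proof -
  let ?w1 = "wt 1 + wt 2" and ?w2 = "wt 3 + wt 4"
  obtain g3 g4 f1 where g: "wge wt (?w1 + e) g3" "wge wt (?w1 + e) g4"
      and f1: "wge wt (?w1 + n * e) f1"
    and F1: "F1 = (\<lambda>p. p$1 * p$2 + g3 (ax 3 p) + g4 (ax 4 p) + f1 p)"
    using assms(1) unfolding partially_normal_def by blast
  obtain g1 g2 f2 where g': "wge wt (?w2 + e) g1" "wge wt (?w2 + e) g2"
      and f2: "wge wt (?w2 + n * e) f2"
    and F2: "F2 = (\<lambda>p. p$3 * p$4 + g1 (ax 1 p) + g2 (ax 2 p) + f2 p)"
    using assms(1) unfolding partially_normal_def by blast
  have z: "g1 0 = 0" "g2 0 = 0" "g3 0 = 0" "g4 0 = 0" using wge_0 g g' e by auto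
  have axis: "\<exists>G. holo_at_0 G \<and> G 0 \<noteq> 0 \<and> (\<forall>p. g (ax i p) =
      p $ i ^ k * G p)"
    if l: "leading i k F" and f: "wge wt K f" "K > k * wt i" and F: "\<And>p. F (ax i p) =
        g (ax i p) + f (ax i p)"
    for i k F f g K
  proof -
    obtain G where G: "holo_at_0 G" "G 0 \<noteq> 0" "\<And>p. F (ax i p) = p $ i ^ k * G p"
      using l unfolding leading_def by blast
    obtain r where r: "holo_at_0 r" "\<And>p. f (ax i p) = p $ i ^ Suc k * r p"
      using wge_axis[OF f] by blast
    have "holo_at_0 (\<lambda>p. G p - p $ i * r p)" by (intro holo0_diff holo0_mult G r holo0_nth)
    moreover have "g (ax i p) = p $ i ^ k * (G p - p $ i * r p)" for p
      using F[of p] G(3)[of p] r(2)[of p] by (simp add: algebra_simps)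
    ultimately show ?thesis using G(2) by (intro exI[of _ "\<lambda>p. G p - p $ i * r p"]) auto
  qed
  have l: "leading 3 a F1" "leading 4 b F1" "leading 1 c F2" "leading 2 d F2"
    using assms(1) by (auto simp: partially_normal_def)
  obtain G3 where G3: "holo_at_0 G3" "G3 0 \<noteq> 0" "\<And>p. g3 (ax 3 p) = p $ 3 ^ a * G3 p"
    using axis[OF l(1) f1, of g3] big z by (auto simp: F1 algebra_simps)
  obtain G4 where G4: "holo_at_0 G4" "G4 0 \<noteq> 0" "\<And>p. g4 (ax 4 p) = p $ 4 ^ b * G4 p"
    using axis[OF l(2) f1, of g4] big z by (auto simp: F1 algebra_simps)
  obtain G1 where G1: "holo_at_0 G1" "G1 0 \<noteq> 0" "\<And>p. g1 (ax 1 p) = p $ 1 ^ c * G1 p"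
    using axis[OF l(3) f2, of g1] big z by (auto simp: F2 algebra_simps)
  obtain G2 where G2: "holo_at_0 G2" "G2 0 \<noteq> 0" "\<And>p. g2 (ax 2 p) = p $ 2 ^ d * G2 p"
    using axis[OF l(4) f2, of g2] big z by (auto simp: F2 algebra_simps)
  \<comment> \<open>One power beyond \<open>z^a\<close>, \<open>w^b\<close> suffices in the first
    equation, because it is absorbed by the unit coefficient. Powers of \<open>x\<close>,
    \<open>y\<close> foreign to this equation must appear with exponents \<open>c + 2\<close>,
    \<open>d + 2\<close> to fit the remainder lemma. \<open>m2\<close> exchanges the roles.\<close>
  define m1 m2 :: "4 \<Rightarrow> nat"
    where "m1 = (\<lambda>i. if i = 1 then c + 2 else if i = 2 then d + 2 else if i = 3 then a +
        1 else b + 1)"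
      and "m2 = (\<lambda>i. if i = 1 then c + 1 else if i = 2 then d + 1 else if i = 3 then a +
          2 else b + 2)"
  obtain A where A: "\<And>i. holo_at_0 (A i)" "\<And>p. f1 p =
      (\<Sum>i\<in>UNIV. p $ i ^ m1 i * A i p)"
    using wge_ideal[OF f1, of m1] big by (auto simp: sum_4 m1_def)
  obtain B where B: "\<And>i. holo_at_0 (B i)" "\<And>p. f2 p =
      (\<Sum>i\<in>UNIV. p $ i ^ m2 i * B i p)"
    using wge_ideal[OF f2, of m2] big by (auto simp: sum_4 m2_def)
  show ?thesis
  proof (rule K_equivalent_normal_form_remainder[where P="\<lambda>p. G3 p + p$3 * A 3 p"
      and Q="\<lambda>p. G4 p + p$4 * A 4 p"
        and R="\<lambda>p. G1 p + p$1 * B 1 p" and S="\<lambda>p. G2 p + p$2 * B 2 p"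
        and \<mu>="A 1" and \<nu>="A 2" and \<mu>'="B 3" and \<nu>'="B 4"])
    show "F1 = (\<lambda>p. p$1 * p$2 + p$3^a * (G3 p + p$3 * A 3 p) + p$4^b * (G4 p + p$4 * A 4 p)
        + p$1^(c+2) * A 1 p + p$2^(d+2) * A 2 p)"
      unfolding F1 A(2) G3(3) G4(3) by (simp add: sum_4 m1_def algebra_simps)
    show "F2 = (\<lambda>p. p$3 * p$4 + p$1^c * (G1 p + p$1 * B 1 p) + p$2^d * (G2 p + p$2 * B 2 p)
        + p$3^(a+2) * B 3 p + p$4^(b+2) * B 4 p)"
      unfolding F2 B(2) G1(3) G2(3) by (simp add: sum_4 m2_def algebra_simps)
  qed (use abcd G1 G2 G3 G4 A B in \<open>auto intro!: holo0_add holo0_mult\<close>)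
qed

theorem K_equivalent_normal_form:
  assumes "leading 3 a F1" "leading 4 b F1" "leading 1 c F2" "leading 2 d F2"
    and w1: "wge wt (wt 1 + wt 2 + e) (\<lambda>p. F1 p - p$1 * p$2)"
    and w2: "wge wt (wt 3 + wt 4 + e) (\<lambda>p. F2 p - p$3 * p$4)"
  shows "K_equivalent (F1, F2) (normal_form a b c d)"
proof -
  have "partially_normal 1 F1 F2"
    unfolding partially_normal_def
    using assms by (intro conjI exI[of _ "\<lambda>_. 0"] exI[of _ "\<lambda>p. F1 p - p$1 * p$2"]
      exI[of _ "\<lambda>p. F2 p - p$3 * p$4"]) (simp_all add: wge.zero)
  then have *: "\<exists>E1 E2. partially_normal (Suc n) E1 E2 \<and> K_equivalent (F1, F2) (E1,
      E2)" for n
  proof (induction n)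
    case 0
    have "K_equivalent (F1, F2) (F1, F2)"
      by (rule K_equivalentI[of "\<lambda>p. p" "\<lambda>_. 1" "\<lambda>_. 0" "\<lambda>_. 0"
          "\<lambda>_. 1", OF coordinate_change_id]) simp_all
    with 0 show ?case by auto
  next
    case (Suc n)
    then obtain E1 E2 where E: "partially_normal (Suc n) E1 E2" "K_equivalent (F1, F2) (E1, E2)"
        by blast
    from partially_normal_step[OF E(1)] E(2) show ?case by (auto intro: K_equivalent_trans)
  qed
  define n where "n = (c + 2) * wt 1 + (d + 2) * wt 2 + (a + 2) * wt 3 + (b + 2) * wt 4"
  obtain E1 E2 where E: "partially_normal (Suc n) E1 E2" "K_equivalent (F1, F2) (E1, E2)" using *
      by blast
  have "Suc n * 1 \<le> Suc n * e" by (rule mult_le_mono2) (use e in simp)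
  then have "K_equivalent (E1, E2) (normal_form a b c d)"
    by (intro partially_normal_K_equivalent[OF E(1)]) (simp add: n_def)
  with E(2) show ?thesis by (rule K_equivalent_trans)
qed

end

section \<open>Reduction of the eight singularities to normal form\<close>

definition tup :: "'a \<Rightarrow> 'a \<Rightarrow> 'a \<Rightarrow> 'a \<Rightarrow> 4
    \<Rightarrow> 'a" where
  "tup i j k l t = (if t = 1 then i else if t = 2 then j else if t = 3 then k else l)"

lemma tup_simps [simp]: "tup i j k l 1 = i" "tup i j k l 2 = j" "tup i j k l 3 = k" "tup i j k l 4 =
    l"
  by (simp_all add: tup_def)

text \<open>Integer coefficients and exponents as lists turn all conditions on weights and leading
  terms into computations.\<close>

definition mpol :: "(int \<times> nat \<times> nat \<times> nat \<times> nat) list \<Rightarrow>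
    complex^4 \<Rightarrow> complex" where
  "mpol L p = (\<Sum>(c,i,j,k,l)\<leftarrow>L. of_int c * (\<Prod>t\<in>UNIV. p $ t ^ tup i j k l
      t))"

lemma prod_4: "(\<Prod>t\<in>UNIV. f (t :: 4)) = f 1 * f 2 * f 3 * f 4"
proof -
  have "(\<Prod>t\<in>UNIV. f t) = (\<Prod>t\<in>{1,2,3,4}. f (t :: 4))"
    using exhaust_4 by (intro prod.cong) auto
  then show ?thesis by (simp add: mult.assoc)
qed

lemma mpol_simps:
  "mpol [] p = 0"
  "mpol ((c,i,j,k,l) # L) p = of_int c * (p$1 ^ i * p$2 ^ j * p$3 ^ k * p$4 ^ l) + mpol L p"
  by (simp_all add: mpol_def prod_4)

lemma wge_power: "wge wt K f \<Longrightarrow> wge wt (n * K) (\<lambda>p. f p ^ n)"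
  by (induction n) (auto intro: wge.const wge.mult)

lemma wge_mpol:
  assumes "\<forall>(c,i,j,k,l)\<in>set L. K \<le> i * wt 1 + j * wt 2 + k * wt 3 + l * wt 4"
  shows "wge wt K (mpol L)"
  using assms
proof (induction L)
  case Nil
  show ?case using wge.zero by (simp add: mpol_def[abs_def])
next
  case (Cons m L)
  obtain c i j k l where m: "m = (c,i,j,k,l)" by (cases m)
  have "wge wt (i * wt 1 + j * wt 2 + k * wt 3 + l * wt 4) (\<lambda>p. p$1 ^ i * p$2 ^ j * p$3 ^ k
      * p$4 ^ l)"
    by (intro wge.mult wge_power wge.coord)
  then have "wge wt K (\<lambda>p. of_int c * (p$1 ^ i * p$2 ^ j * p$3 ^ k * p$4 ^ l))"
    using Cons.prems m by (intro wge_cmult) (auto intro: wge.mono)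
  then show ?case using Cons m by (auto simp: mpol_simps[abs_def] intro!: wge.add)
qed

definition pure :: "4 \<Rightarrow> nat \<times> nat \<times> nat \<times> nat \<Rightarrow> bool"
    where
  "pure t = (\<lambda>(i,j,k,l). \<forall>s. s \<noteq> t \<longrightarrow> tup i j k l s = 0)"

lemma pure_simps:
  "pure 1 (i,j,k,l) \<longleftrightarrow> j = 0 \<and> k = 0 \<and> l = 0"
      "pure 2 (i,j,k,l) \<longleftrightarrow> i = 0 \<and> k = 0 \<and> l = 0"
  "pure 3 (i,j,k,l) \<longleftrightarrow> i = 0 \<and> j = 0 \<and> l = 0"
      "pure 4 (i,j,k,l) \<longleftrightarrow> i = 0 \<and> j = 0 \<and> k = 0"
  by (simp_all add: pure_def forall_4)

primrec coef :: "nat \<times> nat \<times> nat \<times> nat \<Rightarrow> (int \<times> nat \<times>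
    nat \<times> nat \<times> nat) list \<Rightarrow> int" where
  "coef n [] = 0"
| "coef n (m # L) = (if snd m = n then fst m + coef n L else coef n L)"

text \<open>On the axis only the pure monomials survive; after division by the \<open>n\<close>-th
  power, the value at 0 is the coefficient of the monomial \<open>m\<close>.\<close>

lemma leading_mpol:
  assumes "weighted_pair wt e a b c d"
    and F: "\<And>p. F (ax t p) = mpol L (ax t p)"
    and 1: "\<forall>(c,i,j,k,l)\<in>set L. pure t (i,j,k,l) \<longrightarrow> n \<le>
        tup i j k l t"
    and 2: "coef m L \<noteq> 0" "\<And>i j k l. m = (i,j,k,l) \<longleftrightarrow>
        pure t (i,j,k,l) \<and> tup i j k l t = n"
  shows "weighted_pair.leading t n F"
proof -
  interpret weighted_pair wt e a b c d by fact
  define G where "G = (\<lambda>p :: complex^4. \<Sum>(c,i,j,k,l)\<leftarrow>L. if pure t (i,j,k,l)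
      then of_int c * p $ t ^ (tup i j k l t - n) else 0)"
  have "holo_at_0 G" unfolding G_def
  proof (induction L)
    case (Cons m L)
    then show ?case
      by (cases m; cases "pure t (snd m)") (auto intro!: holo0_add holo0_mult holo0_power)
  qed simp
  moreover have "G 0 \<noteq> 0"
  proof -
    have "G 0 = of_int (coef m L)"
      using 1 unfolding G_def
    proof (induction L)
      case (Cons r L)
      obtain c i j k l where r: "r = (c,i,j,k,l)" by (cases r)
      show ?case using Cons 2(2)[of i j k l] by (auto simp: r)
    qed simp
    with 2(1) show ?thesis by simp
  qed
  moreover have "mpol L (ax t p) = p $ t ^ n * G p" for p
    using 1 unfolding G_def
  proof (induction L)
    case (Cons m L)
    obtain c i j k l where m: "m = (c,i,j,k,l)" by (cases m)
    have pr: "(\<Prod>s\<in>UNIV. ax t p $ s ^ tup i j k l s) =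
        (if pure t (i,j,k,l) then p $ t ^ tup i j k l t else 0)"
    proof (cases "pure t (i,j,k,l)")
      case True
      have "(\<Prod>s\<in>UNIV. ax t p $ s ^ tup i j k l s) = (\<Prod>s\<in>UNIV. if s =
          t then p $ t ^ tup i j k l t else 1)"
        using True by (intro prod.cong) (auto simp: pure_def)
      then show ?thesis using True by simp
    next
      case False
      then obtain s where "s \<noteq> t" "tup i j k l s \<noteq> 0" by (auto simp: pure_def)
      then show ?thesis using False by (auto intro!: prod_zero bexI[of _ s])
    qed
    have "of_int c * (\<Prod>s\<in>UNIV. ax t p $ s ^ tup i j k l s) =
        p $ t ^ n * (if pure t (i,j,k,l) then of_int c * p $ t ^ (tup i j k l t - n) else 0)"
      using Cons.prems m unfolding pr by (auto simp flip: power_add)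
    then show ?case using Cons m by (simp add: mpol_def distrib_left)
  qed (simp add: mpol_def)
  ultimately show ?thesis unfolding leading_def
    using F by (intro exI[of _ G]) simp
qed

lemma holo0_mpol [simp]: "holo_at_0 (mpol L)"
  by (induction L) (auto simp: mpol_simps[abs_def] intro!: holo0_add holo0_mult holo0_power)

definition shift :: "(4 \<Rightarrow> (int \<times> nat \<times> nat \<times> nat \<times> nat)
    list) \<Rightarrow> complex^4 \<Rightarrow> complex^4" where
  "shift S p = (\<chi> j. p $ j + mpol (S j) p)"

lemma shift_nth: "shift S p $ j = p $ j + mpol (S j) p"
  by (simp add: shift_def)

lemma shift_Nil [simp]: "shift (tup [] [] [] []) p = p"
  by (simp add: vec_eq_iff forall_4 shift_nth mpol_simps)

lemma coordinate_change_shift: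
  assumes "\<forall>j. list_all (\<lambda>(c,i,j,k,l). 2 \<le> i + j + k + l) (S j)"
  shows "coordinate_change_at_0 (shift S)"
proof (rule wge_coordinate_change[of "\<lambda>_. 1" 1])
  show "wge (\<lambda>_. 1) (1 + 1) (\<lambda>p. shift S p $ j - p $ j)" for j
    using wge_mpol[of "S j" 2 "\<lambda>_. 1"] assms
        by (simp add: shift_nth list_all_iff numeral_2_eq_2)
qed simp_all

lemma coordinate_change_linear:
  fixes A B :: "complex^4^4"
  assumes "A ** B = mat 1" "B ** A = mat 1"
  shows "coordinate_change_at_0 (\<lambda>p. A *v p)"
proof -
  have lin: "cdiff (\<lambda>p. (M *v p) $ i) p" for M :: "complex^4^4" and i p
    by (simp add: matrix_vector_mult_def sum_4 cdiff_add cdiff_mult)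
  have cont: "continuous_on UNIV (\<lambda>p. M *v p)" for M :: "complex^4^4"
  proof (intro continuous_at_imp_continuous_on ballI)
    show "isCont (\<lambda>p. M *v p) p" for p
      unfolding isCont_def
      by (rule vec_tendstoI) (use cdiff_isCont[OF lin[of M _ p]] in \<open>simp add:
          isCont_def\<close>)
  qed
  have "homeomorphism UNIV UNIV (\<lambda>p. A *v p) (\<lambda>p. B *v p)"
    by (rule homeomorphismI) (simp_all add: cont matrix_vector_mul_assoc assms)
  then show ?thesis
    unfolding coordinate_change_at_0_def holo_map_on_def holo_on_cdiff using lin
    by (intro conjI exI[of _ UNIV] exI[of _ "\<lambda>p. B *v p"]) simp_all
qed

text \<open>Reduces a contact equivalence to a certificate: two polynomial identities,
  \<open>1\<close> and \<open>2\<close>, and checks on integer lists. The inverse matrix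
  \<open>B\<close> is part of the certificate. The coordinate change is the shift \<open>S\<close>,
  then the matrix \<open>A\<close>, then the shift \<open>R\<close>.\<close>

lemma K_equivalent_expansion:
  fixes A B :: "complex^4^4"
  assumes 1: "\<And>p. mpol ma p * X1 (shift R (A *v shift S p)) +
      mpol mb p * X2 (shift R (A *v shift S p)) =
      p$1 * p$2 + mpol ms p"
    and 2: "\<And>p. mpol mc p * X1 (shift R (A *v shift S p)) +
        mpol md p * X2 (shift R (A *v shift S p)) =
      p$3 * p$4 + mpol ns p"
    and W: "weighted_pair wt e a b c d"
    and A: "A ** B = mat 1" "B ** A = mat 1"
    and S: "\<forall>j. list_all (\<lambda>(c,i,j,k,l). 2 \<le> i + j + k + l) (S j)"
    and R: "\<forall>j. list_all (\<lambda>(c,i,j,k,l). 2 \<le> i + j + k + l) (R j)"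
    and det: "mpol ma 0 * mpol md 0 - mpol mb 0 * mpol mc 0 \<noteq> 0"
    and w1: "list_all (\<lambda>(c,i,j,k,l). wt 1 + wt 2 + e \<le> i * wt 1 + j * wt 2 + k * wt 3 +
        l * wt 4) ms"
    and w2: "list_all (\<lambda>(c,i,j,k,l). wt 3 + wt 4 + e \<le> i * wt 1 + j * wt 2 + k * wt 3 +
        l * wt 4) ns"
    and z: "list_all (\<lambda>(c,i,j,k,l). i = 0 \<and> j = 0 \<and> l = 0 \<longrightarrow>
        a \<le> k) ms"
      "coef (0,0,a,0) ms \<noteq> 0"
    and w: "list_all (\<lambda>(c,i,j,k,l). i = 0 \<and> j = 0 \<and> k = 0 \<longrightarrow>
        b \<le> l) ms"
      "coef (0,0,0,b) ms \<noteq> 0"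
    and x: "list_all (\<lambda>(r,i,j,k,l). j = 0 \<and> k = 0 \<and> l = 0 \<longrightarrow>
        c \<le> i) ns"
      "coef (c,0,0,0) ns \<noteq> 0"
    and y: "list_all (\<lambda>(c,i,j,k,l). i = 0 \<and> k = 0 \<and> l = 0 \<longrightarrow>
        d \<le> j) ns"
      "coef (0,d,0,0) ns \<noteq> 0"
  shows "K_equivalent (X1, X2) (normal_form a b c d)"
proof -
  interpret weighted_pair wt e a b c d by fact
  define \<phi> where "\<phi> = shift R \<circ> ((\<lambda>p. A *v p) \<circ> shift S)"
  have \<phi>: "coordinate_change_at_0 \<phi>"
    unfolding \<phi>_def
    by (intro coordinate_change_comp coordinate_change_shift coordinate_change_linear[OF A] S R)
  define F1 F2 where "F1 = (\<lambda>p. mpol ma p * X1 (\<phi> p) + mpol mb p * X2 (\<phi> p))"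
    and "F2 = (\<lambda>p. mpol mc p * X1 (\<phi> p) + mpol md p * X2 (\<phi> p))"
  have F1: "F1 p = p$1 * p$2 + mpol ms p" and F2: "F2 p = p$3 * p$4 + mpol ns p" for p
    unfolding F1_def F2_def \<phi>_def comp_def by (rule 1, rule 2)
  have "K_equivalent (\<lambda>p. X1 (\<phi> p), \<lambda>p. X2 (\<phi> p)) (X1, X2)"
    by (rule K_equivalentI[of \<phi> "\<lambda>_. 1" "\<lambda>_. 0" "\<lambda>_. 0"
        "\<lambda>_. 1", OF \<phi>]) simp_all
  moreover have "K_equivalent (\<lambda>p. X1 (\<phi> p), \<lambda>p. X2 (\<phi> p)) (F1, F2)"
    by (rule K_equivalentI[OF coordinate_change_id, of "mpol ma" "mpol mb" "mpol mc" "mpol md"])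
      (use det in \<open>simp_all add: F1_def F2_def\<close>)
  moreover have "K_equivalent (F1, F2) (normal_form a b c d)"
  proof (rule K_equivalent_normal_form)
    show "leading 3 a F1" by (rule leading_mpol[OF W, of _ _ ms _ "(0,0,a,0)"])
        (use z in \<open>auto simp: F1 pure_simps list_all_iff\<close>)
    show "leading 4 b F1" by (rule leading_mpol[OF W, of _ _ ms _ "(0,0,0,b)"])
        (use w in \<open>auto simp: F1 pure_simps list_all_iff\<close>)
    show "leading 1 c F2" by (rule leading_mpol[OF W, of _ _ ns _ "(c,0,0,0)"])
        (use x in \<open>auto simp: F2 pure_simps list_all_iff\<close>)
    show "leading 2 d F2" by (rule leading_mpol[OF W, of _ _ ns _ "(0,d,0,0)"])
        (use y in \<open>auto simp: F2 pure_simps list_all_iff\<close>)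
    show "wge wt (wt 1 + wt 2 + e) (\<lambda>p. F1 p - p$1 * p$2)"
      "wge wt (wt 3 + wt 4 + e) (\<lambda>p. F2 p - p$3 * p$4)"
      using wge_mpol[OF w1[unfolded list_all_iff]] wge_mpol[OF w2[unfolded list_all_iff]]
      by (simp_all add: F1 F2)
  qed
  ultimately show ?thesis using K_equivalent_sym K_equivalent_trans by blast
qed

lemma matrix_vector_nth_4:
  fixes A :: "complex^4^4"
  shows "(A *v v) $ i = A $ i $ 1 * v $ 1 + A $ i $ 2 * v $ 2 + A $ i $ 3 * v $ 3 +
      A $ i $ 4 * v $ 4"
  by (simp add: matrix_vector_mult_def sum_4)

lemmas expansion_simps = on_C4_def h1_gab_def matrix_vector_nth_4

lemmas expansion_steps = shift_nth tup_simps mpol_simps matrix_vector_nth_4 vector4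

lemmas expansion_checks = weighted_pair_def vec_eq_iff forall_4 matrix_matrix_mult_def mat_def sum_4
    mpol_simps

text \<open>The substitutions \<open>A\<close>, \<open>R\<close>, \<open>S\<close> and the multipliers \<open>ma\<close>, \<open>mb\<close>, \<open>mc\<close>, \<open>md\<close> result from
  diagonalizing the quadratic parts to \<open>x*y\<close>, \<open>z*w\<close> and then eliminating the monomials of too low
  weight, as in the general reduction; the lists \<open>ms\<close> and \<open>ns\<close> are the expansions of what
  remains.\<close>

lemma K_equivalent_I1: "K_equivalent (X'_eqs I1) (normal_form 3 3 3 3)"
  unfolding X'_eqs_def
\<comment> \<open>In all eight cases the weights are chosen so that the four powers have the same
  excess: \<open>a * wt 3 = b * wt 4 = wt 1 + wt 2 + e\<close> and
  \<open>c * wt 1 = d * wt 2 = wt 3 + wt 4 + e\<close>. This is again a linear system with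
  determinant \<open>1 - s * t\<close>. Here everything beyond the quadratic terms is cubic.\<close>
proof (rule K_equivalent_expansion[where
      wt="tup 1 1 1 1" and e=1 and
      A="vector [vector [1,0,0,0], vector [0,1,0,0], vector [-1,0,1,0], vector [-1,1,1,-1]]" and
      B="vector [vector [1,0,0,0], vector [0,1,0,0], vector [1,0,1,0], vector [0,1,1,-1]]" and
      S="tup [] [] [] []" and
      R="tup [] [] [] []" and
      ma="[(1,0,0,0,0)]" and mb="[]" and mc="[(1,0,0,0,0)]" and md="[(1,0,0,0,0)]" and
      ms="[(1,3,0,0,0), (-3,2,1,0,0), (-3,2,0,1,0), (3,2,0,0,1), (3,1,2,0,0), (6,1,1,1,0),
        (-6,1,1,0,1), (3,1,0,2,0), (-6,1,0,1,1), (3,1,0,0,2), (-1,0,3,0,0), (-3,0,2,1,0),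
        (3,0,2,0,1), (-3,0,1,2,0), (6,0,1,1,1), (-3,0,1,0,2), (-1,0,0,3,0), (3,0,0,2,1),
        (-3,0,0,1,2), (1,0,0,0,3)]" and
      ns="[(1,3,0,0,0), (-3,2,1,0,0), (-3,2,0,1,0), (3,2,0,0,1), (3,1,2,0,0), (6,1,1,1,0),
        (-6,1,1,0,1), (3,1,0,2,0), (-6,1,0,1,1), (3,1,0,0,2), (-1,0,3,0,0), (-3,0,2,1,0),
        (3,0,2,0,1), (-3,0,1,2,0), (6,0,1,1,1), (-3,0,1,0,2), (-1,0,0,3,0), (3,0,0,2,1),
        (-3,0,0,1,2), (1,0,0,0,3)]"],
    goal_cases)
  case (1 p)
  show ?case
    by (simp add: expansion_simps, simp only: expansion_steps) (simp, algebra)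
next
  case (2 p)
  show ?case
    by (simp add: expansion_simps, simp only: expansion_steps) (simp, algebra)
qed (simp_all add: expansion_checks)

lemma K_equivalent_L1: "K_equivalent (X'_eqs L1) (normal_form 2 4 4 2)"
  unfolding X'_eqs_def
proof (rule K_equivalent_expansion[where
      wt="tup 1 2 2 1" and e=1 and
      A="vector [vector [1,3,-3,1], vector [0,1,0,0], vector [0,1,-1,0], vector [0,2,-1,1]]" and
      B="vector [vector [1,1,-2,-1], vector [0,1,0,0], vector [0,1,-1,0], vector [0,-1,-1,1]]" and
      S="tup [] [(-1,2,0,0,0), (-2,1,0,0,1), (-1,0,0,0,2)] [] []" and
      R="tup [] [(1,2,0,0,0), (-1,1,0,0,1)] [] []" and
      ma="[(1,0,0,0,0)]" and mb="[(-1,0,0,0,0)]" and mc="[]" and md="[(1,0,0,0,0)]" and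
      ms="[(-1,0,0,2,0), (7,2,1,0,0), (-8,2,0,1,0), (15,1,2,0,0), (-36,1,1,1,0), (8,1,1,0,1),
        (21,1,0,2,0), (-10,1,0,1,1), (9,0,3,0,0), (-36,0,2,1,0), (6,0,2,0,1), (45,0,1,2,0),
        (-18,0,1,1,1), (1,0,1,0,2), (-18,0,0,3,0), (12,0,0,2,1), (-2,0,0,1,2), (-7,4,0,0,0),
        (-30,3,1,0,0), (36,3,0,1,0), (-22,3,0,0,1), (-27,2,2,0,0), (72,2,1,1,0), (-72,2,1,0,1),
        (-45,2,0,2,0), (90,2,0,1,1), (-24,2,0,0,2), (-54,1,2,0,1), (144,1,1,1,1), (-54,1,1,0,2),
        (-90,1,0,2,1), (72,1,0,1,2), (-10,1,0,0,3), (-27,0,2,0,2), (72,0,1,1,2), (-12,0,1,0,3),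
        (-45,0,0,2,2), (18,0,0,1,3), (-1,0,0,0,4), (15,5,0,0,0), (27,4,1,0,0), (-36,4,0,1,0),
        (66,4,0,0,1), (108,3,1,0,1), (-144,3,0,1,1), (114,3,0,0,2), (162,2,1,0,2), (-216,2,0,1,2),
        (96,2,0,0,3), (108,1,1,0,3), (-144,1,0,1,3), (39,1,0,0,4), (27,0,1,0,4), (-36,0,0,1,4),
        (6,0,0,0,5), (-9,6,0,0,0), (-54,5,0,0,1), (-135,4,0,0,2), (-180,3,0,0,3), (-135,2,0,0,4),
        (-54,1,0,0,5), (-9,0,0,0,6)]" and
      ns="[(1,0,2,0,0), (-2,2,1,0,0), (-4,1,1,0,1), (-2,0,1,0,2), (1,4,0,0,0), (4,3,0,0,1),
        (6,2,0,0,2), (4,1,0,0,3), (1,0,0,0,4)]"],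
    goal_cases)
  case (1 p)
  show ?case
    by (simp add: expansion_simps, simp only: expansion_steps) (simp, algebra)
next
  case (2 p)
  show ?case
    by (simp add: expansion_simps, simp only: expansion_steps) (simp, algebra)
qed (simp_all add: expansion_checks)

lemma K_equivalent_J2: "K_equivalent (X'_eqs J2') (normal_form 2 2 6 2)"
  unfolding X'_eqs_def
proof (rule K_equivalent_expansion[where
      wt="tup 2 6 5 5" and e=2 and
      A="vector [vector [1,5,6,-4], vector [0,1,0,0], vector [0,1,1,0], vector [0,2,1,-1]]" and
      B="vector [vector [1,5,-2,-4], vector [0,1,0,0], vector [0,-1,1,0], vector [0,1,1,-1]]" and
      S="tup [] [(-2,1,0,1,0), (2,1,0,0,1), (1,3,0,0,0)] [] [(1,2,0,0,0), (-8,3,0,0,0)]" and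
      R="tup [] [] [] []" and
      ma="[(1,0,0,0,0)]" and mb="[]" and mc="[(1,1,0,0,0)]" and md="[(1,0,0,0,0)]" and
      ms="[(-2,0,0,2,0), (2,0,0,1,1), (-1,0,0,0,2), (-16,3,0,1,0), (16,3,0,0,1), (16,5,0,0,0),
        (-64,6,0,0,0)]" and
      ns="[(1,0,2,0,0), (-6,1,2,0,0), (-22,1,1,1,0), (8,1,1,0,1), (-13,1,0,2,0), (8,1,0,1,1),
        (-5,0,3,0,0), (-41,0,2,1,0), (4,0,2,0,1), (-67,0,1,2,0), (38,0,1,1,1), (5,0,1,0,2),
        (-30,0,0,3,0), (32,0,0,2,1), (-2,0,0,1,2), (-4,0,0,0,3), (6,3,1,0,0), (4,2,2,0,0),
        (62,2,1,1,0), (-14,2,1,0,1), (72,2,0,2,0), (-56,2,0,1,1), (30,1,2,1,0), (-30,1,2,0,1),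
        (164,1,1,2,0), (-180,1,1,1,1), (16,1,1,0,2), (134,1,0,3,0), (-210,1,0,2,1), (66,1,0,1,2),
        (10,1,0,0,3), (-39,4,1,0,0), (-96,4,0,1,0), (4,4,0,0,1), (-47,3,2,0,0), (-402,3,1,1,0),
        (-56,3,1,0,1), (-423,3,0,2,0), (174,3,0,1,1), (97,3,0,0,2), (-60,2,1,2,0), (120,2,1,1,1),
        (-60,2,1,0,2), (-164,2,0,3,0), (344,2,0,2,1), (-196,2,0,1,2), (16,2,0,0,3), (1,6,0,0,0),
        (-72,5,1,0,0), (148,5,0,1,0), (124,5,0,0,1), (188,4,1,1,0), (-188,4,1,0,1), (788,4,0,2,0),
        (-660,4,0,1,1), (-128,4,0,0,2), (40,3,0,3,0), (-120,3,0,2,1), (120,3,0,1,2), (-40,3,0,0,3),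
        (63,7,0,0,0), (241,6,1,0,0), (-329,6,0,1,0), (-988,6,0,0,1), (-188,5,0,2,0), (376,5,0,1,1),
        (-188,5,0,0,2), (-844,8,0,0,0), (-482,7,0,1,0), (482,7,0,0,1), (2331,9,0,0,0)]"],
    goal_cases)
  case (1 p)
  show ?case
    by (simp add: expansion_simps, simp only: expansion_steps) (simp, algebra)
next
  case (2 p)
  show ?case
    by (simp add: expansion_simps, simp only: expansion_steps) (simp, algebra)
qed (simp_all add: expansion_checks)

lemma K_equivalent_K1: "K_equivalent (X'_eqs K1') (normal_form 2 2 4 4)"
  unfolding X'_eqs_def
proof (rule K_equivalent_expansion[where
      wt="tup 2 2 3 3" and e=2 and
      A="vector [vector [1,1,2,-2], vector [0,1,0,0], vector [0,0,1,0], vector [0,1,1,-1]]" and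
      B="vector [vector [1,1,0,-2], vector [0,1,0,0], vector [0,0,1,0], vector [0,1,1,-1]]" and
      S="tup [] [] [(-1,2,0,0,0), (-1,0,2,0,0)] [(1,2,0,0,0), (1,0,2,0,0)]" and
      R="tup [] [] [] []" and
      ma="[(1,0,0,0,0)]" and mb="[]" and mc="[(1,1,0,0,0), (1,0,1,0,0), (4,0,0,1,0), (-4,0,0,0,1)]"
        and md="[(1,0,0,0,0)]" and
      ms="[(-2,0,0,2,0), (2,0,0,1,1), (-1,0,0,0,2), (6,2,0,1,0), (-4,2,0,0,1), (6,0,2,1,0),
        (-4,0,2,0,1), (-5,4,0,0,0), (-10,2,2,0,0), (-5,0,4,0,0)]" and
      ns="[(-5,1,0,2,0), (8,1,0,1,1), (-4,1,0,0,2), (-5,0,1,2,0), (8,0,1,1,1), (-4,0,1,0,2),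
        (-10,0,0,3,0), (22,0,0,2,1), (-18,0,0,1,2), (6,0,0,0,3), (1,4,0,0,0), (8,3,1,0,0),
        (18,3,0,1,0), (-16,3,0,0,1), (2,2,2,0,0), (18,2,1,1,0), (-16,2,1,0,1), (36,2,0,2,0),
        (-64,2,0,1,1), (28,2,0,0,2), (8,1,3,0,0), (18,1,2,1,0), (-16,1,2,0,1), (1,0,4,0,0),
        (18,0,3,1,0), (-16,0,3,0,1), (36,0,2,2,0), (-64,0,2,1,1), (28,0,2,0,2), (-17,5,0,0,0),
        (-17,4,1,0,0), (-44,4,0,1,0), (44,4,0,0,1), (-34,3,2,0,0), (-34,2,3,0,0), (-88,2,2,1,0),
        (88,2,2,0,1), (-17,1,4,0,0), (-17,0,5,0,0), (-44,0,4,1,0), (44,0,4,0,1), (16,6,0,0,0),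
        (48,4,2,0,0), (48,2,4,0,0), (16,0,6,0,0)]"],
    goal_cases)
  case (1 p)
  show ?case
    by (simp add: expansion_simps, simp only: expansion_steps) (simp, algebra)
next
  case (2 p)
  show ?case
    by (simp add: expansion_simps, simp only: expansion_steps) (simp, algebra)
qed (simp_all add: expansion_checks)

text \<open>The weights come from \<open>2 * 23 = 12 + 20 + 14\<close> and
  \<open>5 * 12 = 3 * 20 = 23 + 23 + 14\<close>.\<close>

lemma K_equivalent_K1_flat: "K_equivalent (X'_eqs K1_flat) (normal_form 2 2 5 3)"
  unfolding X'_eqs_def
proof (rule K_equivalent_expansion[where
      wt="tup 12 20 23 23" and e=14 and
      A="vector [vector [1,1,2,-2], vector [0,1,0,0], vector [0,0,1,0], vector [0,1,1,-1]]" and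
      B="vector [vector [1,1,0,-2], vector [0,1,0,0], vector [0,0,1,0], vector [0,1,1,-1]]" and
      S="tup [] [] [(-1,2,0,0,0), (5,1,0,0,1), (6,3,0,0,0)] [(2,1,0,1,0), (-6,1,0,0,1),
        (-4,3,0,0,0)]" and
      R="tup [] [] [] []" and
      ma="[(1,0,0,0,0)]" and mb="[]" and mc="[(1,1,0,0,0), (2,0,1,0,0), (4,0,0,1,0), (-6,0,0,0,1),
        (-4,2,0,0,0)]" and md="[(1,0,0,0,0)]" and
      ms="[(-2,0,0,2,0), (2,0,0,1,1), (-1,0,0,0,2), (4,2,0,1,0), (-2,2,0,0,1), (4,1,0,2,0),
        (-36,1,0,1,1), (22,1,0,0,2), (-2,4,0,0,0), (-36,3,0,1,0), (52,3,0,0,1), (-4,2,0,2,0),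
        (44,2,0,1,1), (-146,2,0,0,2), (32,5,0,0,0), (40,4,0,1,0), (-280,4,0,0,1),
            (-136,6,0,0,0)]" and
      ns="[(-1,0,3,0,0), (-4,0,2,1,0), (5,0,2,0,1), (-8,0,1,2,0), (16,0,1,1,1), (-10,0,1,0,2),
        (-8,0,0,3,0), (24,0,0,2,1), (-24,0,0,1,2), (10,0,0,0,3), (4,2,2,0,0), (28,2,1,1,0),
        (-72,2,1,0,1), (36,2,0,2,0), (-114,2,0,1,1), (84,2,0,0,2), (10,1,2,1,0), (-50,1,2,0,1),
        (32,1,1,2,0), (-216,1,1,1,1), (200,1,1,0,2), (24,1,0,3,0), (-224,1,0,2,1), (464,1,0,1,2),
        (-244,1,0,0,3), (-2,5,0,0,0), (-56,4,1,0,0), (-72,4,0,1,0), (100,4,0,0,1), (-44,3,2,0,0),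
        (-192,3,1,1,0), (352,3,1,0,1), (-212,3,0,2,0), (940,3,0,1,1), (-1042,3,0,0,2),
        (-40,2,1,2,0), (400,2,1,1,1), (-1040,2,1,0,2), (-48,2,0,3,0), (520,2,0,2,1),
        (-1824,2,0,1,2), (1888,2,0,0,3), (32,6,0,0,0), (160,5,1,0,0), (464,5,0,1,0),
        (-1232,5,0,0,1), (352,4,1,1,0), (-1856,4,1,0,1), (432,4,0,2,0), (-3024,4,0,1,1),
        (4504,4,0,0,2), (32,3,0,3,0), (-448,3,0,2,1), (2024,3,0,1,2), (-2904,3,0,0,3),
        (-440,7,0,0,0), (-832,6,1,0,0), (-1248,6,0,1,0), (3488,6,0,0,1), (-384,5,0,2,0),
        (3424,5,0,1,1), (-7216,5,0,0,2), (864,8,0,0,0), (1440,7,0,1,0), (-5920,7,0,0,1),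
        (-1600,9,0,0,0)]"],
    goal_cases)
  case (1 p)
  show ?case
    by (simp add: expansion_simps, simp only: expansion_steps) (simp, algebra)
next
  case (2 p)
  show ?case
    by (simp add: expansion_simps, simp only: expansion_steps) (simp, algebra)
qed (simp_all add: expansion_checks)

lemma K_equivalent_L1_sharp: "K_equivalent (X'_eqs L1_sharp) (normal_form 2 3 5 2)"
  unfolding X'_eqs_def
proof (rule K_equivalent_expansion[where
      wt="tup 22 55 51 34" and e=25 and
      A="vector [vector [1,3,-3,1], vector [0,1,0,0], vector [0,1,-1,0], vector [0,2,-1,1]]" and
      B="vector [vector [1,1,-2,-1], vector [0,1,0,0], vector [0,1,-1,0], vector [0,-1,-1,1]]" and
      S="tup [] [(-1,1,1,0,0), (2,1,0,1,0), (-1,1,0,0,1), (-2,0,0,0,2), (1,3,0,0,0), (17,2,0,0,1)]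
        [(1,2,0,0,0), (2,1,0,0,1), (1,0,0,0,2), (-7,3,0,0,0)] [(-6,1,0,0,1)]" and
      R="tup [] [] [] []" and
      ma="[(1,0,0,0,0)]" and mb="[(-1,0,0,0,0)]" and mc="[(1,1,0,0,0)]" and md="[(1,0,0,0,0),
        (-1,1,0,0,0)]" and
      ms="[(-1,0,0,2,0), (6,1,2,0,0), (-6,1,1,1,0), (8,1,1,0,1), (-10,1,0,1,1), (9,0,3,0,0),
        (-18,0,2,1,0), (15,0,2,0,1), (9,0,1,2,0), (-24,0,1,1,1), (7,0,1,0,2), (9,0,0,2,1),
        (-8,0,0,1,2), (1,0,0,0,3), (-7,3,1,0,0), (16,3,0,1,0), (-30,2,2,0,0), (48,2,1,1,0),
        (-104,2,1,0,1), (-12,2,0,2,0), (76,2,0,1,1), (-58,2,0,0,2), (-27,1,3,0,0), (90,1,2,1,0),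
        (-183,1,2,0,1), (-81,1,1,2,0), (300,1,1,1,1), (-199,1,1,0,2), (18,1,0,3,0), (-111,1,0,2,1),
        (158,1,0,1,2), (-63,1,0,0,3), (-72,0,2,0,2), (90,0,1,1,2), (-84,0,1,0,3), (-18,0,0,2,2),
        (66,0,0,1,3), (-21,0,0,0,4), (15,5,0,0,0), (69,4,1,0,0), (-18,4,0,1,0), (146,4,0,0,1),
        (195,3,2,0,0), (-276,3,1,1,0), (714,3,1,0,1), (69,3,0,2,0), (-570,3,0,1,1), (553,3,0,0,2),
        (27,2,3,0,0), (-126,2,2,1,0), (780,2,2,0,1), (180,2,1,2,0), (-1500,2,1,1,1),
        (1647,2,1,0,2), (-72,2,0,3,0), (645,2,0,2,1), (-1458,2,0,1,2), (806,2,0,0,3),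
        (144,1,2,0,2), (-378,1,1,1,2), (912,1,1,0,3), (180,1,0,2,2), (-726,1,0,1,3), (492,1,0,0,4),
        (189,0,1,0,4), (-108,0,0,1,4), (117,0,0,0,5), (-55,6,0,0,0), (-225,5,1,0,0), (144,5,0,1,0),
        (-681,5,0,0,1), (-324,4,2,0,0), (846,4,1,1,0), (-3048,4,1,0,1), (-396,4,0,2,0),
        (2640,4,0,1,1), (-3480,4,0,0,2), (-9,3,3,0,0), (54,3,2,1,0), (-1071,3,2,0,1),
        (-108,3,1,2,0), (3060,3,1,1,1), (-7431,3,1,0,2), (72,3,0,3,0), (-1836,3,0,2,1),
        (6924,3,0,1,2), (-5943,3,0,0,3), (-72,2,2,0,2), (288,2,1,1,2), (-3276,2,1,0,3),
        (-288,2,0,2,2), (3186,2,0,1,3), (-3876,2,0,0,4), (-189,1,1,0,4), (378,1,0,1,4),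
        (-1107,1,0,0,5), (-162,0,0,0,6), (57,7,0,0,0), (882,6,1,0,0), (-468,6,0,1,0),
        (2793,6,0,0,1), (153,5,2,0,0), (-612,5,1,1,0), (7632,5,1,0,1), (612,5,0,2,0),
        (-7614,5,0,1,1), (14379,5,0,0,2), (459,4,2,0,1), (-1836,4,1,1,1), (13779,4,1,0,2),
        (1836,4,0,2,1), (-17154,4,0,1,2), (25134,4,0,0,3), (2448,3,1,0,3), (-4896,3,0,1,3),
        (15021,3,0,0,4), (3213,2,0,0,5), (-144,8,0,0,0), (-720,7,1,0,0), (1440,7,0,1,0),
        (-7506,7,0,0,1), (-5202,6,1,0,1), (10404,6,0,1,1), (-37692,6,0,0,2), (-7803,5,1,0,2),
        (15606,5,0,1,2), (-57375,5,0,0,3), (-20808,4,0,0,4), (576,9,0,0,0), (12240,8,0,0,1),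
        (44217,7,0,0,2), (44217,6,0,0,3)]" and
      ns="[(1,0,2,0,0), (-8,1,2,0,0), (10,1,1,1,0), (-10,1,1,0,1), (-1,1,0,2,0), (-9,0,3,0,0),
        (18,0,2,1,0), (-15,0,2,0,1), (-9,0,1,2,0), (24,0,1,1,1), (-11,0,1,0,2), (-9,0,0,2,1),
        (6,0,0,1,2), (9,3,1,0,0), (-2,3,0,1,0), (37,2,2,0,0), (-58,2,1,1,0), (148,2,1,0,1),
        (16,2,0,2,0), (-90,2,0,1,1), (41,2,0,0,2), (36,1,3,0,0), (-108,1,2,1,0), (198,1,2,0,1),
        (90,1,1,2,0), (-324,1,1,1,1), (210,1,1,0,2), (-18,1,0,3,0), (120,1,0,2,1), (-174,1,0,1,2),
        (58,1,0,0,3), (72,0,2,0,2), (-90,0,1,1,2), (84,0,1,0,3), (18,0,0,2,2), (-66,0,0,1,3),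
        (24,0,0,0,4), (-1,5,0,0,0), (-78,4,1,0,0), (38,4,0,1,0), (-78,4,0,0,1), (-225,3,2,0,0),
        (324,3,1,1,0), (-852,3,1,0,1), (-81,3,0,2,0), (714,3,0,1,1), (-635,3,0,0,2), (-54,2,3,0,0),
        (216,2,2,1,0), (-963,2,2,0,1), (-261,2,1,2,0), (1800,2,1,1,1), (-1846,2,1,0,2),
        (90,2,0,3,0), (-756,2,0,2,1), (1616,2,0,1,2), (-937,2,0,0,3), (-216,1,2,0,2),
        (468,1,1,1,2), (-996,1,1,0,3), (-198,1,0,2,2), (792,1,0,1,3), (-513,1,0,0,4),
        (-189,0,1,0,4), (108,0,0,1,4), (-117,0,0,0,5), (22,6,0,0,0), (294,5,1,0,0), (-162,5,0,1,0),
        (861,5,0,0,1), (519,4,2,0,0), (-1122,4,1,1,0), (3762,4,1,0,1), (465,4,0,2,0),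
        (-3210,4,0,1,1), (4322,4,0,0,2), (36,3,3,0,0), (-180,3,2,1,0), (1851,3,2,0,1),
        (288,3,1,2,0), (-4560,3,1,1,1), (9078,3,1,0,2), (-144,3,0,3,0), (2481,3,0,2,1),
        (-8382,3,0,1,2), (6749,3,0,0,3), (216,2,2,0,2), (-666,2,1,1,2), (4188,2,1,0,3),
        (468,2,0,2,2), (-3912,2,0,1,3), (4368,2,0,0,4), (378,1,1,0,4), (-486,1,0,1,4),
        (1224,1,0,0,5), (162,0,0,0,6), (-112,7,0,0,0), (-1107,6,1,0,0), (612,6,0,1,0),
        (-3474,6,0,0,1), (-477,5,2,0,0), (1458,5,1,1,0), (-10680,5,1,0,1), (-1008,5,0,2,0),
        (10254,5,0,1,1), (-17859,5,0,0,2), (-9,4,3,0,0), (54,4,2,1,0), (-1530,4,2,0,1),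
        (-108,4,1,2,0), (4896,4,1,1,1), (-21210,4,1,0,2), (72,4,0,3,0), (-3672,4,0,2,1),
        (24078,4,0,1,2), (-31077,4,0,0,3), (-72,3,2,0,2), (288,3,1,1,2), (-5724,3,1,0,3),
        (-288,3,0,2,2), (8082,3,0,1,3), (-18897,3,0,0,4), (-189,2,1,0,4), (378,2,0,1,4),
        (-4320,2,0,0,5), (-162,1,0,0,6), (201,8,0,0,0), (1602,7,1,0,0), (-1908,7,0,1,0),
        (10299,7,0,0,1), (153,6,2,0,0), (-612,6,1,1,0), (12834,6,1,0,1), (612,6,0,2,0),
        (-18018,6,0,1,1), (52071,6,0,0,2), (459,5,2,0,1), (-1836,5,1,1,1), (21582,5,1,0,2),
        (1836,5,0,2,1), (-32760,5,0,1,2), (82509,5,0,0,3), (2448,4,1,0,3), (-4896,4,0,1,3),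
        (35829,4,0,0,4), (3213,3,0,0,5), (-720,9,0,0,0), (-720,8,1,0,0), (1440,8,0,1,0),
        (-19746,8,0,0,1), (-5202,7,1,0,1), (10404,7,0,1,1), (-81909,7,0,0,2), (-7803,6,1,0,2),
        (15606,6,0,1,2), (-101592,6,0,0,3), (-20808,5,0,0,4), (576,10,0,0,0), (12240,9,0,0,1),
        (44217,8,0,0,2), (44217,7,0,0,3)]"],
    goal_cases)
  case (1 p)
  show ?case
    by (simp add: expansion_simps, simp only: expansion_steps) (simp, algebra)
next
  case (2 p)
  show ?case
    by (simp add: expansion_simps, simp only: expansion_steps) (simp, algebra)
qed (simp_all add: expansion_checks)

text \<open>Here the equations exchange roles: \<open>x*y - w^2\<close> becomes
  \<open>z*w - x^2\<close> under \<open>A\<close> and serves as the second equation, hence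
  \<open>mc = 1\<close> and \<open>md = 0\<close>.\<close>

lemma K_equivalent_M1: "K_equivalent (X'_eqs M1) (normal_form 3 3 2 4)"
  unfolding X'_eqs_def
proof (rule K_equivalent_expansion[where
      wt="tup 10 5 7 7" and e=6 and
      A="vector [vector [-2,0,1,1], vector [0,0,0,1], vector [-2,1,1,1], vector [1,0,0,-1]]" and
      B="vector [vector [0,1,0,1], vector [-1,0,1,0], vector [1,1,0,2], vector [0,1,0,0]]" and
      S="tup [(1,0,2,0,0), (3,0,1,1,0), (3,0,1,0,1), (3,0,0,2,0), (3,0,0,0,2), (-18,0,3,0,0)]
        [(-6,0,2,0,0)] [] []" and
      R="tup [] [] [] []" and
      ma="[(-1,0,0,0,0), (6,0,1,0,0)]" and mb="[(-1,0,0,0,0)]" and mc="[(1,0,0,0,0)]" and md="[]"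
          and
      ms="[(8,3,0,0,0), (-18,2,1,0,0), (-12,2,0,1,0), (-12,2,0,0,1), (12,1,1,1,0), (12,1,1,0,1),
        (6,1,0,2,0), (12,1,0,1,1), (6,1,0,0,2), (-1,0,0,3,0), (-3,0,0,2,1), (-3,0,0,1,2),
        (-1,0,0,0,3), (96,2,2,0,0), (72,2,1,1,0), (72,2,1,0,1), (72,2,0,2,0), (72,2,0,0,2),
        (-108,1,3,0,0), (-204,1,2,1,0), (-204,1,2,0,1), (-180,1,1,2,0), (-144,1,1,1,1),
        (-180,1,1,0,2), (-72,1,0,3,0), (-72,1,0,2,1), (-72,1,0,1,2), (-72,1,0,0,3), (48,0,3,1,0),
        (48,0,3,0,1), (60,0,2,2,0), (120,0,2,1,1), (60,0,2,0,2), (54,0,1,3,0), (90,0,1,2,1),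
        (90,0,1,1,2), (54,0,1,0,3), (18,0,0,4,0), (36,0,0,3,1), (36,0,0,2,2), (36,0,0,1,3),
        (18,0,0,0,4), (-432,2,3,0,0), (1032,1,4,0,0), (1008,1,3,1,0), (1008,1,3,0,1),
        (792,1,2,2,0), (432,1,2,1,1), (792,1,2,0,2), (432,1,1,3,0), (432,1,1,2,1), (432,1,1,1,2),
        (432,1,1,0,3), (216,1,0,4,0), (432,1,0,2,2), (216,1,0,0,4), (-198,0,5,0,0), (-732,0,4,1,0),
        (-732,0,4,0,1), (-882,0,3,2,0), (-1116,0,3,1,1), (-882,0,3,0,2), (-720,0,2,3,0),
        (-936,0,2,2,1), (-936,0,2,1,2), (-720,0,2,0,3), (-378,0,1,4,0), (-432,0,1,3,1),
        (-756,0,1,2,2), (-432,0,1,1,3), (-378,0,1,0,4), (-108,0,0,5,0), (-108,0,0,4,1),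
        (-216,0,0,3,2), (-216,0,0,2,3), (-108,0,0,1,4), (-108,0,0,0,5), (-3456,1,5,0,0),
        (-2592,1,4,1,0), (-2592,1,4,0,1), (-2592,1,3,2,0), (-2592,1,3,0,2), (2456,0,6,0,0),
        (4824,0,5,1,0), (4824,0,5,0,1), (5256,0,4,2,0), (4320,0,4,1,1), (5256,0,4,0,2),
        (3240,0,3,3,0), (3672,0,3,2,1), (3672,0,3,1,2), (3240,0,3,0,3), (1512,0,2,4,0),
        (1296,0,2,3,1), (3024,0,2,2,2), (1296,0,2,1,3), (1512,0,2,0,4), (648,0,1,5,0),
        (648,0,1,4,1), (1296,0,1,3,2), (1296,0,1,2,3), (648,0,1,1,4), (648,0,1,0,5), (216,0,0,6,0),
        (648,0,0,4,2), (648,0,0,2,4), (216,0,0,0,6), (7776,1,6,0,0), (-12744,0,7,0,0),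
        (-14256,0,6,1,0), (-14256,0,6,0,1), (-14256,0,5,2,0), (-7776,0,5,1,1), (-14256,0,5,0,2),
        (-7776,0,4,3,0), (-7776,0,4,2,1), (-7776,0,4,1,2), (-7776,0,4,0,3), (-3888,0,3,4,0),
        (-7776,0,3,2,2), (-3888,0,3,0,4), (31104,0,8,0,0), (23328,0,7,1,0), (23328,0,7,0,1),
        (23328,0,6,2,0), (23328,0,6,0,2), (-46656,0,9,0,0)]" and
      ns="[(-1,2,0,0,0), (-2,1,2,0,0), (-6,1,1,1,0), (-6,1,1,0,1), (-6,1,0,2,0), (-6,1,0,0,2),
        (36,1,3,0,0), (-1,0,4,0,0), (-6,0,3,1,0), (-6,0,3,0,1), (-15,0,2,2,0), (-18,0,2,1,1),
        (-15,0,2,0,2), (-18,0,1,3,0), (-18,0,1,2,1), (-18,0,1,1,2), (-18,0,1,0,3), (-9,0,0,4,0),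
        (-18,0,0,2,2), (-9,0,0,0,4), (36,0,5,0,0), (108,0,4,1,0), (108,0,4,0,1), (108,0,3,2,0),
        (108,0,3,0,2), (-324,0,6,0,0)]"],
    goal_cases)
  case (1 p)
  show ?case
    by (simp add: expansion_simps, simp only: expansion_steps) (simp, algebra)
next
  case (2 p)
  show ?case
    by (simp add: expansion_simps, simp only: expansion_steps) (simp, algebra)
qed (simp_all add: expansion_checks)

lemma K_equivalent_M1_sharp: "K_equivalent (X'_eqs M1_sharp) (normal_form 2 3 4 3)"
  unfolding X'_eqs_def
proof (rule K_equivalent_expansion[where
      wt="tup 33 44 57 38" and e=37 and
      A="vector [vector [1,-1,2,1], vector [0,1,0,0], vector [0,1,-1,0], vector [0,-1,1,1]]" and
      B="vector [vector [1,-1,1,-1], vector [0,1,0,0], vector [0,1,-1,0], vector [0,0,1,1]]" and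
      S="tup [] [(-1,1,1,0,0), (1,1,0,0,1), (2,0,0,0,2)] [(-1,2,0,0,0), (-2,1,0,0,1), (-3,0,2,0,0),
        (3,0,1,0,1), (-1,0,0,0,2)] [(-1,2,0,0,0), (-6,1,0,0,1)]" and
      R="tup [] [] [] []" and
      ma="[(1,0,0,0,0)]" and mb="[(-1,0,0,0,0)]" and mc="[(1,1,0,0,0), (-2,0,1,0,0), (4,0,0,0,1)]"
        and md="[(1,0,0,0,0), (-1,1,0,0,0), (2,0,1,0,0), (-4,0,0,0,1)]" and
      ms="[(1,0,0,2,0), (-3,2,0,1,0), (-2,1,2,0,0), (6,1,1,1,0), (4,1,1,0,1), (-4,1,0,2,0),
        (-10,1,0,1,1), (1,0,3,0,0), (-11,0,2,1,0), (-3,0,2,0,1), (8,0,1,2,0), (16,0,1,1,1),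
        (3,0,1,0,2), (-4,0,0,3,0), (-8,0,0,2,1), (-7,0,0,1,2), (-1,0,0,0,3), (3,4,0,0,0),
        (-11,3,1,0,0), (14,3,0,1,0), (23,3,0,0,1), (21,2,2,0,0), (-32,2,1,1,0), (-69,2,1,0,1),
        (20,2,0,2,0), (84,2,0,1,1), (57,2,0,0,2), (-21,1,3,0,0), (34,1,2,1,0), (85,1,2,0,1),
        (-8,1,1,2,0), (-136,1,1,1,1), (-109,1,1,0,2), (80,1,0,2,1), (122,1,0,1,2), (49,1,0,0,3),
        (24,0,4,0,0), (-48,0,3,1,0), (-63,0,3,0,1), (36,0,2,2,0), (96,0,2,1,1), (71,0,2,0,2),
        (-36,0,1,2,1), (-84,0,1,1,2), (-43,0,1,0,3), (28,0,0,2,2), (36,0,0,1,3), (12,0,0,0,4),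
        (-12,5,0,0,0), (31,4,1,0,0), (-33,4,0,1,0), (-119,4,0,0,1), (-60,3,2,0,0), (26,3,1,1,0),
        (262,3,1,0,1), (-262,3,0,1,1), (-396,3,0,0,2), (99,2,3,0,0), (-125,2,2,1,0),
        (-413,2,2,0,1), (222,2,1,1,1), (705,2,1,0,2), (-609,2,0,1,2), (-515,2,0,0,3),
        (-66,1,4,0,0), (48,1,3,1,0), (438,1,3,0,1), (-528,1,2,1,1), (-760,1,2,0,2), (516,1,1,1,2),
        (614,1,1,0,3), (-364,1,0,1,3), (-250,1,0,0,4), (72,0,5,0,0), (-108,0,4,1,0),
        (-216,0,4,0,1), (216,0,3,1,1), (324,0,3,0,2), (-276,0,2,1,2), (-288,0,2,0,3),
        (168,0,1,1,3), (148,0,1,0,4), (-64,0,0,1,4), (-40,0,0,0,5), (18,6,0,0,0), (-21,5,1,0,0),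
        (213,5,0,0,1), (107,4,2,0,0), (-263,4,1,0,1), (911,4,0,0,2), (-79,3,3,0,0), (895,3,2,0,1),
        (-1163,3,1,0,2), (1679,3,0,0,3), (195,2,4,0,0), (-681,2,3,0,1), (2324,2,2,0,2),
        (-2053,2,1,0,3), (1259,2,0,0,4), (-72,1,5,0,0), (864,1,4,0,1), (-1620,1,3,0,2),
        (1920,1,2,0,3), (-1132,1,1,0,4), (408,1,0,0,5), (108,0,6,0,0), (-324,0,5,0,1),
        (576,0,4,0,2), (-612,0,3,0,3), (444,0,2,0,4), (-192,0,1,0,5), (48,0,0,0,6)]" and
      ns="[(-6,1,1,1,0), (5,1,0,2,0), (-1,0,3,0,0), (5,0,2,1,0), (-10,0,1,2,0), (-10,0,1,1,1),
        (4,0,0,3,0), (12,0,0,2,1), (5,0,0,1,2), (-1,4,0,0,0), (11,3,1,0,0), (-17,3,0,1,0),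
        (-11,3,0,0,1), (-14,2,2,0,0), (44,2,1,1,0), (64,2,1,0,1), (-24,2,0,2,0), (-106,2,0,1,1),
        (-38,2,0,0,2), (26,1,3,0,0), (-57,1,2,1,0), (-74,1,2,0,1), (24,1,1,2,0), (196,1,1,1,1),
        (98,1,1,0,2), (-4,1,0,3,0), (-104,1,0,2,1), (-169,1,0,1,2), (-40,1,0,0,3), (-17,0,4,0,0),
        (70,0,3,1,0), (55,0,3,0,1), (-52,0,2,2,0), (-172,0,2,1,1), (-74,0,2,0,2), (8,0,1,3,0),
        (84,0,1,2,1), (162,0,1,1,2), (51,0,1,0,3), (-16,0,0,3,1), (-60,0,0,2,2), (-64,0,0,1,3),
        (-15,0,0,0,4), (15,5,0,0,0), (-48,4,1,0,0), (47,4,0,1,0), (154,4,0,0,1), (103,3,2,0,0),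
        (-86,3,1,1,0), (-421,3,1,0,1), (20,3,0,2,0), (402,3,0,1,1), (545,3,0,0,2), (-162,2,3,0,0),
        (223,2,2,1,0), (720,2,2,0,1), (-48,2,1,2,0), (-654,2,1,1,1), (-1204,2,1,0,2),
        (160,2,0,2,1), (1067,2,0,1,2), (792,2,0,0,3), (132,1,4,0,0), (-164,1,3,1,0),
        (-755,1,3,0,1), (52,1,2,2,0), (1032,1,2,1,1), (1389,1,2,0,2), (-228,1,1,2,1),
        (-1388,1,1,1,2), (-1191,1,1,0,3), (348,1,0,2,2), (888,1,0,1,3), (458,1,0,0,4),
        (-120,0,5,0,0), (204,0,4,1,0), (438,0,4,0,1), (-72,0,3,2,0), (-600,0,3,1,1),
        (-718,0,3,0,2), (216,0,2,2,1), (828,0,2,1,2), (658,0,2,0,3), (-200,0,1,2,2),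
        (-576,0,1,1,3), (-344,0,1,0,4), (112,0,0,2,3), (208,0,0,1,4), (88,0,0,0,5), (-30,6,0,0,0),
        (76,5,1,0,0), (-33,5,0,1,0), (-380,5,0,0,1), (-229,4,2,0,0), (92,4,1,1,0), (887,4,1,0,1),
        (-394,4,0,1,1), (-1783,4,0,0,2), (298,3,3,0,0), (-177,3,2,1,0), (-2072,3,2,0,1),
        (850,3,1,1,1), (3708,3,1,0,2), (-1657,3,0,1,2), (-3778,3,0,0,3), (-459,2,4,0,0),
        (298,2,3,1,0), (2341,2,3,0,1), (-1472,2,2,1,1), (-6146,2,2,0,2), (2622,2,1,1,2),
        (6517,2,1,0,3), (-2800,2,0,1,3), (-3569,2,0,0,4), (276,1,5,0,0), (-204,1,4,1,0),
        (-2220,1,4,0,1), (1464,1,3,1,1), (5216,1,3,0,2), (-3420,1,2,1,2), (-6476,1,2,0,3),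
        (2960,1,1,1,3), (4236,1,1,0,4), (-1520,1,0,1,4), (-1448,1,0,0,5), (-252,0,6,0,0),
        (216,0,5,1,0), (1044,0,5,0,1), (-864,0,4,1,1), (-2088,0,4,0,2), (1416,0,3,1,2),
        (2484,0,3,0,3), (-1440,0,2,1,3), (-1892,0,2,0,4), (800,0,1,1,4), (864,0,1,0,5),
        (-256,0,0,1,5), (-208,0,0,0,6), (18,7,0,0,0), (-57,6,1,0,0), (285,6,0,0,1), (149,5,2,0,0),
        (-773,5,1,0,1), (1763,5,0,0,2), (-293,4,3,0,0), (1849,4,2,0,1), (-4037,4,1,0,2),
        (5323,4,0,0,3), (353,3,4,0,0), (-2787,3,3,0,1), (8230,3,2,0,2), (-10063,3,1,0,3),
        (7975,3,0,0,4), (-462,2,5,0,0), (3006,2,4,0,1), (-8992,2,3,0,2), (15322,2,2,0,3),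
        (-11862,2,1,0,4), (5444,2,0,0,5), (252,1,6,0,0), (-2340,1,5,0,1), (7272,1,4,0,2),
        (-10932,1,3,0,3), (10388,1,2,0,4), (-5536,1,1,0,5), (1680,1,0,0,6), (-216,0,7,0,0),
        (1080,0,6,0,1), (-2448,0,5,0,2), (3528,0,4,0,3), (-3336,0,3,0,4), (2160,0,2,0,5),
        (-864,0,1,0,6), (192,0,0,0,7)]"],
    goal_cases)
  case (1 p)
  show ?case
    by (simp add: expansion_simps, simp only: expansion_steps) (simp, algebra)
next
  case (2 p)
  show ?case
    by (simp add: expansion_simps, simp only: expansion_steps) (simp, algebra)
qed (simp_all add: expansion_checks)

section \<open>Invariants of contact equivalence\<close>

text \<open>The scale \<open>t\<close> is recorded together with the sequence, so that orders of
  vanishing are measured against it and the limit is a vector on which the derivative of a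
  coordinate change acts.\<close>

definition approaches :: "(nat \<Rightarrow> complex) \<Rightarrow> (nat \<Rightarrow> complex^4)
    \<Rightarrow> complex^4 \<Rightarrow> bool" where
  "approaches t p v \<longleftrightarrow> t \<longlonglongrightarrow> 0 \<and>
      (\<forall>n. t n \<noteq> 0) \<and> (\<lambda>n. (1 / t n) *s p n) \<longlonglongrightarrow>
      v"

definition minor ::
  "(complex^4 \<Rightarrow> complex) \<Rightarrow> (complex^4 \<Rightarrow> complex) \<Rightarrow> 4
      \<Rightarrow> 4 \<Rightarrow> complex^4 \<Rightarrow> complex" where
  "minor f g i j p = pd f i p * pd g j p - pd f j p * pd g i p"

text \<open>\<open>v\<close> is a direction along which the equations and the minors of their Jacobian matrix vanish
  to order \<open>N\<close>. For a normal form and \<open>N \<ge> 3\<close> these are the coordinate directions whose exponent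
  is at least \<open>N\<close>.\<close>

definition singular_dir ::
  "(complex^4 \<Rightarrow> complex) \<Rightarrow> (complex^4 \<Rightarrow> complex) \<Rightarrow>
      nat \<Rightarrow> complex^4 \<Rightarrow> bool" where
  "singular_dir f g N v \<longleftrightarrow> (\<exists>t p. approaches t p v \<and>
     (\<lambda>n. f (p n)) \<in> O(\<lambda>n. t n ^ N) \<and> (\<lambda>n. g (p n)) \<in>
         O(\<lambda>n. t n ^ N) \<and>
     (\<forall>i j. (\<lambda>n. minor f g i j (p n)) \<in> O(\<lambda>n. t n ^ N)))"

text \<open>For equations of order at least 2 this describes the common zeros of their quadratic
  parts; see \<open>nf_tangent_dir\<close>.\<close>

definition tangent_dir ::
  "(complex^4 \<Rightarrow> complex) \<Rightarrow> (complex^4 \<Rightarrow> complex) \<Rightarrow>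
      complex^4 \<Rightarrow> bool" where
  "tangent_dir f g v \<longleftrightarrow> (\<exists>t p. approaches t p v \<and>
     (\<lambda>n. f (p n)) \<in> o(\<lambda>n. t n ^ 2) \<and> (\<lambda>n. g (p n)) \<in>
         o(\<lambda>n. t n ^ 2))"

lemma tendsto_smult:
  "f \<longlonglongrightarrow> c \<Longrightarrow> g \<longlonglongrightarrow> v \<Longrightarrow>
      (\<lambda>n. f n *s g n) \<longlonglongrightarrow> c *s (v :: complex^4)"
  by (rule vec_tendstoI) (simp add: tendsto_mult tendsto_vec_nth)

lemma approaches_tendsto_0: "approaches t p v \<Longrightarrow> p \<longlonglongrightarrow> 0"
proof -
  assume a: "approaches t p v"
  then have "(\<lambda>n. t n *s ((1 / t n) *s p n)) \<longlonglongrightarrow> 0 *s v"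
    unfolding approaches_def by (intro tendsto_smult) auto
  moreover have "t n *s ((1 / t n) *s p n) = p n" for n
    using a by (simp add: approaches_def vec_eq_iff)
  ultimately show ?thesis by simp
qed

definition dmap :: "(complex^4 \<Rightarrow> complex^4) \<Rightarrow> complex^4 \<Rightarrow>
    complex^4" where
  "dmap \<phi> h = (\<chi> i. \<Sum>j\<in>UNIV. h $ j * pd (\<lambda>p. \<phi> p $ i) j 0)"

lemma dmap_linear: "dmap \<phi> (a + b) = dmap \<phi> a + dmap \<phi> b" "dmap \<phi> (c *s a) =
    c *s dmap \<phi> a"
  by (simp_all add: dmap_def vec_eq_iff sum.distrib algebra_simps sum_distrib_left)

lemma dmap_has_derivative:
  assumes "\<And>i. holo_at_0 (\<lambda>p. \<phi> p $ i)"
  shows "(\<phi> has_derivative dmap \<phi>) (at 0)"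
proof (rule has_derivative_vec)
  fix i
  have "cdiff (\<lambda>p. \<phi> p $ i) 0"
    using assms[of i] unfolding holo_at_0_iff by (rule eventually_nhds_x_imp_x)
  then show "((\<lambda>x. \<phi> x $ i) has_derivative (\<lambda>h. dmap \<phi> h $ i)) (at 0)"
    using cdiff_has_derivative by (simp add: dmap_def)
qed

text \<open>\<open>\<phi>\<close> differs from its derivative at 0 by an error small compared with
  \<open>norm (p n)\<close>, and \<open>p n\<close> is bounded by a multiple of
  \<open>t n\<close>.\<close>

lemma approaches_map:
  assumes "\<And>i. holo_at_0 (\<lambda>p. \<phi> p $ i)" "\<phi> 0 = 0" "approaches t p v"
  shows "approaches t (\<lambda>n. \<phi> (p n)) (dmap \<phi> v)"
proof -
  have t: "t \<longlonglongrightarrow> 0" "\<And>n. t n \<noteq> 0"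
      and u: "(\<lambda>n. (1 / t n) *s p n) \<longlonglongrightarrow> v"
    using assms(3) by (auto simp: approaches_def)
  define u where "u = (\<lambda>n. (1 / t n) *s p n)"
  have der: "(\<phi> has_derivative dmap \<phi>) (at 0)" by (rule dmap_has_derivative[OF assms(1)])
  have bl: "bounded_linear (dmap \<phi>)" using der by (rule has_derivative_bounded_linear)
  have nrm: "norm (c *s x) = norm c * norm x" for c :: complex and x :: "complex^4"
    by (simp add: norm_vec_def norm_mult L2_set_right_distrib)
  have 1: "(\<lambda>n. dmap \<phi> (u n)) \<longlonglongrightarrow> dmap \<phi> v"
    using u bounded_linear.tendsto[OF bl] by (simp add: u_def)
  have 2: "(\<lambda>n. (1 / t n) *s (\<phi> (p n) - dmap \<phi> (p n))) \<longlonglongrightarrow>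
      0"
  proof (rule tendstoI)
    fix e :: real assume e: "e > 0"
    define e' where "e' = e / (2 * (norm v + 1))"
    have nv: "norm v + 1 > 0" by (smt (verit) norm_ge_zero)
    have e': "e' > 0" using e nv by (simp add: e'_def)
    obtain d where d: "d > 0" "\<And>y. norm y < d \<Longrightarrow>
        norm (\<phi> y - dmap \<phi> y) \<le> e' * norm y"
      using der e' assms(2) unfolding has_derivative_at_alt by auto
    have "\<forall>\<^sub>F n in sequentially. dist (p n) 0 < d"
      using approaches_tendsto_0[OF assms(3)] d(1) by (rule tendstoD)
    moreover have "\<forall>\<^sub>F n in sequentially. dist (u n) v < 1"
      using u by (intro tendstoD) (simp_all add: u_def)
    ultimately show "\<forall>\<^sub>F n in sequentially. dist
        ((1 / t n) *s (\<phi> (p n) - dmap \<phi> (p n))) 0 < e"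
    proof eventually_elim
      case (elim n)
      have "norm (u n) \<le> norm v + 1"
        using elim(2) norm_triangle_ineq2[of "u n" v] by (simp add: dist_norm)
      have "norm ((1 / t n) *s (\<phi> (p n) - dmap \<phi> (p n))) \<le>
          norm (1 / t n) * (e' * norm (p n))"
        unfolding nrm using d(2)[of "p n"] elim(1) by (intro mult_left_mono) auto
      also have "\<dots> = e' * norm (u n)" by (simp add: u_def nrm)
      also have "\<dots> \<le> e' * (norm v + 1)" using \<open>norm (u n) \<le> _\<close> e' by simp
      also have "\<dots> = e / 2" using nv by (simp add: e'_def field_simps)
      also have "\<dots> < e" using e by simp
      finally show ?case by simp
    qed
  qed
  have "(1 / t n) *s \<phi> (p n) = (1 / t n) *s (\<phi> (p n) - dmap \<phi> (p n)) +
      dmap \<phi> (u n)" for n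
    by (simp add: u_def dmap_linear vec_eq_iff algebra_simps)
  then have "(\<lambda>n. (1 / t n) *s \<phi> (p n)) \<longlonglongrightarrow> dmap \<phi> v"
    using tendsto_add[OF 2 1] by simp
  then show ?thesis using t by (simp add: approaches_def)
qed

lemma holo0_seq_bigo:
  assumes "holo_at_0 f" "p \<longlonglongrightarrow> 0"
  shows "(\<lambda>n. f (p n)) \<in> O(\<lambda>n. 1)"
proof -
  have "(\<lambda>n. f (p n)) \<longlonglongrightarrow> f 0"
    using holo0_tendsto[OF assms(1)] assms(2) by (rule filterlim_compose)
  then show ?thesis by (intro bigoI_tendsto[where c="f 0"]) simp_all
qed

lemma pd_seq_bigo:
  assumes "holo_at_0 f" "p \<longlonglongrightarrow> 0"
  shows "(\<lambda>n. pd f i (p n)) \<in> O(\<lambda>n. 1)"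
proof -
  obtain S where S: "open S" "0 \<in> S" "holo_on S f" using assms(1) unfolding holo_at_0_def
      by blast
  then have "isCont (pd f i) 0" using pd_continuous continuous_on_eq_continuous_at by blast
  then have "(\<lambda>n. pd f i (p n)) \<longlonglongrightarrow> pd f i 0"
    using assms(2) by (rule isCont_tendsto_compose)
  then show ?thesis by (intro bigoI_tendsto[where c="pd f i 0"]) simp_all
qed

lemma bigo_mult_1:
  "f \<in> O(\<lambda>n. 1) \<Longrightarrow> g \<in> O(h) \<Longrightarrow>
      (\<lambda>n. f n * g n) \<in> O(h :: nat \<Rightarrow> complex)"
  "f \<in> O(\<lambda>n. 1) \<Longrightarrow> g \<in> O(h) \<Longrightarrow>
      (\<lambda>n. g n * f n) \<in> O(h :: nat \<Rightarrow> complex)"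
  using landau_o.big.mult[of f sequentially "\<lambda>n. 1" g h] by (simp_all add: mult.commute)

lemma pd_comp:
  fixes \<psi> :: "complex^4 \<Rightarrow> complex^4"
  assumes "\<And>k. cdiff (\<lambda>p. \<psi> p $ k) q" "cdiff f (\<psi> q)"
  shows "pd (\<lambda>p. f (\<psi> p)) i q =
      (\<Sum>k\<in>UNIV. pd (\<lambda>p. \<psi> p $ k) i q * pd f k (\<psi> q))"
proof -
  have d: "(\<psi> has_derivative (\<lambda>h. \<chi> k. \<Sum>j\<in>UNIV. h $ j * pd
      (\<lambda>p. \<psi> p $ k) j q)) (at q)"
    by (rule has_derivative_vec) (simp add: cdiff_has_derivative assms)
  have "((\<lambda>p. f (\<psi> p)) has_derivative
      (\<lambda>h. \<Sum>k\<in>UNIV. (\<chi> k. \<Sum>j\<in>UNIV. h $ j * pd (\<lambda>p. \<psi> p $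
          k) j q) $ k * pd f k (\<psi> q))) (at q)"
    by (rule has_derivative_compose[OF d cdiff_has_derivative[OF assms(2)]])
  then have "pd (\<lambda>p. f (\<psi> p)) i q =
      (\<Sum>k\<in>UNIV. (\<chi> k. \<Sum>j\<in>UNIV. axis i 1 $ j * pd (\<lambda>p. \<psi> p $ k) j
          q) $ k * pd f k (\<psi> q))"
    by (rule pd_eqI) (simp add: sum_distrib_left algebra_simps)
  then show ?thesis by (simp add: axis_def if_distrib if_distribR cong: if_cong)
qed

lemma pd_cong:
  assumes "\<forall>\<^sub>F q in nhds p. f q = g q" "cdiff f p"
  shows "pd g i p = pd f i p"
proof -
  obtain D where D: "(f has_derivative D) (at p)" "\<And>c v. D (c *s v) = c * D v"
    using assms(2) unfolding cdiff_def by blast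
  have "(g has_derivative D) (at p)"
    using D(1) by (rule has_derivative_transform_eventually)
      (use eventually_nhds_x_imp_x[OF assms(1)] assms(1) in \<open>simp_all add:
          eventually_at_filter eventually_mono\<close>)
  then show ?thesis using pd_eqI[OF D] pd_eqI[of g D] D(2) by simp
qed

text \<open>The product rule, with the terms that contain derivatives of \<open>a\<close> and
  \<open>b\<close> kept apart: they are multiples of \<open>f1\<close> and \<open>f2\<close> and
  hence as small as the equations.\<close>

lemma pd_combination:
  assumes "\<forall>\<^sub>F p in nhds 0. g p = a p * f1 p + b p * f2 p"
    and "holo_at_0 a" "holo_at_0 b" "holo_at_0 f1" "holo_at_0 f2"
  shows "\<forall>\<^sub>F p in nhds 0. \<forall>i. pd g i p =
    a p * pd f1 i p + b p * pd f2 i p + (pd a i p * f1 p + pd b i p * f2 p)"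
proof -
  have "\<forall>\<^sub>F p in nhds 0. \<forall>\<^sub>F q in nhds p. a q * f1 q + b q * f2 q = g q"
    using assms(1) by (simp add: eventually_eventually eq_commute)
  then show ?thesis using assms(2-5)[unfolded holo_at_0_iff]
  proof eventually_elim
    case (elim p)
    show ?case
    proof
      fix i
      have "pd g i p = pd (\<lambda>q. a q * f1 q + b q * f2 q) i p"
        by (rule pd_cong[OF elim(1)]) (intro cdiff_add cdiff_mult elim)
      also have "\<dots> = pd (\<lambda>q. a q * f1 q) i p + pd (\<lambda>q. b q * f2 q) i p"
        by (intro pd_add cdiff_mult elim)
      also have "\<dots> = (a p * pd f1 i p + pd a i p * f1 p) +
          (b p * pd f2 i p + pd b i p * f2 p)"
        by (simp add: pd_mult elim)
      finally show "pd g i p = a p * pd f1 i p + b p * pd f2 i p +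
          (pd a i p * f1 p + pd b i p * f2 p)"
        by simp
    qed
  qed
qed

text \<open>One half of a contact equivalence, namely one inclusion of ideals. Contact equivalence
  yields two instances in opposite directions, so every transport lemma is proved for implications
  only.\<close>

locale ideal_map =
  fixes f1 f2 g1 g2 :: "complex^4 \<Rightarrow> complex"
      and \<phi> \<psi> :: "complex^4 \<Rightarrow> complex^4"
  assumes hol: "holo_at_0 f1" "holo_at_0 f2" "holo_at_0 g1" "holo_at_0 g2"
    and \<phi>: "\<And>i. holo_at_0 (\<lambda>p. \<phi> p $ i)" "\<phi> 0 = 0"
    and \<psi>: "\<And>i. holo_at_0 (\<lambda>p. \<psi> p $ i)" "\<psi> 0 = 0"
    and inv: "\<forall>\<^sub>F p in nhds 0. \<psi> (\<phi> p) = p"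
        "\<forall>\<^sub>F p in nhds 0. \<phi> (\<psi> p) = p"
    and ideal: "(\<lambda>p. g1 (\<phi> p)) \<in> germ_ideal f1 f2"
        "(\<lambda>p. g2 (\<phi> p)) \<in> germ_ideal f1 f2"
begin

lemma seq_eventually: "p \<longlonglongrightarrow> 0 \<Longrightarrow>
    \<forall>\<^sub>F x in nhds 0. P x \<Longrightarrow> \<forall>\<^sub>F n in sequentially. P
    (p n)"
  by (rule eventually_compose_filterlim[of P "nhds 0" p sequentially])

lemma tangent_dir_map:
  assumes "tangent_dir f1 f2 v"
  shows "tangent_dir g1 g2 (dmap \<phi> v)"
proof -
  obtain t p where tp: "approaches t p v" "(\<lambda>n. f1 (p n)) \<in> o(\<lambda>n. t n ^ 2)"
      "(\<lambda>n. f2 (p n)) \<in> o(\<lambda>n. t n ^ 2)"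
    using assms unfolding tangent_dir_def by blast
  have p0: "p \<longlonglongrightarrow> 0" by (rule approaches_tendsto_0[OF tp(1)])
  have *: "(\<lambda>n. g (\<phi> (p n))) \<in> o(\<lambda>n. t n ^ 2)"
      if g: "(\<lambda>p. g (\<phi> p)) \<in> germ_ideal f1 f2" for g
  proof -
    obtain a b where ab: "holo_at_0 a" "holo_at_0 b" "\<forall>\<^sub>F p in nhds 0. g (\<phi> p) =
        a p * f1 p + b p * f2 p"
      using g by (rule germ_idealE)
    have "(\<lambda>n. a (p n) * f1 (p n)) \<in> o(\<lambda>n. 1 * t n ^ 2)"
        "(\<lambda>n. b (p n) * f2 (p n)) \<in> o(\<lambda>n. 1 * t n ^ 2)"
      by (rule landau_o.big_small_mult[OF holo0_seq_bigo[OF ab(1) p0] tp(2)],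
          rule landau_o.big_small_mult[OF holo0_seq_bigo[OF ab(2) p0] tp(3)])
    then have "(\<lambda>n. a (p n) * f1 (p n) + b (p n) * f2 (p n)) \<in> o(\<lambda>n. t n ^ 2)"
      by (intro sum_in_smallo) simp_all
    moreover have "\<forall>\<^sub>F n in sequentially. a (p n) * f1 (p n) + b (p n) * f2 (p n) =
        g (\<phi> (p n))"
      using seq_eventually[OF p0 ab(3)] by eventually_elim simp
    ultimately show ?thesis by (simp cong: landau_o.small.in_cong)
  qed
  show ?thesis unfolding tangent_dir_def
    using approaches_map[OF \<phi> tp(1)] *[OF ideal(1)] *[OF ideal(2)]
    by (intro exI[of _ t] exI[of _ "\<lambda>n. \<phi> (p n)"]) simp
qed

text \<open>Minors of the pulled-back equations are a determinant times minors of \<open>f1\<close>,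
  \<open>f2\<close>, up to terms containing \<open>f1\<close> or \<open>f2\<close>. Equations and
  minors together are thus respected, although the minors alone are not. The chain rule for
  \<open>\<psi>\<close> then passes from the pullbacks to \<open>g1\<close>,
  \<open>g2\<close>.\<close>

lemma singular_dir_map:
  assumes "singular_dir f1 f2 N v"
  shows "singular_dir g1 g2 N (dmap \<phi> v)"
proof -
  obtain t p where tp: "approaches t p v" and f: "(\<lambda>n. f1 (p n)) \<in>
      O(\<lambda>n. t n ^ N)" "(\<lambda>n. f2 (p n)) \<in> O(\<lambda>n. t n ^ N)"
    and m: "\<And>i j. (\<lambda>n. minor f1 f2 i j (p n)) \<in> O(\<lambda>n. t n ^ N)"
    using assms unfolding singular_dir_def by blast
  have p0: "p \<longlonglongrightarrow> 0" by (rule approaches_tendsto_0[OF tp(1)])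
  define q where "q = (\<lambda>n. \<phi> (p n))"
  have q: "approaches t q (dmap \<phi> v)" unfolding q_def by (rule approaches_map[OF \<phi> tp])
  have q0: "q \<longlonglongrightarrow> 0" by (rule approaches_tendsto_0[OF q])
  obtain a1 b1 where ab1: "holo_at_0 a1" "holo_at_0 b1"
      "\<forall>\<^sub>F p in nhds 0. g1 (\<phi> p) = a1 p * f1 p + b1 p * f2 p"
    using ideal(1) by (rule germ_idealE)
  obtain a2 b2 where ab2: "holo_at_0 a2" "holo_at_0 b2"
      "\<forall>\<^sub>F p in nhds 0. g2 (\<phi> p) = a2 p * f1 p + b2 p * f2 p"
    using ideal(2) by (rule germ_idealE)
  have fb: "(\<lambda>n. a (p n) * f1 (p n) + b (p n) * f2 (p n)) \<in> O(\<lambda>n. t n ^ N)"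
    if "holo_at_0 a" "holo_at_0 b" for a b
    by (intro sum_in_bigo bigo_mult_1(1)[OF holo0_seq_bigo[OF that(1) p0]]
      bigo_mult_1(1)[OF holo0_seq_bigo[OF that(2) p0]] f)
  have g1: "(\<lambda>n. g1 (q n)) \<in> O(\<lambda>n. t n ^ N)"
    using fb[OF ab1(1,2)] seq_eventually[OF p0 ab1(3)]
        by (simp add: q_def cong: landau_o.big.in_cong)
  have g2: "(\<lambda>n. g2 (q n)) \<in> O(\<lambda>n. t n ^ N)"
    using fb[OF ab2(1,2)] seq_eventually[OF p0 ab2(3)]
        by (simp add: q_def cong: landau_o.big.in_cong)
  define h1 h2 where "h1 = (\<lambda>p. g1 (\<phi> p))" and "h2 = (\<lambda>p. g2 (\<phi> p))"
  have hh: "holo_at_0 h1" "holo_at_0 h2" unfolding h1_def h2_def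
      by (rule holo0_comp[OF \<phi> hol(3)], rule holo0_comp[OF \<phi> hol(4)])
  have mh: "(\<lambda>n. minor h1 h2 k l (p n)) \<in> O(\<lambda>n. t n ^ N)" for k l
  proof -
    define r s where "r = (\<lambda>i n. pd a1 i (p n) * f1 (p n) + pd b1 i (p n) * f2 (p n))"
      and "s = (\<lambda>i n. pd a2 i (p n) * f1 (p n) + pd b2 i (p n) * f2 (p n))"
    have rs: "r i \<in> O(\<lambda>n. t n ^ N)" "s i \<in> O(\<lambda>n. t n ^ N)" for i
      unfolding r_def s_def
      by (intro sum_in_bigo bigo_mult_1(1)[OF pd_seq_bigo[OF ab1(1) p0]]
          bigo_mult_1(1)[OF pd_seq_bigo[OF ab1(2) p0]]
        bigo_mult_1(1)[OF pd_seq_bigo[OF ab2(1) p0]] bigo_mult_1(1)[OF pd_seq_bigo[OF ab2(2) p0]]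
            f)+
    \<comment> \<open>The gradient of \<open>h1\<close> is \<open>A + r\<close> and that of
      \<open>h2\<close> is \<open>B\<close>, which still contains \<open>s\<close>. Expanding in
      this asymmetric way gives four error terms, each with a single factor \<open>r\<close> or
      \<open>s\<close>.\<close>
    define A where "A = (\<lambda>i n. a1 (p n) * pd f1 i (p n) + b1 (p n) * pd f2 i (p n))"
    define B where "B = (\<lambda>i n. pd h2 i (p n))"
    have A: "A i \<in> O(\<lambda>n. 1)" for i
      unfolding A_def
      by (intro sum_in_bigo bigo_mult_1(1)[OF holo0_seq_bigo[OF ab1(1) p0]]
          bigo_mult_1(1)[OF holo0_seq_bigo[OF ab1(2) p0]]
        pd_seq_bigo[OF hol(1) p0] pd_seq_bigo[OF hol(2) p0])
    have B: "B i \<in> O(\<lambda>n. 1)" for i unfolding B_def by (rule pd_seq_bigo[OF hh(2) p0])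
    have D: "(\<lambda>n. a1 (p n) * b2 (p n) - a2 (p n) * b1 (p n)) \<in> O(\<lambda>n. 1)"
      by (intro sum_in_bigo bigo_mult_1(1)[OF holo0_seq_bigo[OF ab1(1) p0]]
          bigo_mult_1(1)[OF holo0_seq_bigo[OF ab2(1) p0]]
        holo0_seq_bigo[OF ab1(2) p0] holo0_seq_bigo[OF ab2(2) p0])
    have "(\<lambda>n. (a1 (p n) * b2 (p n) - a2 (p n) * b1 (p n)) * minor f1 f2 k l (p n)
        + A k n * s l n - A l n * s k n + B l n * r k n - B k n * r l n) \<in> O(\<lambda>n. t n ^
            N)"
      by (intro sum_in_bigo bigo_mult_1(1)[OF D] bigo_mult_1(1)[OF A] bigo_mult_1(1)[OF B] rs m)
    moreover have "\<forall>\<^sub>F n in sequentially. minor h1 h2 k l (p n) =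
        (a1 (p n) * b2 (p n) - a2 (p n) * b1 (p n)) * minor f1 f2 k l (p n)
        + A k n * s l n - A l n * s k n + B l n * r k n - B k n * r l n"
      using seq_eventually[OF p0 pd_combination[OF ab1(3,1,2) hol(1,2)]]
        seq_eventually[OF p0 pd_combination[OF ab2(3,1,2) hol(1,2)]]
    proof eventually_elim
      case (elim n)
      have 1: "pd h1 i (p n) = A i n + r i n" for i using elim(1) by (simp add: h1_def A_def r_def)
      have 2: "pd h2 i (p n) = a2 (p n) * pd f1 i (p n) + b2 (p n) * pd f2 i (p n) + s i n" for i
        using elim(2) by (simp add: h2_def s_def)
      show ?case unfolding minor_def B_def 1 2 unfolding A_def by (simp add: algebra_simps)
    qed
    ultimately show ?thesis by (simp cong: landau_o.big.in_cong)
  qed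
  have "(\<lambda>n. minor g1 g2 i j (q n)) \<in> O(\<lambda>n. t n ^ N)" for i j
  proof -
    define c where "c = (\<lambda>k i n. pd (\<lambda>x. \<psi> x $ k) i (q n))"
    have c: "c k i \<in> O(\<lambda>n. 1)" for k i unfolding c_def
        by (rule pd_seq_bigo[OF \<psi>(1) q0])
    have cc: "(\<lambda>n. c k i n * c l j n) \<in> O(\<lambda>n. 1)" for k l i j
        by (rule bigo_mult_1(1)[OF c c])
    have "(\<lambda>n. \<Sum>k\<in>UNIV. \<Sum>l\<in>UNIV. (c k i n * c l j n) * minor h1 h2 k l
        (p n)) \<in> O(\<lambda>n. t n ^ N)"
      by (intro big_sum_in_bigo bigo_mult_1(1)[OF cc] mh)
    moreover have "\<forall>\<^sub>F n in sequentially. minor g1 g2 i j (q n) =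
        (\<Sum>k\<in>UNIV. \<Sum>l\<in>UNIV. (c k i n * c l j n) * minor h1 h2 k l (p n))"
    proof -
      have pdg: "\<forall>\<^sub>F x in nhds 0. \<forall>i. pd g i x =
          (\<Sum>k\<in>UNIV. pd (\<lambda>x. \<psi> x $ k) i x * pd (\<lambda>p. g (\<phi> p)) k
          (\<psi> x))"
        if "holo_at_0 g" for g
      proof -
        have hg: "holo_at_0 (\<lambda>p. g (\<phi> p))" by (rule holo0_comp[OF \<phi> that])
        have \<psi>0: "filterlim \<psi> (nhds 0) (nhds 0)"
        proof (rule vec_tendstoI)
          show "((\<lambda>p. \<psi> p $ i) \<longlongrightarrow> 0 $ i) (nhds 0)" for i
            using holo0_tendsto[OF \<psi>(1)[of i]] \<psi>(2) by simp
        qed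
        have "\<forall>\<^sub>F x in nhds 0. \<forall>\<^sub>F y in nhds x. \<phi> (\<psi> y) = y"
          using inv(2) by (simp add: eventually_eventually)
        moreover have "\<forall>\<^sub>F x in nhds 0. \<forall>k. cdiff (\<lambda>p. \<psi> p $ k)
            x"
          using \<psi>(1) by (simp add: eventually_all_finite holo_at_0_iff)
        moreover have "\<forall>\<^sub>F x in nhds 0. cdiff (\<lambda>p. g (\<phi> p)) (\<psi> x)"
          using hg unfolding holo_at_0_iff
          by (rule eventually_compose_filterlim[of "cdiff (\<lambda>p. g (\<phi> p))"
              "nhds 0" \<psi> "nhds 0"]) (rule \<psi>0)
        ultimately show ?thesis
        proof eventually_elim
          case (elim x)
          have cd: "cdiff (\<lambda>y. g (\<phi> (\<psi> y))) x"
              by (rule cdiff_comp[of \<psi> x "\<lambda>p. g (\<phi> p)"]) (use elim in auto)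
          have "\<forall>\<^sub>F y in nhds x. g (\<phi> (\<psi> y)) = g y" using elim(1)
              by eventually_elim simp
          then have "pd g i x = pd (\<lambda>y. g (\<phi> (\<psi> y))) i x" for i using cd
              by (rule pd_cong)
          also have "pd (\<lambda>y. g (\<phi> (\<psi> y))) i x =
              (\<Sum>k\<in>UNIV. pd (\<lambda>x. \<psi> x $ k) i x * pd (\<lambda>p. g (\<phi> p)) k
                  (\<psi> x))" for i
            by (rule pd_comp[of \<psi> x "\<lambda>p. g (\<phi> p)"]) (use elim in auto)
          finally show ?case by blast
        qed
      qed
      show ?thesis
        using seq_eventually[OF q0 pdg[OF hol(3)]] seq_eventually[OF q0 pdg[OF hol(4)]]
          seq_eventually[OF p0 inv(1)]
      proof eventually_elim
        case (elim n)
        have "\<psi> (q n) = p n" using elim(3) by (simp add: q_def)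
        then have 1: "pd g1 i (q n) = (\<Sum>k\<in>UNIV. c k i n * pd h1 k (p n))"
          "pd g2 i (q n) = (\<Sum>k\<in>UNIV. c k i n * pd h2 k (p n))" for i
          using elim(1,2) by (simp_all add: c_def h1_def h2_def)
        have "minor g1 g2 i j (q n) = (\<Sum>k\<in>UNIV. \<Sum>l\<in>UNIV. c k i n * pd h1 k (p n) *
            (c l j n * pd h2 l (p n)))
            - (\<Sum>l\<in>UNIV. \<Sum>k\<in>UNIV. c l j n * pd h1 l (p n) *
                (c k i n * pd h2 k (p n)))"
          unfolding minor_def 1 sum_product ..
        also have "(\<Sum>l\<in>UNIV. \<Sum>k\<in>UNIV. c l j n * pd h1 l (p n) *
            (c k i n * pd h2 k (p n))) =
            (\<Sum>k\<in>UNIV. \<Sum>l\<in>UNIV. c l j n * pd h1 l (p n) *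
                (c k i n * pd h2 k (p n)))"
          by (rule sum.swap)
        finally show ?case
          by (simp add: minor_def algebra_simps flip: sum_subtractf)
      qed
    qed
    ultimately show ?thesis by (simp cong: landau_o.big.in_cong)
  qed
  with q g1 g2 show ?thesis unfolding singular_dir_def by blast
qed

text \<open>Vanishing to order 2 along every sequence is a property of the ideal. A sequence for the
  target is pulled back by \<open>\<psi>\<close>, since the hypothesis concerns the source.\<close>

lemma order_two_map:
  assumes "\<And>t p v. approaches t p v \<Longrightarrow> (\<lambda>n. f1 (p n)) \<in>
      O(\<lambda>n. t n ^ 2) \<and> (\<lambda>n. f2 (p n)) \<in> O(\<lambda>n. t n ^ 2)"
    and tq: "approaches t q v"
  shows "(\<lambda>n. g1 (q n)) \<in> O(\<lambda>n. t n ^ 2) \<and> (\<lambda>n. g2 (q n)) \<in>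
      O(\<lambda>n. t n ^ 2)"
proof -
  define p where "p = (\<lambda>n. \<psi> (q n))"
  have p: "approaches t p (dmap \<psi> v)" unfolding p_def by (rule approaches_map[OF \<psi> tq])
  have p0: "p \<longlonglongrightarrow> 0" and q0: "q \<longlonglongrightarrow> 0"
      by (rule approaches_tendsto_0[OF p], rule approaches_tendsto_0[OF tq])
  have "(\<lambda>n. g (q n)) \<in> O(\<lambda>n. t n ^ 2)" if g: "(\<lambda>p. g (\<phi> p)) \<in>
      germ_ideal f1 f2" for g
  proof -
    obtain a b where ab: "holo_at_0 a" "holo_at_0 b" "\<forall>\<^sub>F p in nhds 0. g (\<phi> p) =
        a p * f1 p + b p * f2 p"
      using g by (rule germ_idealE)
    have "(\<lambda>n. a (p n) * f1 (p n) + b (p n) * f2 (p n)) \<in> O(\<lambda>n. t n ^ 2)"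
      using assms(1)[OF p]
      by (intro sum_in_bigo bigo_mult_1(1)[OF holo0_seq_bigo[OF ab(1) p0]]
        bigo_mult_1(1)[OF holo0_seq_bigo[OF ab(2) p0]]) auto
    moreover have "\<forall>\<^sub>F n in sequentially. a (p n) * f1 (p n) + b (p n) * f2 (p n) =
        g (q n)"
      using seq_eventually[OF p0 ab(3)] seq_eventually[OF q0 inv(2)]
      by eventually_elim (simp add: p_def)
    ultimately show ?thesis by (simp cong: landau_o.big.in_cong)
  qed
  then show ?thesis using ideal by blast
qed

end

section \<open>Directions and orders of vanishing for normal forms\<close>

abbreviation nf1 :: "nat \<Rightarrow> nat \<Rightarrow> complex^4 \<Rightarrow> complex" where
  "nf1 a b \<equiv> on_C4 (\<lambda>x y z w. x*y - z^a - w^b)"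

abbreviation nf2 :: "nat \<Rightarrow> nat \<Rightarrow> complex^4 \<Rightarrow> complex" where
  "nf2 c d \<equiv> on_C4 (\<lambda>x y z w. x^c + y^d - z*w)"

lemma cdiff_power: "cdiff f p \<Longrightarrow> cdiff (\<lambda>p. f p ^ n) p"
  by (induction n) (auto intro: cdiff_mult)

lemma cdiff_diff: "cdiff f p \<Longrightarrow> cdiff g p \<Longrightarrow>
    cdiff (\<lambda>p. f p - g p) p"
  using cdiff_add[OF _ cdiff_mult[OF cdiff_const[of "-1"]], of f p g] by simp

lemma pd_diff: "cdiff f p \<Longrightarrow> cdiff g p \<Longrightarrow>
    pd (\<lambda>p. f p - g p) i p = pd f i p - pd g i p"
  using pd_add[OF _ cdiff_mult[OF cdiff_const[of "-1"]], of f p g i]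
      pd_mult[OF cdiff_const[of "-1"], of g p i]
  by simp

lemma pd_power: "cdiff f p \<Longrightarrow> pd (\<lambda>p. f p ^ n) i p =
    of_nat n * f p ^ (n - 1) * pd f i p"
proof (induction n)
  case (Suc n)
  then show ?case
    by (cases n) (simp_all add: pd_mult cdiff_mult cdiff_power algebra_simps)
qed simp

lemma holo0_nf: "holo_at_0 (nf1 a b)" "holo_at_0 (nf2 c d)"
  unfolding on_C4_def[abs_def] by (intro holo0_add holo0_diff holo0_mult holo0_power holo0_nth)+

lemma pd_nf1:
  "pd (nf1 a b) 1 p = p$2" "pd (nf1 a b) 2 p = p$1"
  "pd (nf1 a b) 3 p = - of_nat a * p$3 ^ (a - 1)" "pd (nf1 a b) 4 p = - of_nat b * p$4 ^ (b - 1)"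
  unfolding on_C4_def[abs_def]
  by (simp_all add: pd_diff pd_mult pd_power pd_nth cdiff_diff cdiff_mult cdiff_power)

lemma pd_nf2:
  "pd (nf2 c d) 1 p = of_nat c * p$1 ^ (c - 1)" "pd (nf2 c d) 2 p = of_nat d * p$2 ^ (d - 1)"
  "pd (nf2 c d) 3 p = - p$4" "pd (nf2 c d) 4 p = - p$3"
  unfolding on_C4_def[abs_def]
  by (simp_all add: pd_diff pd_add pd_mult pd_power pd_nth cdiff_diff cdiff_add cdiff_mult
      cdiff_power)

lemma bigo_power_mono:
  assumes "t \<longlonglongrightarrow> (0::complex)" "m \<le> n"
  shows "(\<lambda>k. t k ^ n) \<in> O(\<lambda>k. t k ^ m)"
proof -
  have "t \<in> O(\<lambda>_. 1)" using assms(1) by (intro bigoI_tendsto[where c=0]) simp_all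
  then have "(\<lambda>k. t k ^ (n - m)) \<in> O(\<lambda>k. 1 ^ (n - m))"
      by (rule landau_o.big_power)
  then have "(\<lambda>k. t k ^ (n - m) * t k ^ m) \<in> O(\<lambda>k. t k ^ m)"
      by (intro bigo_mult_1(1)) simp_all
  then show ?thesis using assms(2) by (simp flip: power_add)
qed

lemma bigo_power_trans:
  fixes f t :: "nat \<Rightarrow> complex"
  assumes "f \<in> O(\<lambda>k. t k ^ n)" "t \<longlonglongrightarrow> 0" "m \<le> n * j"
  shows "(\<lambda>k. f k ^ j) \<in> O(\<lambda>k. t k ^ m)"
proof -
  have "(\<lambda>k. f k ^ j) \<in> O(\<lambda>k. (t k ^ n) ^ j)" using assms(1)
      by (rule landau_o.big_power)
  also have "(\<lambda>k. (t k ^ n) ^ j) \<in> O(\<lambda>k. t k ^ m)"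
    using bigo_power_mono[OF assms(2,3)] by (simp add: power_mult)
  finally show ?thesis .
qed

lemma bigo_cancel:
  fixes f t :: "nat \<Rightarrow> complex"
  assumes "(\<lambda>k. f k * t k) \<in> O(\<lambda>k. t k ^ Suc m)" "\<And>k. t k \<noteq> 0"
  shows "f \<in> O(\<lambda>k. t k ^ m)"
proof -
  obtain c where c: "c > 0" "\<forall>\<^sub>F k in sequentially. norm (f k * t k) \<le>
      c * norm (t k ^ Suc m)"
    using assms(1) by (rule landau_o.bigE)
  have "\<forall>\<^sub>F k in sequentially. norm (f k) \<le> c * norm (t k ^ m)"
    using c(2)
  proof eventually_elim
    case (elim k)
    then have "norm (f k) * norm (t k) \<le> (c * norm (t k ^ m)) * norm (t k)"
      by (simp add: norm_mult mult_ac)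
    then show ?case using assms(2)[of k] by (simp add: mult_le_cancel_right)
  qed
  with c(1) show ?thesis by (rule landau_o.bigI)
qed

text \<open>Here \<open>z\<close> grows like \<open>t\<close> and \<open>w\<close> is negligible.
  The minors \<open>3\<close>, \<open>4\<close> bound \<open>y * z\<close> and \<open>x * z\<close>
  by small multiples of \<open>x\<close>, \<open>y\<close> up to order \<open>N\<close>, so
  \<open>x\<close> and \<open>y\<close> have order \<open>N - 1\<close>. Then \<open>1\<close> gives
  \<open>w\<close> order \<open>N - 1\<close>, and \<open>2\<close> gives \<open>z^a\<close> order
  \<open>N\<close>, impossible for \<open>a < N\<close>.\<close>

lemma axis_estimate:
  fixes x y z w t :: "nat \<Rightarrow> complex"
  assumes t: "t \<longlonglongrightarrow> 0" "\<And>n. t n \<noteq> 0"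
    and z: "(\<lambda>n. z n / t n) \<longlonglongrightarrow> \<zeta>" "\<zeta> \<noteq> 0"
    and w: "(\<lambda>n. w n / t n) \<longlonglongrightarrow> 0"
        and xy: "x \<longlonglongrightarrow> 0" "y \<longlonglongrightarrow> 0"
    and exps: "a \<ge> 2" "b \<ge> 2" "c \<ge> 2" "d \<ge> 2" and N: "N \<ge> 2"
    and 1: "(\<lambda>n. x n ^ c + y n ^ d - z n * w n) \<in> O(\<lambda>n. t n ^ N)"
    and 2: "(\<lambda>n. of_nat a * z n ^ a - of_nat b * w n ^ b) \<in> O(\<lambda>n. t n ^ N)"
    and 3: "(\<lambda>n. y n * z n - of_nat b * w n ^ (b - 1) * (of_nat c * x n ^ (c - 1))) \<in>
        O(\<lambda>n. t n ^ N)"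
    and 4: "(\<lambda>n. x n * z n - of_nat b * w n ^ (b - 1) * (of_nat d * y n ^ (d - 1))) \<in>
        O(\<lambda>n. t n ^ N)"
  shows "N \<le> a"
proof (rule ccontr)
  assume "\<not> N \<le> a"
  then have Na: "a < N" by simp
  obtain M where M: "N = Suc M" using N by (cases N) auto
  define L where "L = norm \<zeta> / 2"
  have L: "L > 0" using z(2) by (simp add: L_def)
  obtain C3 where C3: "C3 > 0"
      "\<forall>\<^sub>F n in sequentially. norm (y n * z n - of_nat b * w n ^ (b - 1) *
      (of_nat c * x n ^ (c - 1))) \<le> C3 * norm (t n ^ N)"
    using 3 by (rule landau_o.bigE)
  obtain C4 where C4: "C4 > 0"
      "\<forall>\<^sub>F n in sequentially. norm (x n * z n - of_nat b * w n ^ (b - 1) *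
      (of_nat d * y n ^ (d - 1))) \<le> C4 * norm (t n ^ N)"
    using 4 by (rule landau_o.bigE)
  have ez: "\<forall>\<^sub>F n in sequentially. L * norm (t n) \<le> norm (z n)"
  proof -
    have "(\<lambda>n. norm (z n / t n)) \<longlonglongrightarrow> norm \<zeta>" using z(1)
        by (rule tendsto_norm)
    then have "\<forall>\<^sub>F n in sequentially. norm (z n / t n) > L"
      by (rule order_tendstoD) (use z(2) in \<open>simp add: L_def\<close>)
    then show ?thesis
      by eventually_elim (use t(2) in \<open>auto simp: norm_divide field_simps\<close>)
  qed
  \<comment> \<open>With \<open>w\<close> bounded by \<open>L / (2 * K)\<close> times
    \<open>t\<close>, the coupling terms are at most half of the left-hand sides. Adding the
    inequalities for \<open>x\<close> and \<open>y\<close> absorbs them.\<close>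
  define K where "K = real b * real (max c d)"
  have K: "K > 0" using exps by (simp add: K_def)
  have ew: "\<forall>\<^sub>F n in sequentially. norm (w n) \<le> L / (2 * K) * norm (t n)"
  proof -
    have "\<forall>\<^sub>F n in sequentially. norm (w n / t n) < L / (2 * K)"
      using tendstoD[OF w, of "L / (2 * K)"] L K by simp
    then show ?thesis
      by eventually_elim (use t(2) in \<open>auto simp: norm_divide divide_less_eq
          less_imp_le\<close>)
  qed
  have w0: "w \<longlonglongrightarrow> 0" using tendsto_mult[OF w t(1)] t(2) by simp
  have small: "\<forall>\<^sub>F n in sequentially. norm (f n) < 1"
      if "f \<longlonglongrightarrow> 0" for f :: "nat \<Rightarrow> complex"
    using tendstoD[OF that, of 1] by simp
  have pw: "norm (s ^ (k - 1)) \<le> norm s" if "norm s < 1" "k \<ge> 2" for s :: complex and k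
    using that power_decreasing[of 1 "k - 1" "norm s"] by (simp add: norm_power)
  have key: "L * norm (t n) * norm s \<le> L / 2 * norm (t n) * norm r + C * norm (t n ^ N)"
    if "norm (s * z n - of_nat b * w n ^ (b - 1) * (of_nat k * r ^ (k - 1))) \<le>
        C * norm (t n ^ N)"
      "L * norm (t n) \<le> norm (z n)" "norm (w n) \<le> L / (2 * K) * norm (t n)" "norm (w n) < 1"
          "norm r < 1"
      "k \<ge> 2" "k \<le> max c d" for n s r C k
  proof -
    have "L * norm (t n) * norm s \<le> norm (s * z n)"
      using that(2) by (simp add: norm_mult mult.commute mult_left_mono)
    also have "\<dots> \<le> norm (of_nat b * w n ^ (b - 1) * (of_nat k * r ^ (k - 1))) +
        C * norm (t n ^ N)"
      using that(1) norm_triangle_ineq2[of "s * z n"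
          "of_nat b * w n ^ (b - 1) * (of_nat k * r ^ (k - 1))"]
      by linarith
    also have "norm (of_nat b * w n ^ (b - 1) * (of_nat k * r ^ (k - 1))) =
        (real b * real k) * (norm (w n ^ (b - 1)) * norm (r ^ (k - 1)))"
      by (simp add: norm_mult)
    also have "\<dots> \<le> K * ((L / (2 * K) * norm (t n)) * norm r)"
    proof (intro mult_mono)
      show "real b * real k \<le> K" using that(7) by (simp add: K_def mult_left_mono)
      show "norm (w n ^ (b - 1)) \<le> L / (2 * K) * norm (t n)" using pw[OF that(4) exps(2)]
          that(3) by linarith
      show "norm (r ^ (k - 1)) \<le> norm r" by (rule pw[OF that(5,6)])
    qed (use K L in auto)
    also have "K * ((L / (2 * K) * norm (t n)) * norm r) = L / 2 * norm (t n) * norm r"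
      using K by simp
    finally show ?thesis by simp
  qed
  define C where "C = max C3 C4"
  have "\<forall>\<^sub>F n in sequentially. norm (x n) + norm (y n) \<le>
      (4 * C / L) * norm (t n ^ M)"
    using C3(2) C4(2) ez ew small[OF w0] small[OF xy(1)] small[OF xy(2)]
  proof eventually_elim
    case (elim n)
    have tn: "norm (t n) > 0" using t(2) by simp
    have "norm (t n) * (L * norm (y n)) \<le> norm (t n) * (L / 2 * norm (x n) +
        C3 * norm (t n ^ M))"
      using key[OF elim(1,3,4,5,6)] exps by (simp add: M norm_mult algebra_simps)
    then have y: "L * norm (y n) \<le> L / 2 * norm (x n) + C3 * norm (t n ^ M)"
      using tn by (simp only: mult_le_cancel_left_pos)
    have "norm (t n) * (L * norm (x n)) \<le> norm (t n) * (L / 2 * norm (y n) +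
        C4 * norm (t n ^ M))"
      using key[OF elim(2,3,4,5,7)] exps by (simp add: M norm_mult algebra_simps)
    then have x: "L * norm (x n) \<le> L / 2 * norm (y n) + C4 * norm (t n ^ M)"
      using tn by (simp only: mult_le_cancel_left_pos)
    have "C3 * norm (t n ^ M) \<le> C * norm (t n ^ M)" "C4 * norm (t n ^ M) \<le>
        C * norm (t n ^ M)"
      by (intro mult_right_mono; simp add: C_def)+
    then have "L / 2 * (norm (x n) + norm (y n)) \<le> 2 * (C * norm (t n ^ M))"
      using x y by (simp add: algebra_simps)
    then show ?case using L by (simp add: field_simps)
  qed
  note xyM = this
  have C: "4 * C / L > 0" using C3(1) L by (simp add: C_def)
  have xM: "x \<in> O(\<lambda>n. t n ^ M)"
  proof (rule landau_o.bigI[OF C])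
    show "\<forall>\<^sub>F n in sequentially. norm (x n) \<le> 4 * C / L * norm (t n ^ M)"
      using xyM by eventually_elim (use norm_ge_zero in \<open>smt (verit)\<close>)
  qed
  have yM: "y \<in> O(\<lambda>n. t n ^ M)"
  proof (rule landau_o.bigI[OF C])
    show "\<forall>\<^sub>F n in sequentially. norm (y n) \<le> 4 * C / L * norm (t n ^ M)"
      using xyM by eventually_elim (use norm_ge_zero in \<open>smt (verit)\<close>)
  qed
  \<comment> \<open>As \<open>N = M + 1\<close> and \<open>M \<ge> 1\<close>, a square of something
    of order \<open>M\<close> already has order \<open>N\<close>.\<close>
  have NM: "N \<le> M * k" if "k \<ge> 2" for k
  proof -
    have "M * 2 \<le> M * k" using that by simp
    then show ?thesis using N M by linarith
  qed
  have "(\<lambda>n. x n ^ c + y n ^ d) \<in> O(\<lambda>n. t n ^ N)"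
    by (intro sum_in_bigo bigo_power_trans[OF xM t(1)] bigo_power_trans[OF yM t(1)] NM exps)
  then have "(\<lambda>n. (x n ^ c + y n ^ d) - (x n ^ c + y n ^ d - z n * w n)) \<in>
      O(\<lambda>n. t n ^ N)"
    using 1 by (rule sum_in_bigo(2))
  then have zw: "(\<lambda>n. z n * w n) \<in> O(\<lambda>n. t n ^ N)" by simp
  have "(\<lambda>n. inverse (z n / t n)) \<longlonglongrightarrow> inverse \<zeta>"
      by (rule tendsto_inverse[OF z])
  then have tz: "(\<lambda>n. inverse (z n / t n)) \<in> O(\<lambda>n. 1)"
    by (intro bigoI_tendsto[where c="inverse \<zeta>"]) simp_all
  have z0: "\<forall>\<^sub>F n in sequentially. z n \<noteq> 0"
    using ez by eventually_elim (use L t(2) in \<open>auto simp: mult_le_0_iff not_less\<close>)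
  have "(\<lambda>n. inverse (z n / t n) * (z n * w n)) \<in> O(\<lambda>n. t n ^ N)"
    by (rule bigo_mult_1(1)[OF tz zw])
  moreover have "\<forall>\<^sub>F n in sequentially. inverse (z n / t n) * (z n * w n) = w n * t n"
    using z0 by eventually_elim (use t(2) in \<open>simp add: field_simps\<close>)
  ultimately have "(\<lambda>n. w n * t n) \<in> O(\<lambda>n. t n ^ N)"
      by (simp cong: landau_o.big.in_cong)
  then have wM: "w \<in> O(\<lambda>n. t n ^ M)" unfolding M using t(2) by (rule bigo_cancel)
  have "(\<lambda>n. of_nat b * w n ^ b) \<in> O(\<lambda>n. t n ^ N)"
    by (rule bigo_mult_1(1)[OF _ bigo_power_trans[OF wM t(1) NM[OF exps(2)]]]) simp
  then have "(\<lambda>n. (of_nat a * z n ^ a - of_nat b * w n ^ b) + of_nat b * w n ^ b) \<in>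
      O(\<lambda>n. t n ^ N)"
    by (rule sum_in_bigo(1)[OF 2])
  then have za: "(\<lambda>n. of_nat a * z n ^ a) \<in> O(\<lambda>n. t n ^ N)" by simp
  have "(\<lambda>n. inverse (z n / t n) ^ a) \<in> O(\<lambda>n. 1 ^ a)" using tz
      by (rule landau_o.big_power)
  then have "(\<lambda>n. inverse (of_nat a) * inverse (z n / t n) ^ a) \<in> O(\<lambda>n. 1)"
      by simp
  then have "(\<lambda>n. (inverse (of_nat a) * inverse (z n / t n) ^ a) * (of_nat a * z n ^ a))
      \<in> O(\<lambda>n. t n ^ N)"
    using za by (rule bigo_mult_1(1))
  moreover have "\<forall>\<^sub>F n in sequentially. (inverse (of_nat a) * inverse (z n / t n) ^ a)
      * (of_nat a * z n ^ a) = t n ^ a"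
    using z0 by eventually_elim (use t(2) exps in \<open>simp add: field_simps\<close>)
  ultimately have "(\<lambda>n. t n ^ a) \<in> O(\<lambda>n. t n ^ N)"
      by (simp cong: landau_o.big.in_cong)
  then obtain c' where c': "c' > 0" "\<forall>\<^sub>F n in sequentially. norm (t n ^ a) \<le>
      c' * norm (t n ^ N)"
    by (rule landau_o.bigE)
  have "(\<lambda>n. t n ^ (N - a)) \<longlonglongrightarrow> 0 ^ (N - a)"
      by (intro tendsto_power t)
  moreover have "0 ^ (N - a) = (0 :: complex)" using Na by simp
  ultimately have "\<forall>\<^sub>F n in sequentially. norm (t n ^ (N - a)) < 1 / c'"
    using Na c'(1) tendstoD[of "\<lambda>n. t n ^ (N - a)" 0 sequentially "1 / c'"] by simp
  with c'(2) have "\<forall>\<^sub>F n in sequentially. False"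
  proof eventually_elim
    case (elim n)
    have tn: "norm (t n ^ a) > 0" using t(2) by simp
    have "norm (t n ^ N) = norm (t n ^ a) * norm (t n ^ (N - a))"
      using Na by (simp flip: norm_mult power_add)
    with elim(1) have "norm (t n ^ a) * 1 \<le> norm (t n ^ a) * (c' * norm (t n ^ (N - a)))"
        by (simp add: mult_ac)
    then have "1 \<le> c' * norm (t n ^ (N - a))"
      using tn by (simp only: mult_le_cancel_left_pos)
    moreover have "c' * norm (t n ^ (N - a)) < 1" using elim(2) c'(1) by (simp add: field_simps)
    ultimately show False by simp
  qed
  then show False by simp
qed

lemma approaches_nth:
  assumes "approaches t p v"
  shows "t \<longlonglongrightarrow> 0" "t n \<noteq> 0"
      "(\<lambda>n. p n $ i / t n) \<longlonglongrightarrow> v $ i"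
      "(\<lambda>n. p n $ i) \<longlonglongrightarrow> 0"
    "(\<lambda>n. p n $ i) \<in> O(\<lambda>n. t n ^ 1)"
proof -
  show t: "t \<longlonglongrightarrow> 0" "t n \<noteq> 0" for n using assms
      by (auto simp: approaches_def)
  have "(\<lambda>n. ((1 / t n) *s p n) $ i) \<longlonglongrightarrow> v $ i"
    using assms unfolding approaches_def by (intro tendsto_vec_nth) auto
  then show 1: "(\<lambda>n. p n $ i / t n) \<longlonglongrightarrow> v $ i" by simp
  show "(\<lambda>n. p n $ i) \<longlonglongrightarrow> 0"
    using tendsto_vec_nth[OF approaches_tendsto_0[OF assms], of i] by simp
  show "(\<lambda>n. p n $ i) \<in> O(\<lambda>n. t n ^ 1)"
    using 1 t(2) by (intro bigoI_tendsto[where c="v $ i"]) simp_all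
qed

lemma nf_order_two:
  assumes "approaches t p v" "a \<ge> 2" "b \<ge> 2" "c \<ge> 2" "d \<ge> 2"
  shows "(\<lambda>n. nf1 a b (p n)) \<in> O(\<lambda>n. t n ^ 2)"
      "(\<lambda>n. nf2 c d (p n)) \<in> O(\<lambda>n. t n ^ 2)"
proof -
  note t = approaches_nth[OF assms(1)]
  have m: "(\<lambda>n. p n $ i * p n $ j) \<in> O(\<lambda>n. t n ^ 2)" for i j
    using landau_o.big.mult[OF t(5)[of i] t(5)[of j]] by (simp add: power2_eq_square)
  have k: "(\<lambda>n. p n $ i ^ k) \<in> O(\<lambda>n. t n ^ 2)" if "k \<ge> 2" for i k
    by (rule bigo_power_trans[OF t(5,1)]) (use that in simp)
  show "(\<lambda>n. nf1 a b (p n)) \<in> O(\<lambda>n. t n ^ 2)" "(\<lambda>n. nf2 c d (p n)) \<in>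
      O(\<lambda>n. t n ^ 2)"
    unfolding on_C4_def by (intro sum_in_bigo m k assms)+
qed

lemma power_over_t:
  assumes "approaches t p v" "k \<ge> m"
  shows "(\<lambda>n. p n $ i ^ k / t n ^ m) \<longlonglongrightarrow> (if k =
      m then v $ i ^ k else 0)"
proof -
  note t = approaches_nth[OF assms(1)]
  have "(\<lambda>n. t n ^ (k - m) * (p n $ i / t n) ^ k) \<longlonglongrightarrow> 0 ^ (k - m) * v
      $ i ^ k"
    by (intro tendsto_mult tendsto_power t)
  moreover have "t n ^ (k - m) * (p n $ i / t n) ^ k = p n $ i ^ k / t n ^ m" for n
  proof -
    have "t n ^ k = t n ^ (k - m) * t n ^ m" using assms(2) by (simp flip: power_add)
    then show ?thesis using t(2)[of n] by (simp add: field_simps)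
  qed
  moreover have "0 ^ (k - m) * v $ i ^ k = (if k = m then v $ i ^ k else 0)" using assms(2) by auto
  ultimately show ?thesis by simp
qed

definition sq :: "nat \<Rightarrow> complex \<Rightarrow> complex" where
  "sq k s = (if k = 2 then s else 0)"

lemma nf_quadratic:
  assumes "approaches t p v" "a \<ge> 2" "b \<ge> 2" "c \<ge> 2" "d \<ge> 2"
  shows "(\<lambda>n. nf1 a b (p n) / t n ^ 2) \<longlonglongrightarrow> v$1 * v$2 - sq a (v$3 ^ 2)
      - sq b (v$4 ^ 2)"
    "(\<lambda>n. nf2 c d (p n) / t n ^ 2) \<longlonglongrightarrow> sq c (v$1 ^ 2) +
        sq d (v$2 ^ 2) - v$3 * v$4"
proof -
  note t = approaches_nth[OF assms(1)]
  have k: "(\<lambda>n. p n $ i ^ k / t n ^ 2) \<longlonglongrightarrow> sq k (v $ i ^ 2)"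
      if "k \<ge> 2" for i k
    using power_over_t[OF assms(1) that, of i] by (auto simp: sq_def cong: if_cong)
  have m: "(\<lambda>n. (p n $ i * p n $ j) / t n ^ 2) \<longlonglongrightarrow> v $ i * v $ j"
      for i j
    using tendsto_mult[OF t(3)[of i] t(3)[of j]] by (simp add: power2_eq_square)
  show "(\<lambda>n. nf1 a b (p n) / t n ^ 2) \<longlonglongrightarrow> v$1 * v$2 - sq a (v$3 ^ 2) -
      sq b (v$4 ^ 2)"
    "(\<lambda>n. nf2 c d (p n) / t n ^ 2) \<longlonglongrightarrow> sq c (v$1 ^ 2) +
        sq d (v$2 ^ 2) - v$3 * v$4"
    unfolding on_C4_def diff_divide_distrib add_divide_distrib
    by (intro tendsto_add tendsto_diff k m assms)+
qed

lemma null_sequence: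
  obtains t :: "nat \<Rightarrow> complex" where "t \<longlonglongrightarrow> 0"
      "\<And>n. t n \<noteq> 0"
proof
  show "(\<lambda>n. (1 / 2) ^ n :: complex) \<longlonglongrightarrow> 0"
      by (rule LIMSEQ_power_zero) (simp add: norm_divide)
qed simp

lemma nf_tangent_dir:
  assumes "a \<ge> 2" "b \<ge> 2" "c \<ge> 2" "d \<ge> 2"
  shows "tangent_dir (nf1 a b) (nf2 c d) v \<longleftrightarrow>
    v$1 * v$2 = sq a (v$3 ^ 2) + sq b (v$4 ^ 2) \<and> sq c (v$1 ^ 2) + sq d (v$2 ^ 2) = v$3 * v$4"
proof
  assume "tangent_dir (nf1 a b) (nf2 c d) v"
  then obtain t p where tp: "approaches t p v" "(\<lambda>n. nf1 a b (p n)) \<in>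
      o(\<lambda>n. t n ^ 2)" "(\<lambda>n. nf2 c d (p n)) \<in> o(\<lambda>n. t n ^ 2)"
    unfolding tangent_dir_def by blast
  show "v$1 * v$2 = sq a (v$3 ^ 2) + sq b (v$4 ^ 2) \<and> sq c (v$1 ^ 2) + sq d (v$2 ^ 2) =
      v$3 * v$4"
    using LIMSEQ_unique[OF smalloD_tendsto[OF tp(2)] nf_quadratic(1)[OF tp(1) assms]]
      LIMSEQ_unique[OF smalloD_tendsto[OF tp(3)] nf_quadratic(2)[OF tp(1) assms]]
    by (simp add: algebra_simps)
next
  assume q: "v$1 * v$2 = sq a (v$3 ^ 2) + sq b (v$4 ^ 2) \<and> sq c (v$1 ^ 2) + sq d (v$2 ^ 2) =
      v$3 * v$4"
  obtain t :: "nat \<Rightarrow> complex" where t: "t \<longlonglongrightarrow> 0"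
      "\<And>n. t n \<noteq> 0"
    by (rule null_sequence) (rule that)
  have ap: "approaches t (\<lambda>n. t n *s v) v"
    unfolding approaches_def using t by (simp add: vector_smult_assoc)
  show "tangent_dir (nf1 a b) (nf2 c d) v" unfolding tangent_dir_def
    using ap nf_quadratic[OF ap assms] q t(2)
    by (intro exI[of _ t] exI[of _ "\<lambda>n. t n *s v"]) (auto intro!: smalloI_tendsto simp:
        algebra_simps)
qed

definition expn :: "nat \<Rightarrow> nat \<Rightarrow> nat \<Rightarrow> nat \<Rightarrow> 4
    \<Rightarrow> nat" where
  "expn a b c d i = (if i = 1 then c else if i = 2 then d else if i = 3 then a else b)"

lemma expn_simps [simp]: "expn a b c d 1 = c" "expn a b c d 2 = d" "expn a b c d 3 = a"
    "expn a b c d 4 = b"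
  by (simp_all add: expn_def)

text \<open>The points \<open>t n *s v\<close> on the axis are used: there the equations and minors
  reduce to multiples of one power, of exponent \<open>expn a b c d i\<close>.\<close>

lemma singular_dir_axis:
  assumes "a \<ge> 2" "b \<ge> 2" "c \<ge> 2" "d \<ge> 2"
      and v: "\<And>j. j \<noteq> i \<Longrightarrow> v $ j = 0" and N: "N \<le> expn a b c d i"
  shows "singular_dir (nf1 a b) (nf2 c d) N v"
proof -
  obtain t :: "nat \<Rightarrow> complex" where t: "t \<longlonglongrightarrow> 0"
      "\<And>n. t n \<noteq> 0" by (rule null_sequence) (rule that)
  have ap: "approaches t (\<lambda>n. t n *s v) v"
    unfolding approaches_def using t by (simp add: vector_smult_assoc)
  have o: "(\<lambda>n. s * (t n * r) ^ k) \<in> O(\<lambda>n. t n ^ N)" if "N \<le> k" for s r k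
    using bigo_mult_1(1)[of "\<lambda>_. s * r ^ k", OF _ bigo_power_mono[OF t(1) that]]
    by (simp add: power_mult_distrib mult_ac)
  have o1: "(\<lambda>n. s * (t n * r) ^ (k - Suc 0) * (t n * r)) \<in> O(\<lambda>n. t n ^ N)"
      if "N \<le> k" "k \<ge> 2" for s r k
  proof -
    have "(t n * r) ^ (k - Suc 0) * (t n * r) = (t n * r) ^ k" for n
      using that by (cases k) simp_all
    then show ?thesis using o[OF that(1), of s r] by (simp add: mult.assoc)
  qed
  have o2: "(\<lambda>n. (t n * r) * (s * (t n * r) ^ (k - Suc 0))) \<in> O(\<lambda>n. t n ^ N)"
      if "N \<le> k" "k \<ge> 2" for s r k
    using o1[OF that, of s r] by (simp add: mult_ac)
  note oo = o[of _ 1] o[of _ "-1"]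
  show ?thesis unfolding singular_dir_def
  proof (intro exI conjI allI)
    show "approaches t (\<lambda>n. t n *s v) v" by (fact ap)
    have z: "(0::complex) ^ k = 0" if "k \<ge> 2" for k :: nat using that by simp
    show "(\<lambda>n. nf1 a b (t n *s v)) \<in> O(\<lambda>n. t n ^ N)"
        "(\<lambda>n. nf2 c d (t n *s v)) \<in> O(\<lambda>n. t n ^ N)"
      using exhaust_4[of i] v N assms(1-4) o[of _ 1] o[of _ "-1"] o[where s="-1"] o[where s=1]
      by (auto simp: on_C4_def z)
    fix k l
    show "(\<lambda>n. minor (nf1 a b) (nf2 c d) k l (t n *s v)) \<in> O(\<lambda>n. t n ^ N)"
      using exhaust_4[of i] exhaust_4[of k] exhaust_4[of l] v N assms(1-4) o1 o2
      by (elim disjE) (simp_all add: minor_def pd_nf1 pd_nf2)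
  qed
qed

text \<open>For \<open>N \<ge> 3\<close> the quadratic limits of equations and minors all vanish at
  \<open>v\<close>. These relations force every product of two distinct coordinates of
  \<open>v\<close> to be 0, so \<open>v\<close> lies on an axis and \<open>axis_estimate\<close>
  bounds its exponent.\<close>

lemma singular_dir_imp_axis:
  assumes ge: "a \<ge> 2" "b \<ge> 2" "c \<ge> 2" "d \<ge> 2" and N: "N \<ge> 3"
      and v: "v \<noteq> 0"
    and sd: "singular_dir (nf1 a b) (nf2 c d) N v"
  obtains i where "\<And>j. j \<noteq> i \<Longrightarrow> v $ j = 0" "N \<le> expn a b c d i"
proof -
  obtain t p where tp: "approaches t p v"
    and f: "(\<lambda>n. nf1 a b (p n)) \<in> O(\<lambda>n. t n ^ N)"
        "(\<lambda>n. nf2 c d (p n)) \<in> O(\<lambda>n. t n ^ N)"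
    and m: "\<And>i j. (\<lambda>n. minor (nf1 a b) (nf2 c d) i j (p n)) \<in>
        O(\<lambda>n. t n ^ N)"
    using sd unfolding singular_dir_def by blast
  note t = approaches_nth[OF tp]
  have small: "(\<lambda>n. f n / t n ^ 2) \<longlonglongrightarrow> 0"
      if "f \<in> O(\<lambda>n. t n ^ N)" for f
  proof -
    have "(\<lambda>n. t n ^ N) \<in> o(\<lambda>n. t n ^ 2)"
    proof (rule smalloI_tendsto)
      have "(\<lambda>n. t n ^ (N - 2)) \<longlonglongrightarrow> 0 ^ (N - 2)"
          by (intro tendsto_power t)
      moreover have "0 ^ (N - 2) = (0 :: complex)" using N by (intro power_0_left[THEN trans]) simp
      moreover have "t n ^ (N - 2) = t n ^ N / t n ^ 2" for n
        using N t(2)[of n] by (simp add: power_diff)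
      ultimately show "(\<lambda>n. t n ^ N / t n ^ 2) \<longlonglongrightarrow> 0" by simp
    qed (simp add: t(2))
    with that have "f \<in> o(\<lambda>n. t n ^ 2)" by (rule landau_o.big_small_trans)
    then show ?thesis by (rule smalloD_tendsto)
  qed
  define \<alpha> \<beta> \<gamma> \<delta> where "\<alpha> = sq a 1" and "\<beta> = sq b 1"
      and "\<gamma> = sq c 1" and "\<delta> = sq d 1"
  have pw: "(\<lambda>n. of_nat k * p n $ i ^ (k - 1) / t n) \<longlonglongrightarrow> 2 * sq k 1 *
      v $ i" if "k \<ge> 2" for k i
  proof -
    have "(\<lambda>n. of_nat k * (p n $ i ^ (k - 1) / t n ^ 1)) \<longlonglongrightarrow> of_nat k
        * (if k - 1 = 1 then v $ i ^ (k - 1) else 0)"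
      by (intro tendsto_mult tendsto_const power_over_t[OF tp]) (use that in simp)
    moreover have "of_nat k * (if k - 1 = 1 then v $ i ^ (k - 1) else 0) = 2 * sq k 1 * v $ i"
      using that by (auto simp: sq_def)
    ultimately show ?thesis by simp
  qed
  have g1: "(\<lambda>n. pd (nf1 a b) 1 (p n) / t n) \<longlonglongrightarrow> v $ 2"
      "(\<lambda>n. pd (nf1 a b) 2 (p n) / t n) \<longlonglongrightarrow> v $ 1"
    "(\<lambda>n. pd (nf1 a b) 3 (p n) / t n) \<longlonglongrightarrow> - (2 * \<alpha> * v $ 3)"
        "(\<lambda>n. pd (nf1 a b) 4 (p n) / t n) \<longlonglongrightarrow> - (2 * \<beta> * v $ 4)"
    unfolding pd_nf1 \<alpha>_def \<beta>_def using t(3) tendsto_minus[OF pw[OF ge(1), of 3]]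
        tendsto_minus[OF pw[OF ge(2), of 4]]
    by simp_all
  have g2: "(\<lambda>n. pd (nf2 c d) 1 (p n) / t n) \<longlonglongrightarrow> 2 * \<gamma> * v $ 1"
      "(\<lambda>n. pd (nf2 c d) 2 (p n) / t n) \<longlonglongrightarrow> 2 * \<delta> * v $ 2"
    "(\<lambda>n. pd (nf2 c d) 3 (p n) / t n) \<longlonglongrightarrow> - v $ 4"
        "(\<lambda>n. pd (nf2 c d) 4 (p n) / t n) \<longlonglongrightarrow> - v $ 3"
    unfolding pd_nf2 \<gamma>_def \<delta>_def using pw[OF ge(3), of 1] pw[OF ge(4), of 2]
      tendsto_minus[OF t(3)[of 4]] tendsto_minus[OF t(3)[of 3]]
    by simp_all
  have mlim: "x1 * y2 - x2 * y1 = 0"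
    if "(\<lambda>n. pd (nf1 a b) i (p n) / t n) \<longlonglongrightarrow> x1"
        "(\<lambda>n. pd (nf1 a b) j (p n) / t n) \<longlonglongrightarrow> x2"
      "(\<lambda>n. pd (nf2 c d) i (p n) / t n) \<longlonglongrightarrow> y1"
          "(\<lambda>n. pd (nf2 c d) j (p n) / t n) \<longlonglongrightarrow> y2"
          for i j x1 x2 y1 y2
  proof -
    have "(\<lambda>n. pd (nf1 a b) i (p n) / t n * (pd (nf2 c d) j (p n) / t n)
        - pd (nf1 a b) j (p n) / t n * (pd (nf2 c d) i (p n) / t n)) \<longlonglongrightarrow> x1 *
            y2 - x2 * y1"
      by (intro tendsto_diff tendsto_mult that)
    then have "(\<lambda>n. minor (nf1 a b) (nf2 c d) i j (p n) / t n ^ 2) \<longlonglongrightarrow>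
        x1 * y2 - x2 * y1"
      by (simp add: minor_def power2_eq_square diff_divide_distrib)
    then show ?thesis using small[OF m[of i j]] by (rule LIMSEQ_unique)
  qed
  have 13: "v$2 * v$4 = 4 * \<alpha> * \<gamma> * v$1 * v$3"
    using mlim[OF g1(1,3) g2(1,3)] by (simp add: algebra_simps)
  have 24: "v$1 * v$3 = 4 * \<beta> * \<delta> * v$2 * v$4"
    using mlim[OF g1(2,4) g2(2,4)] by (simp add: algebra_simps)
  have 14: "v$2 * v$3 = 4 * \<beta> * \<gamma> * v$1 * v$4"
    using mlim[OF g1(1,4) g2(1,4)] by (simp add: algebra_simps)
  have 23: "v$1 * v$4 = 4 * \<alpha> * \<delta> * v$2 * v$3"
    using mlim[OF g1(2,3) g2(2,3)] by (simp add: algebra_simps)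
  have q1: "v$1 * v$2 = \<alpha> * v$3 ^ 2 + \<beta> * v$4 ^ 2"
    using LIMSEQ_unique[OF small[OF f(1)] nf_quadratic(1)[OF tp ge]]
    by (auto simp: \<alpha>_def \<beta>_def sq_def algebra_simps split: if_splits)
  have q2: "v$3 * v$4 = \<gamma> * v$1 ^ 2 + \<delta> * v$2 ^ 2"
    using LIMSEQ_unique[OF small[OF f(2)] nf_quadratic(2)[OF tp ge]]
    by (auto simp: \<gamma>_def \<delta>_def sq_def algebra_simps split: if_splits)
  have bin: "\<alpha> = 0 \<or> \<alpha> = 1" "\<beta> = 0 \<or> \<beta> = 1" "\<gamma> = 0 \<or>
      \<gamma> = 1" "\<delta> = 0 \<or> \<delta> = 1"
    by (auto simp: \<alpha>_def \<beta>_def \<gamma>_def \<delta>_def sq_def)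
  \<comment> \<open>The determinant \<open>1 - 16 * (A * B * C * D)\<close> is 1 or -15, since the
    four factors are 0 or 1.\<close>
  have sol: "r = 0 \<and> s = 0" if "r = 4 * A * B * s" "s = 4 * C * D * r" "A = 0 \<or> A = 1"
      "B = 0 \<or> B = 1"
    "C = 0 \<or> C = 1" "D = 0 \<or> D = 1" for r s A B C D :: complex
  proof -
    have "r * (1 - 16 * (A * B * C * D)) = 0" using that(1,2) by (simp add: algebra_simps)
    moreover have "1 - 16 * (A * B * C * D) \<noteq> 0" using that(3-6) by auto
    ultimately show ?thesis using that(2) by simp
  qed
  have z1: "v$2 * v$4 = 0 \<and> v$1 * v$3 = 0"
    by (rule sol[of _ \<alpha> \<gamma> _ \<beta> \<delta>]) (use 13 24 bin in \<open>simp_all add: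
        mult.assoc\<close>)
  have z2: "v$2 * v$3 = 0 \<and> v$1 * v$4 = 0"
    by (rule sol[of _ \<beta> \<gamma> _ \<alpha> \<delta>]) (use 14 23 bin in \<open>simp_all add:
        mult.assoc\<close>)
  have z3: "v$1 * v$2 = 0" using z1 z2 q1 by (cases "v$1 = 0"; cases "v$2 = 0") auto
  have z4: "v$3 * v$4 = 0" using z1 z2 q2 by (cases "v$3 = 0"; cases "v$4 = 0") auto
  obtain i where i: "v $ i \<noteq> 0" using v by (auto simp: vec_eq_iff)
  have others: "v $ j = 0" if "j \<noteq> i" for j
    using that i z1 z2 z3 z4 exhaust_4[of i] exhaust_4[of j] by auto
  have lim0: "(\<lambda>n. p n $ j / t n) \<longlonglongrightarrow> 0" if "j \<noteq> i" for j
    using t(3)[of j] others[OF that] by simp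
  have N2: "N \<ge> 2" using N by simp
  have mi: "(\<lambda>n. - minor (nf1 a b) (nf2 c d) i j (p n)) \<in> O(\<lambda>n. t n ^ N)"
      for i j
    using m[of i j] by simp
  have f1: "(\<lambda>n. - nf1 a b (p n)) \<in> O(\<lambda>n. t n ^ N)" using f(1) by simp
  have pw1: "s * s ^ (k - 1) = s ^ k" "s ^ (k - 1) * s = s ^ k" if "k \<ge> 2" for s :: complex
      and k :: nat
    using that by (cases k; simp)+
  have mm: "minor (nf1 a b) (nf2 c d) 1 2 q = of_nat d * q$2 ^ d - of_nat c * q$1 ^ c"
    "minor (nf1 a b) (nf2 c d) 3 4 q = of_nat a * q$3 ^ a - of_nat b * q$4 ^ b"
    "minor (nf1 a b) (nf2 c d) 1 3 q = of_nat a * q$3 ^ (a - 1) * (of_nat c * q$1 ^ (c - 1)) - q$2 *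
        q$4"
    "minor (nf1 a b) (nf2 c d) 1 4 q = of_nat b * q$4 ^ (b - 1) * (of_nat c * q$1 ^ (c - 1)) - q$2 *
        q$3"
    "minor (nf1 a b) (nf2 c d) 2 3 q = of_nat a * q$3 ^ (a - 1) * (of_nat d * q$2 ^ (d - 1)) - q$1 *
        q$4"
    "minor (nf1 a b) (nf2 c d) 2 4 q = of_nat b * q$4 ^ (b - 1) * (of_nat d * q$2 ^ (d - 1)) - q$1 *
        q$3" for q
    using pw1[OF ge(1)] pw1[OF ge(2)] pw1[OF ge(3)] pw1[OF ge(4)]
    by (simp_all add: minor_def pd_nf1 pd_nf2 mult.assoc mult.left_commute[of "q $ 1"]
        mult.left_commute[of "q $ 2"])
  have "N \<le> expn a b c d i"
  proof -
    consider "i = 1" | "i = 2" | "i = 3" | "i = 4" using exhaust_4[of i] by blast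
    then show ?thesis
    proof cases
      case 1
      have "N \<le> c"
      proof (rule axis_estimate[OF t(1,2) t(3)[of 1] _ lim0[of 2] t(4)[of 3] t(4)[of 4] ge(3,4,1,2)
          N2])
        show "(\<lambda>n. p n $ 3 ^ a + p n $ 4 ^ b - p n $ 1 * p n $ 2) \<in>
            O(\<lambda>n. t n ^ N)"
          using f1 by (simp add: on_C4_def algebra_simps)
      qed (use 1 i mi[of 1 2] mi[of 2 3] mi[of 2 4] in \<open>simp_all add: mm mult_ac\<close>)
      then show ?thesis using 1 by simp
    next
      case 2
      have "N \<le> d"
      proof (rule axis_estimate[OF t(1,2) t(3)[of 2] _ lim0[of 1] t(4)[of 3] t(4)[of 4] ge(4,3,1,2)
          N2])
        show "(\<lambda>n. p n $ 3 ^ a + p n $ 4 ^ b - p n $ 2 * p n $ 1) \<in>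
            O(\<lambda>n. t n ^ N)"
          using f1 by (simp add: on_C4_def algebra_simps)
      qed (use 2 i m[of 1 2] mi[of 1 3] mi[of 1 4] in \<open>simp_all add: mm mult_ac\<close>)
      then show ?thesis using 2 by simp
    next
      case 3
      have "N \<le> a"
      proof (rule axis_estimate[OF t(1,2) t(3)[of 3] _ lim0[of 4] t(4)[of 1] t(4)[of 2] ge(1,2,3,4)
          N2])
        show "(\<lambda>n. p n $ 1 ^ c + p n $ 2 ^ d - p n $ 3 * p n $ 4) \<in>
            O(\<lambda>n. t n ^ N)"
          using f(2) by (simp add: on_C4_def algebra_simps)
      qed (use 3 i m[of 3 4] mi[of 1 4] mi[of 2 4] in \<open>simp_all add: mm mult_ac\<close>)
      then show ?thesis using 3 by simp
    next
      case 4
      have "N \<le> b"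
      proof (rule axis_estimate[OF t(1,2) t(3)[of 4] _ lim0[of 3] t(4)[of 1] t(4)[of 2] ge(2,1,3,4)
          N2])
        show "(\<lambda>n. p n $ 1 ^ c + p n $ 2 ^ d - p n $ 4 * p n $ 3) \<in>
            O(\<lambda>n. t n ^ N)"
          using f(2) by (simp add: on_C4_def algebra_simps)
      qed (use 4 i mi[of 3 4] mi[of 1 3] mi[of 2 3] in \<open>simp_all add: mm mult_ac\<close>)
      then show ?thesis using 4 by simp
    qed
  qed
  with others show thesis by (rule that)
qed

lemma K_equivalent_ideal_maps:
  assumes "K_equivalent (f1, f2) (g1, g2)"
    and hol: "holo_at_0 f1" "holo_at_0 f2" "holo_at_0 g1" "holo_at_0 g2"
  obtains \<phi> \<psi> where "ideal_map f1 f2 g1 g2 \<phi> \<psi>"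
      "ideal_map g1 g2 f1 f2 \<psi> \<phi>"
proof -
  obtain \<phi> where \<phi>: "coordinate_change_at_0 \<phi>"
    "\<And>g. g \<circ> \<phi> \<in> germ_ideal f1 f2 \<longleftrightarrow> g \<in>
        germ_ideal g1 g2"
    using assms(1) unfolding K_equivalent_def by auto
  obtain \<psi> where "coordinate_change_at_0 \<psi>" and \<psi>: "\<phi> 0 = 0" "\<psi> 0 = 0"
    "\<And>i. holo_at_0 (\<lambda>p. \<phi> p $ i)" "\<And>i. holo_at_0 (\<lambda>p. \<psi> p $ i)"
    "\<forall>\<^sub>F p in nhds 0. \<psi> (\<phi> p) = p"
        "\<forall>\<^sub>F p in nhds 0. \<phi> (\<psi> p) = p"
    "filterlim \<phi> (nhds 0) (nhds 0)" "filterlim \<psi> (nhds 0) (nhds 0)"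
    by (rule coordinate_changeE[OF \<phi>(1)]) (rule that)
  have 1: "(\<lambda>p. g (\<phi> p)) \<in> germ_ideal f1 f2" if "g \<in> germ_ideal g1 g2" for g
    using \<phi>(2)[of g] that by (simp add: comp_def)
  have 2: "(\<lambda>p. f (\<psi> p)) \<in> germ_ideal g1 g2" if "f \<in> germ_ideal f1 f2" for f
  proof -
    have "\<forall>\<^sub>F p in nhds 0. ((\<lambda>p. f (\<psi> p)) \<circ> \<phi>) p = f p"
        using \<psi>(5) by eventually_elim simp
    then show ?thesis using \<phi>(2)[of "\<lambda>p. f (\<psi> p)"] germ_ideal_cong that by blast
  qed
  show thesis
  proof (rule that[of \<phi> \<psi>])
    show "ideal_map f1 f2 g1 g2 \<phi> \<psi>"
      by unfold_locales (rule hol \<psi> 1[OF germ_ideal_gens(1)] 1[OF germ_ideal_gens(2)])+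
    show "ideal_map g1 g2 f1 f2 \<psi> \<phi>"
      by unfold_locales (rule hol \<psi> 2[OF germ_ideal_gens(1)] 2[OF germ_ideal_gens(2)])+
  qed
qed

lemma dmap_inverse:
  assumes "ideal_map f1 f2 g1 g2 \<phi> \<psi>"
  shows "dmap \<psi> (dmap \<phi> v) = v"
proof -
  interpret ideal_map f1 f2 g1 g2 \<phi> \<psi> by fact
  have "(\<psi> has_derivative dmap \<psi>) (at (\<phi> 0))"
    unfolding \<phi>(2) by (rule dmap_has_derivative[OF \<psi>(1)])
  with dmap_has_derivative[OF \<phi>(1)] have
      "((\<lambda>p. \<psi> (\<phi> p)) has_derivative (\<lambda>h. dmap \<psi> (dmap \<phi> h)))
      (at 0)"
    by (rule has_derivative_compose)
  then have "((\<lambda>p. p) has_derivative (\<lambda>h. dmap \<psi> (dmap \<phi> h))) (at 0)"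
    by (rule has_derivative_transform_eventually)
      (use eventually_nhds_x_imp_x[OF inv(1)] inv(1) in \<open>simp_all add: eventually_at_filter
          eventually_mono\<close>)
  then have "(\<lambda>h. dmap \<psi> (dmap \<phi> h)) = (\<lambda>h. h)"
    by (rule has_derivative_unique) (rule has_derivative_ident)
  then show ?thesis by (rule fun_cong)
qed

text \<open>\<open>gabrielov_numbers\<close> quantifies over all natural exponents, so 0 and 1 must
  be excluded on the other side. Both would give an equation of order below 2 on a coordinate
  axis.\<close>

lemma normal_form_exponents_ge_2:
  assumes K: "K_equivalent (normal_form a b c d) (normal_form a' b' c' d')"
    and ge: "a \<ge> 2" "b \<ge> 2" "c \<ge> 2" "d \<ge> 2"
  shows "a' \<ge> 2" "b' \<ge> 2" "c' \<ge> 2" "d' \<ge> 2"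
proof -
  obtain \<phi> \<psi> where "ideal_map (nf1 a b) (nf2 c d) (nf1 a' b') (nf2 c' d') \<phi> \<psi>"
    by (rule K_equivalent_ideal_maps[OF K[unfolded normal_form_def] holo0_nf(1,2) holo0_nf(1,2)])
  then interpret ideal_map "nf1 a b" "nf2 c d" "nf1 a' b'" "nf2 c' d'" \<phi> \<psi> .
  obtain t :: "nat \<Rightarrow> complex" where t: "t \<longlonglongrightarrow> 0"
      "\<And>n. t n \<noteq> 0" by (rule null_sequence) (rule that)
  have ap: "approaches t (\<lambda>n. t n *s v) v" for v
    unfolding approaches_def using t by (simp add: vector_smult_assoc)
  have o: "(\<lambda>n. nf1 a' b' (t n *s v)) \<in> O(\<lambda>n. t n ^ 2)"
      "(\<lambda>n. nf2 c' d' (t n *s v)) \<in> O(\<lambda>n. t n ^ 2)" for v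
    using order_two_map[OF _ ap[of v]] nf_order_two[OF _ ge] by blast+
  have lim: "(\<lambda>n. f n / t n) \<longlonglongrightarrow> 0"
      if "f \<in> O(\<lambda>n. t n ^ 2)" for f
  proof -
    have "(\<lambda>n. t n ^ 2) \<in> o(t)"
      by (rule smalloI_tendsto) (use t in \<open>simp_all add: power2_eq_square\<close>)
    with that have "f \<in> o(t)" by (rule landau_o.big_small_trans)
    then show ?thesis by (rule smalloD_tendsto)
  qed
  have no: "k \<ge> 2" if "\<And>n. f n = s * ((t n) ^ k + r)" "s \<noteq> 0"
      "f \<in> O(\<lambda>n. t n ^ 2)" "r = 0 \<or> r = 1"
    for f :: "nat \<Rightarrow> complex" and s r k
  proof (rule ccontr)
    assume "\<not> 2 \<le> k"
    then have k: "k = 0 \<or> k = 1" by auto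
    have "f \<longlonglongrightarrow> 0"
      using tendsto_mult[OF lim[OF that(3)] t(1)] t(2) by simp
    moreover have "f \<longlonglongrightarrow> s * (0 ^ k + r)"
      unfolding that(1)[abs_def] by (intro tendsto_intros t)
    ultimately have "s * (0 ^ k + r) = 0" by (rule LIMSEQ_unique[symmetric])
    then have "k = 1" "r = 0" using k that(2,4) by auto
    then have "(\<lambda>n. f n / t n) = (\<lambda>n. s)" using that(1) t(2) by auto
    then show False using lim[OF that(3)] that(2) by (simp add: LIMSEQ_const_iff)
  qed
  \<comment> \<open>\<open>0 ^ b'\<close> is 1 for \<open>b' = 0\<close>; this constant from an
    exponent 0 is why \<open>no\<close> allows \<open>r = 1\<close>.\<close>
  have zp: "(0::complex) ^ m = 0 \<or> (0::complex) ^ m = 1" for m :: nat by (cases m) auto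
  have n1: "nf1 a' b' (t n *s axis 3 1) = - 1 * (t n ^ a' + 0 ^ b')"
    "nf1 a' b' (t n *s axis 4 1) = - 1 * (t n ^ b' + 0 ^ a')"
    "nf2 c' d' (t n *s axis 1 1) = 1 * (t n ^ c' + 0 ^ d')"
    "nf2 c' d' (t n *s axis 2 1) = 1 * (t n ^ d' + 0 ^ c')" for n
    by (simp_all add: on_C4_def axis_def)
  show "a' \<ge> 2" by (rule no[OF n1(1) _ o(1) zp]) simp
  show "b' \<ge> 2" by (rule no[OF n1(2) _ o(1) zp]) simp
  show "c' \<ge> 2" by (rule no[OF n1(3) _ o(2) zp]) simp
  show "d' \<ge> 2" by (rule no[OF n1(4) _ o(2) zp]) simp
qed

section \<open>Recovering two unordered pairs from a partial matching of indices\<close>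

definition opp :: "4 \<Rightarrow> 4" where
  "opp i = (if i = 1 then 2 else if i = 2 then 1 else if i = 3 then 4 else 3)"

definition opair :: "(4 \<Rightarrow> nat) \<Rightarrow> 4 \<Rightarrow> nat multiset" where
  "opair E i = {#E i, E (opp i)#}"

lemma opp_simps [simp]: "opp 1 = 2" "opp 2 = 1" "opp 3 = 4" "opp 4 = 3"
  by (simp_all add: opp_def)

lemma opp_opp [simp]: "opp (opp i) = i" and opp_neq [simp]: "opp i \<noteq> i" "i \<noteq> opp i"
  using exhaust_4[of i] by auto

lemma two_pairs_opair:
  assumes "k \<noteq> i" "k \<noteq> opp i"
  shows "two_pairs (E 3) (E 4) (E 1) (E 2) = {#opair E i, opair E k#}"
  using assms exhaust_4[of i] exhaust_4[of k]
  by (auto simp: two_pairs_def opair_def add_mset_commute)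

lemma opair_match:
  fixes E E' :: "4 \<Rightarrow> nat"
  assumes ge: "\<And>i. E i \<ge> 2" "\<And>i. E' i \<ge> 2"
    and \<sigma>: "\<And>i. E i \<ge> 3 \<Longrightarrow> E' (\<sigma> i) = E i"
    and surj: "\<And>j. E' j \<ge> 3 \<Longrightarrow> \<exists>i. E i \<ge> 3 \<and> \<sigma> i =
        j"
    and opp: "\<And>i j. E i \<ge> 3 \<Longrightarrow> E j \<ge> 3 \<Longrightarrow>
        i \<noteq> j \<Longrightarrow> j = opp i \<longleftrightarrow> \<sigma> j = opp
        (\<sigma> i)"
    and i: "E i \<ge> 3"
  shows "opair E i = opair E' (\<sigma> i)"
proof -
  have "E (opp i) = E' (opp (\<sigma> i))"
  proof (cases "E (opp i) \<ge> 3")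
    case True
    then have "\<sigma> (opp i) = opp (\<sigma> i)" using opp[OF i True] by simp
    then show ?thesis using \<sigma>[OF True] by simp
  next
    case False
    have "\<not> E' (opp (\<sigma> i)) \<ge> 3"
    proof
      assume "E' (opp (\<sigma> i)) \<ge> 3"
      then obtain k where k: "E k \<ge> 3" "\<sigma> k = opp (\<sigma> i)" using surj by blast
      then have "k \<noteq> i" by auto
      with opp[OF i k(1)] k have "k = opp i" by auto
      with False k show False by simp
    qed
    with False show ?thesis using ge(1)[of "opp i"] ge(2)[of "opp (\<sigma> i)"] by linarith
  qed
  then show ?thesis using \<sigma>[OF i] by (simp add: opair_def)
qed

text \<open>\<open>\<sigma>\<close> is controlled only where the exponent is at least 3. Since it
  hits all such indices of \<open>E'\<close> and respects partners, every index left over has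
  exponent 2 on both sides, and any pairing of the rest agrees.\<close>

lemma two_pairs_match:
  fixes E E' :: "4 \<Rightarrow> nat"
  assumes ge: "\<And>i. E i \<ge> 2" "\<And>i. E' i \<ge> 2"
    and \<sigma>: "\<And>i. E i \<ge> 3 \<Longrightarrow> E' (\<sigma> i) = E i"
    and inj: "\<And>i j. E i \<ge> 3 \<Longrightarrow> E j \<ge> 3 \<Longrightarrow> \<sigma> i =
        \<sigma> j \<Longrightarrow> i = j"
    and surj: "\<And>j. E' j \<ge> 3 \<Longrightarrow> \<exists>i. E i \<ge> 3 \<and> \<sigma> i =
        j"
    and opp: "\<And>i j. E i \<ge> 3 \<Longrightarrow> E j \<ge> 3 \<Longrightarrow>
        i \<noteq> j \<Longrightarrow> j = opp i \<longleftrightarrow> \<sigma> j = opp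
        (\<sigma> i)"
  shows "two_pairs (E 3) (E 4) (E 1) (E 2) = two_pairs (E' 3) (E' 4) (E' 1) (E' 2)"
proof (cases "\<exists>i. E i \<ge> 3")
  case False
  then have "E i = 2" for i using ge(1)[of i]
      by (metis Suc_leI le_neq_implies_less eval_nat_numeral(3) numeral_2_eq_2)
  moreover have "E' i = 2" for i
    using False surj[of i] ge(2)[of i] by (metis Suc_leI le_neq_implies_less eval_nat_numeral(3)
        numeral_2_eq_2)
  ultimately show ?thesis by simp
next
  case True
  then obtain i where i: "E i \<ge> 3" by blast
  have match: "opair E i = opair E' (\<sigma> i)" if "E i \<ge> 3" for i
    using that by (intro opair_match[of E E' \<sigma> i] ge \<sigma> surj opp)
  have other: "\<exists>k :: 4. k \<noteq> i \<and> k \<noteq> opp i" for i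
    using exhaust_4[of i] by (intro exI[of _ "if i = 1 \<or> i = 2 then 3 else 1"]) auto
  show ?thesis
  proof (cases "\<exists>k. E k \<ge> 3 \<and> k \<noteq> i \<and> k \<noteq> opp i")
    case True
    then obtain k where k: "E k \<ge> 3" "k \<noteq> i" "k \<noteq> opp i" by blast
    then have "\<sigma> k \<noteq> \<sigma> i" "\<sigma> k \<noteq> opp (\<sigma> i)"
        using inj[OF k(1) i] opp[OF i k(1)] by auto
    then show ?thesis
      using two_pairs_opair[OF k(2,3), of E] two_pairs_opair[of "\<sigma> k" "\<sigma> i" E']
          match[OF i] match[OF k(1)] by simp
  next
    case False
    obtain k where k: "k \<noteq> i" "k \<noteq> opp i" using other by blast
    obtain l where l: "l \<noteq> \<sigma> i" "l \<noteq> opp (\<sigma> i)" using other by blast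
    have k2: "opp k \<noteq> i" "opp k \<noteq> opp i" using k by (metis opp_opp)+
    have l2: "opp l \<noteq> \<sigma> i" "opp l \<noteq> opp (\<sigma> i)" using l
        by (metis opp_opp)+
    have Ek: "E j = 2" if "j \<noteq> i" "j \<noteq> opp i" for j
      using False that ge(1)[of j] by (metis Suc_leI le_neq_implies_less eval_nat_numeral(3)
          numeral_2_eq_2)
    have El: "E' j = 2" if j: "j \<noteq> \<sigma> i" "j \<noteq> opp (\<sigma> i)" for j
    proof (rule ccontr)
      assume "E' j \<noteq> 2"
      then have "E' j \<ge> 3" using ge(2)[of j] by linarith
      then obtain m where m: "E m \<ge> 3" "\<sigma> m = j" using surj by blast
      then have "m \<noteq> i" using j by auto
      then have "m \<noteq> opp i" using opp[OF i m(1)] m j by auto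
      with \<open>m \<noteq> i\<close> m False show False by blast
    qed
    have "opair E k = opair E' l" using Ek[OF k] Ek[OF k2] El[OF l] El[OF l2]
        by (simp add: opair_def)
    then show ?thesis
      using two_pairs_opair[OF k, of E] two_pairs_opair[OF l, of E'] match[OF i] by simp
  qed
qed

theorem normal_form_unique:
  assumes K: "K_equivalent (normal_form a b c d) (normal_form a' b' c' d')"
    and ge: "a \<ge> 2" "b \<ge> 2" "c \<ge> 2" "d \<ge> 2"
  shows "two_pairs a b c d = two_pairs a' b' c' d'"
proof -
  have ge': "a' \<ge> 2" "b' \<ge> 2" "c' \<ge> 2" "d' \<ge> 2"
      by (rule normal_form_exponents_ge_2[OF K ge])+
  obtain \<phi> \<psi> where \<phi>: "ideal_map (nf1 a b) (nf2 c d) (nf1 a' b') (nf2 c' d') \<phi>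
      \<psi>"
    and \<psi>: "ideal_map (nf1 a' b') (nf2 c' d') (nf1 a b) (nf2 c d) \<psi> \<phi>"
    by (rule K_equivalent_ideal_maps[OF K[unfolded normal_form_def] holo0_nf(1,2) holo0_nf(1,2)])
  define E E' where "E = expn a b c d" and "E' = expn a' b' c' d'"
  have E2: "E i \<ge> 2" "E' i \<ge> 2" for i using ge ge' by (auto simp: E_def E'_def expn_def)
  define \<phi>' \<psi>' where "\<phi>' = dmap \<phi>" and "\<psi>' = dmap \<psi>"
  have inv: "\<psi>' (\<phi>' v) = v" "\<phi>' (\<psi>' v) = v" for v
    unfolding \<phi>'_def \<psi>'_def
        by (rule dmap_inverse[OF \<phi>], rule dmap_inverse[OF \<psi>])
  have lin: "\<phi>' (u + v) = \<phi>' u + \<phi>' v" "\<phi>' (s *s v) = s *s \<phi>' v"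
      "\<psi>' (s *s v) = s *s \<psi>' v" for u v s
    by (simp_all add: \<phi>'_def \<psi>'_def dmap_linear)
  have zero: "\<phi>' 0 = 0" "\<psi>' 0 = 0" using lin(2,3)[of 0] by simp_all
  have ax: "\<exists>j s. s \<noteq> 0 \<and> v = s *s axis j 1 \<and> N \<le> expn a b c d j"
    if sd: "singular_dir (nf1 a b) (nf2 c d) N v" and nz: "v \<noteq> 0" and N: "N \<ge> 3"
      and g: "a \<ge> 2" "b \<ge> 2" "c \<ge> 2" "d \<ge> 2" for a b c d N v
  proof -
    obtain j where j: "\<And>k. k \<noteq> j \<Longrightarrow> v $ k = 0" "N \<le> expn a b c d j"
      using singular_dir_imp_axis[OF g N nz sd] by blast
    have "v = v $ j *s axis j 1" using j(1) by (auto simp: vec_eq_iff axis_def)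
    moreover have "v $ j \<noteq> 0" using j(1) nz by (metis vec_eq_iff zero_index)
    ultimately show ?thesis using j(2) by blast
  qed
  have sd: "singular_dir (nf1 a b) (nf2 c d) (expn a b c d i) (axis i 1)"
    if "a \<ge> 2" "b \<ge> 2" "c \<ge> 2" "d \<ge> 2" for a b c d i
    by (rule singular_dir_axis[OF that]) (auto simp: axis_def)
  have ax1: "(axis i 1 :: complex^4) \<noteq> 0" for i by (simp add: axis_eq_0_iff)
  have "\<exists>j s. s \<noteq> 0 \<and> \<phi>' (axis i 1) = s *s axis j 1 \<and> E i \<le> E' j"
      if i: "E i \<ge> 3" for i
    unfolding E'_def
  proof (rule ax[OF _ _ i ge'])
    show "singular_dir (nf1 a' b') (nf2 c' d') (E i) (\<phi>' (axis i 1))"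
      unfolding \<phi>'_def E_def by (rule ideal_map.singular_dir_map[OF \<phi> sd[OF ge]])
    show "\<phi>' (axis i 1) \<noteq> 0" using inv(1)[of "axis i 1"] zero ax1 by metis
  qed
  then obtain \<sigma> s where \<sigma>: "\<And>i. E i \<ge> 3 \<Longrightarrow>
      s i \<noteq> 0 \<and> \<phi>' (axis i 1) = s i *s axis (\<sigma> i) 1 \<and> E i \<le> E'
      (\<sigma> i)"
    by metis
  have "\<exists>j s. s \<noteq> 0 \<and> \<psi>' (axis i 1) = s *s axis j 1 \<and> E' i \<le> E j"
      if i: "E' i \<ge> 3" for i
    unfolding E_def
  proof (rule ax[OF _ _ i ge])
    show "singular_dir (nf1 a b) (nf2 c d) (E' i) (\<psi>' (axis i 1))"
      unfolding \<psi>'_def E'_def by (rule ideal_map.singular_dir_map[OF \<psi> sd[OF ge']])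
    show "\<psi>' (axis i 1) \<noteq> 0" using inv(2)[of "axis i 1"] zero ax1 by metis
  qed
  then obtain \<tau> r where \<tau>: "\<And>i. E' i \<ge> 3 \<Longrightarrow> r i \<noteq> 0 \<and>
      \<psi>' (axis i 1) = r i *s axis (\<tau> i) 1 \<and> E' i \<le> E (\<tau> i)"
    by metis
  have axeq: "i = j" if "axis i 1 = s *s (axis j 1 :: complex^4)" for i j s
    using arg_cong[OF that, of "\<lambda>v. v $ i"] by (auto simp: axis_def split: if_splits)
  have \<tau>\<sigma>: "\<tau> (\<sigma> i) = i" if i: "E i \<ge> 3" for i
  proof -
    have i': "E' (\<sigma> i) \<ge> 3" using \<sigma>[OF i] i by linarith
    have "axis i 1 = \<psi>' (s i *s axis (\<sigma> i) 1)"
        using \<sigma>[OF i] inv(1)[of "axis i 1"] by simp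
    also have "\<dots> = (s i * r (\<sigma> i)) *s axis (\<tau> (\<sigma> i)) 1"
      using \<tau>[OF i'] by (simp add: lin vector_smult_assoc)
    finally show ?thesis using axeq by metis
  qed
  have \<sigma>\<tau>: "\<sigma> (\<tau> j) = j" if j: "E' j \<ge> 3" for j
  proof -
    have j': "E (\<tau> j) \<ge> 3" using \<tau>[OF j] j by linarith
    have "axis j 1 = \<phi>' (r j *s axis (\<tau> j) 1)" using \<tau>[OF j] inv(2)[of "axis j 1"]
        by simp
    also have "\<dots> = (r j * s (\<tau> j)) *s axis (\<sigma> (\<tau> j)) 1"
      using \<sigma>[OF j'] by (simp add: lin vector_smult_assoc)
    finally show ?thesis using axeq by metis
  qed
  have E\<sigma>: "E' (\<sigma> i) = E i" if i: "E i \<ge> 3" for i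
  proof -
    have "E' (\<sigma> i) \<ge> 3" using \<sigma>[OF i] i by linarith
    then show ?thesis using \<tau>[of "\<sigma> i"] \<tau>\<sigma>[OF i] \<sigma>[OF i] by simp
  qed
  \<comment> \<open>With exponents at least 3 the squares of the two nonzero coordinates do not
    occur, so only \<open>x*y\<close> or \<open>z*w\<close> can obstruct, and this happens exactly
    for partner indices.\<close>
  have tan: "tangent_dir (nf1 a b) (nf2 c d) (s *s axis i 1 + r *s axis j 1) \<longleftrightarrow>
      j \<noteq> opp i"
    if "expn a b c d i \<ge> 3" "expn a b c d j \<ge> 3" "i \<noteq> j" "s \<noteq> 0"
        "r \<noteq> 0" "a \<ge> 2" "b \<ge> 2" "c \<ge> 2" "d \<ge> 2"
    for a b c d i j s r
    unfolding nf_tangent_dir[OF that(6-9)]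
    using that(1-5) exhaust_4[of i] exhaust_4[of j] by (elim disjE) (simp_all add: axis_def sq_def)
  have "two_pairs (E 3) (E 4) (E 1) (E 2) = two_pairs (E' 3) (E' 4) (E' 1) (E' 2)"
  proof (rule two_pairs_match[of E E' \<sigma>])
    show "E i \<ge> 2" "E' i \<ge> 2" for i by (fact E2)+
    show "E' (\<sigma> i) = E i" if "E i \<ge> 3" for i by (rule E\<sigma>[OF that])
    show "i = j" if "E i \<ge> 3" "E j \<ge> 3" "\<sigma> i = \<sigma> j" for i j
        using \<tau>\<sigma> that by metis
    show "\<exists>i. E i \<ge> 3 \<and> \<sigma> i = j" if "E' j \<ge> 3" for j
      using \<sigma>\<tau>[OF that] \<tau>[OF that] that by (intro exI[of _ "\<tau> j"]) linarith
    fix i j assume ij: "E i \<ge> 3" "E j \<ge> 3" "i \<noteq> j"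
    have ne: "\<sigma> i \<noteq> \<sigma> j" using \<tau>\<sigma> ij by metis
    have v: "\<phi>' (axis i 1 + axis j 1) = s i *s axis (\<sigma> i) 1 +
        s j *s axis (\<sigma> j) 1"
      using \<sigma>[OF ij(1)] \<sigma>[OF ij(2)] by (simp add: lin)
    have "tangent_dir (nf1 a b) (nf2 c d) (axis i 1 + axis j 1) \<longleftrightarrow>
        tangent_dir (nf1 a' b') (nf2 c' d') (\<phi>' (axis i 1 + axis j 1))"
      using ideal_map.tangent_dir_map[OF \<phi>, of "axis i 1 + axis j 1"]
        ideal_map.tangent_dir_map[OF \<psi>, of "\<phi>' (axis i 1 + axis j 1)"] inv(1)
      by (auto simp: \<phi>'_def \<psi>'_def)
    moreover have "tangent_dir (nf1 a b) (nf2 c d) (axis i 1 + axis j 1) \<longleftrightarrow>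
        j \<noteq> opp i"
      using tan[OF _ _ ij(3) _ _ ge, of 1 1] ij by (simp add: E_def)
    moreover have "tangent_dir (nf1 a' b') (nf2 c' d') (\<phi>' (axis i 1 + axis j 1))
        \<longleftrightarrow> \<sigma> j \<noteq> opp (\<sigma> i)"
      unfolding v using E\<sigma>[OF ij(1)] E\<sigma>[OF ij(2)] ij \<sigma>
      by (intro tan[OF _ _ ne _ _ ge']) (auto simp: E'_def)
    ultimately show "j = opp i \<longleftrightarrow> \<sigma> j = opp (\<sigma> i)" by blast
  qed
  then show ?thesis by (simp add: E_def E'_def)
qed

theorem gabrielov_numbersI:
  assumes K: "K_equivalent (X'_eqs X) (normal_form a b c d)"
    and ge: "a \<ge> 2" "b \<ge> 2" "c \<ge> 2" "d \<ge> 2"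
  shows "gabrielov_numbers X = two_pairs a b c d"
  unfolding gabrielov_numbers_def
proof (rule the_equality)
  show "\<exists>a' b' c' d'. two_pairs a b c d = two_pairs a' b' c' d' \<and>
      K_equivalent (X'_eqs X) (normal_form a' b' c' d')"
    using K by blast
next
  fix M
  assume "\<exists>a' b' c' d'. M = two_pairs a' b' c' d' \<and>
      K_equivalent (X'_eqs X) (normal_form a' b' c' d')"
  then obtain a' b' c' d' where M: "M = two_pairs a' b' c' d'"
      "K_equivalent (X'_eqs X) (normal_form a' b' c' d')"
    by blast
  have "K_equivalent (normal_form a b c d) (normal_form a' b' c' d')"
    by (rule K_equivalent_trans[OF K_equivalent_sym[OF K] M(2)])
  then show "M = two_pairs a b c d" using normal_form_unique[OF _ ge] M(1) by simp
qed

section \<open>Orbits and isotropy groups\<close>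

definition orb :: "nat^4 \<Rightarrow> complex^4 \<Rightarrow> (complex^4) set" where
  "orb wt p = orbit Cstar (act wt) p"

definition stab :: "nat^4 \<Rightarrow> complex^4 \<Rightarrow> complex set" where
  "stab wt p = {c. c \<noteq> 0 \<and> (\<forall>i. p $ i \<noteq> 0 \<longrightarrow>
      c ^ (wt $ i) = 1)}"

lemma act_nth [simp]: "act wt c p $ i = c ^ (wt $ i) * p $ i"
  by (simp add: act_def)

lemma stabilizer_eq_stab: "stabilizer Cstar (act wt) p = stab wt p"
  by (auto simp: stabilizer_def Cstar_def stab_def vec_eq_iff)

lemma mem_orb: "r \<in> orb wt p \<longleftrightarrow> (\<exists>c. c \<noteq> 0 \<and> r =
    act wt c p)"
  by (auto simp: orb_def orbit_def Cstar_def)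

lemma orb_refl: "p \<in> orb wt p"
  unfolding mem_orb by (rule exI[of _ 1]) (simp add: vec_eq_iff)

lemma act_act: "act wt c (act wt d p) = act wt (c * d) p"
  by (simp add: vec_eq_iff power_mult_distrib)

lemma orb_eq:
  assumes "r \<in> orb wt p"
  shows "orb wt r = orb wt p"
proof -
  obtain c where c: "c \<noteq> 0" "r = act wt c p" using assms by (auto simp: mem_orb)
  have "s \<in> orb wt p" if "s \<in> orb wt r" for s
    using that c unfolding mem_orb by (metis act_act mult_eq_0_iff)
  moreover have "s \<in> orb wt r" if s: "s \<in> orb wt p" for s
  proof -
    obtain d where d: "d \<noteq> 0" "s = act wt d p" using s by (auto simp: mem_orb)
    then have "s = act wt (d / c) r" using c by (simp add: act_act)
    then show ?thesis using c d unfolding mem_orb by (intro exI[of _ "d / c"]) simp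
  qed
  ultimately show ?thesis by blast
qed

lemma isotropy_orb: "isotropy wt (orb wt p) = stab wt p"
proof -
  have "stab wt r = stab wt p" if "r \<in> orb wt p" for r
    using that by (auto simp: mem_orb stab_def)
  then have "(\<Inter>r\<in>orb wt p. stab wt r) = (\<Inter>r\<in>orb wt p. stab wt p)"
      by (rule INF_cong[OF refl])
  also have "\<dots> = stab wt p" by (rule INF_const) (use orb_refl in blast)
  finally show ?thesis unfolding isotropy_def stabilizer_eq_stab .
qed

lemma exceptional_orbits_eq:
  "exceptional_orbits wt V = {orb wt p | p. p \<in> V \<and> p \<noteq> 0 \<and>
      stab wt p \<noteq> {1}}"
proof -
  have "exceptional_orbits wt V = {Orb. (\<exists>p. Orb = orb wt p \<and> p \<in> V - {0}) \<and>
      isotropy wt Orb \<noteq> {1}}"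
    by (auto simp: exceptional_orbits_def orbits_def orb_def)
  then show ?thesis by (auto simp: isotropy_orb)
qed

lemma stab_cyclic:
  assumes "p $ i \<noteq> 0" "wt $ i = m" "m > 0" "\<And>j. p $ j \<noteq> 0 \<Longrightarrow>
      m dvd wt $ j"
  shows "stab wt p = {c. c ^ m = 1}"
proof -
  have "c ^ (wt $ j) = 1" if "c ^ m = 1" "p $ j \<noteq> 0" for c :: complex and j
    using assms(4)[OF that(2)] that(1) by (auto simp: power_mult elim!: dvdE)
  moreover have "c \<noteq> 0" if "c ^ m = 1" for c :: complex
    using that assms(3) by (auto simp: power_0_left)
  ultimately show ?thesis using assms(1,2) by (auto simp: stab_def)
qed

lemma card_stab_cyclic:
  assumes "p $ i \<noteq> 0" "wt $ i = m" "m > 0" "\<And>j. p $ j \<noteq> 0 \<Longrightarrow>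
      m dvd wt $ j"
  shows "card (stab wt p) = m"
  using stab_cyclic[OF assms] card_roots_unity_eq[OF assms(3)] by simp

lemma isotropy_orders_two:
  assumes "principal_orbits wt f g = {orb wt p, orb wt q}" "orb wt p \<noteq> orb wt q"
    and "card (stab wt p) = m" "card (stab wt q) = n"
  shows "isotropy_orders wt f g = {#m, n#}"
  using assms by (simp add: isotropy_orders_def isotropy_orb)

lemma power_coprime_eq_1:
  fixes c :: complex
  assumes "c ^ m = 1" "c ^ n = 1" "coprime m n" "m > 0"
  shows "c = 1"
proof -
  obtain x y where xy: "m * x = n * y + 1"
    using coprime_bezout_strong[of m n] assms(3,4)
        by (metis One_nat_def bezout_nat coprime_imp_gcd_eq_1 less_numeral_extra(3))
  have "1 = c ^ (m * x)" using assms(1) by (simp add: power_mult)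
  also have "\<dots> = c" unfolding xy using assms(2) by (simp add: power_add power_mult)
  finally show ?thesis by simp
qed

lemma complex_root_exists:
  fixes z :: complex
  assumes "z \<noteq> 0" "n > 0"
  obtains c where "c \<noteq> 0" "c ^ n = z"
proof
  show "exp (Ln z / of_nat n) ^ n = z" using assms by (simp flip: exp_of_nat_mult)
qed simp

text \<open>The set \<open>B\<close> contains the exceptional orbits that are not principal: it is \<open>L\<close> in case (A),
  \<open>U\<close> in case (B), and the singular orbit in case (C).\<close>

definition two_exceptional :: "nat^4 \<Rightarrow> (complex^4) set \<Rightarrow> complex^4
    \<Rightarrow> complex^4 \<Rightarrow> (complex^4) set \<Rightarrow> bool" where
  "two_exceptional wt V p q B \<longleftrightarrow> p \<in> V - B \<and> q \<in> V - B \<and>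
      p \<noteq> 0 \<and> q \<noteq> 0 \<and>
     stab wt p \<noteq> {1} \<and> stab wt q \<noteq> {1} \<and>
     (\<forall>r\<in>V. r \<noteq> 0 \<longrightarrow> stab wt r \<noteq> {1} \<longrightarrow> r
         \<in> orb wt p \<or> r \<in> orb wt q \<or> r \<in> B)"

lemma two_exceptional_orbits:
  assumes "two_exceptional wt V p q B" and B: "\<And>r. r \<in> B \<Longrightarrow>
      orb wt r \<subseteq> B"
  shows "{Orb \<in> exceptional_orbits wt V. \<not> Orb \<subseteq> B} = {orb wt p, orb wt q}"
proof -
  have "\<not> orb wt p \<subseteq> B" "\<not> orb wt q \<subseteq> B"
    using assms(1) orb_refl unfolding two_exceptional_def by blast+
  moreover have "Orb = orb wt p \<or> Orb = orb wt q"
    if "Orb \<in> exceptional_orbits wt V" and nb: "\<not> Orb \<subseteq> B" for Orb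
  proof -
    obtain r where r: "Orb = orb wt r" "r \<in> V" "r \<noteq> 0" "stab wt r \<noteq> {1}"
      using \<open>Orb \<in> _\<close> by (auto simp: exceptional_orbits_eq)
    have "r \<notin> B" using nb B r(1) by blast
    then show ?thesis using assms(1) r orb_eq unfolding two_exceptional_def by blast
  qed
  moreover have "orb wt p \<in> exceptional_orbits wt V" "orb wt q \<in> exceptional_orbits wt V"
    using assms(1) unfolding two_exceptional_def exceptional_orbits_eq by blast+
  ultimately show ?thesis by blast
qed

lemma orb_zeros: "r \<in> orb wt p \<Longrightarrow> r $ i = 0 \<longleftrightarrow> p $ i = 0"
  by (auto simp: mem_orb)

lemma principal_orbits_A:
  assumes A: "\<And>L. case_A (zero_set f g) L \<longleftrightarrow> L = {p. p $ i = 0 \<and>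
      p $ j = 0}"
    and 2: "two_exceptional wt (zero_set f g) p q {p. p $ i = 0 \<and> p $ j = 0}"
  shows "principal_orbits wt f g = {orb wt p, orb wt q}"
proof -
  have "principal_orbits wt f g =
      {Orb \<in> exceptional_orbits wt (zero_set f g). \<not> Orb \<subseteq> {p. p $ i = 0 \<and> p
          $ j = 0}}"
    by (simp add: principal_orbits_def Let_def A)
  also have "\<dots> = {orb wt p, orb wt q}"
    by (rule two_exceptional_orbits[OF 2]) (auto simp: orb_zeros)
  finally show ?thesis .
qed

text \<open>\<open>U\<close> does not depend on the factorization: \<open>eval3 g1\<close> takes the
  values of \<open>f\<close>, so every admissible \<open>U\<close> is the zero set of
  \<open>f\<close> in \<open>z = 0\<close>.\<close>

lemma principal_orbits_B:
  assumes A: "\<And>L. \<not> case_A (zero_set f g) L"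
    and g1: "\<And>x y z w. f x y z w = eval3 g1 x y w" and g2: "\<And>x y z w. g x y z w =
        z * eval3 g2 x y z"
    and f: "\<And>r c. on_C4 f r = 0 \<Longrightarrow> on_C4 f (act wt c r) = 0"
    and 2: "two_exceptional wt (zero_set f g) p q {p. on_C4 f p = 0 \<and> p $ 3 = 0}"
  shows "principal_orbits wt f g = {orb wt p, orb wt q}"
proof -
  have nA: "\<not> (\<exists>L. case_A (zero_set f g) L)" using A by blast
  have B: "case_B f g U \<longleftrightarrow> U = {p. on_C4 f p = 0 \<and> p $ 3 = 0}" for U
  proof
    assume "case_B f g U"
    then obtain h1 h2 where "\<And>x y z w. f x y z w = eval3 h1 x y w"
      "U = {p. eval3 h1 (p$1) (p$2) (p$4) = 0 \<and> p$3 = 0}"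
      unfolding case_B_def by blast
    then show "U = {p. on_C4 f p = 0 \<and> p $ 3 = 0}" by (simp add: on_C4_def)
  next
    assume "U = {p. on_C4 f p = 0 \<and> p $ 3 = 0}"
    then show "case_B f g U"
      unfolding case_B_def using g1 g2 by (intro exI[of _ g1] exI[of _ g2]) (simp add: on_C4_def)
  qed
  have "principal_orbits wt f g =
      {Orb \<in> exceptional_orbits wt (zero_set f g). \<not> Orb \<subseteq> {p. on_C4 f p = 0
          \<and> p $ 3 = 0}}"
    unfolding principal_orbits_def Let_def if_not_P[OF nA] by (simp add: B)
  also have "\<dots> = {orb wt p, orb wt q}"
    by (rule two_exceptional_orbits[OF 2]) (auto simp: mem_orb f)
  finally show ?thesis .
qed

text \<open>Hypothesis \<open>B\<close> rules out case (B), where \<open>g\<close> would vanish on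
  \<open>z = 0\<close>. Removing one orbit by inequality agrees with removing those contained in it,
  because distinct orbits are disjoint.\<close>

lemma principal_orbits_C:
  assumes A: "\<And>L. \<not> case_A (zero_set f g) L" and B: "g x0 y0 0 w0 \<noteq> 0"
    and s: "s \<noteq> 0" "singular_locus f g - {0} = orb wt s"
    and 2: "two_exceptional wt (zero_set f g) p q (orb wt s)"
  shows "principal_orbits wt f g = {orb wt p, orb wt q}"
proof -
  have nB: "\<not> case_B f g U" for U
    using B unfolding case_B_def by (metis mult_zero_left)
  then have nB': "\<not> (\<exists>U. case_B f g U)" by blast
  have nA: "\<not> (\<exists>L. case_A (zero_set f g) L)" using A by blast
  have eq: "Orb \<noteq> orb wt s \<longleftrightarrow> \<not> Orb \<subseteq> orb wt s"
      if "Orb \<in> exceptional_orbits wt V" for Orb V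
  proof
    assume "Orb \<noteq> orb wt s"
    then show "\<not> Orb \<subseteq> orb wt s"
      using that orb_eq orb_refl unfolding exceptional_orbits_eq by blast
  qed auto
  have "principal_orbits wt f g = {Orb \<in> exceptional_orbits wt (zero_set f g). Orb \<noteq> orb
      wt s}"
    unfolding principal_orbits_def Let_def if_not_P[OF nA] if_not_P[OF nB'] s(2) ..
  also have "\<dots> = {Orb \<in> exceptional_orbits wt (zero_set f g). \<not> Orb \<subseteq> orb
      wt s}"
    using eq by blast
  also have "\<dots> = {orb wt p, orb wt q}"
    by (rule two_exceptional_orbits[OF 2]) (simp add: orb_eq)
  finally show ?thesis .
qed

text \<open>A single test point in each coordinate plane of codimension 2; a plane inside
  \<open>V\<close> must have its test point in \<open>V\<close>. Distinct primes as coordinates make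
  accidental zeros unlikely, as the later checks confirm.\<close>

definition plane_point :: "4 \<Rightarrow> 4 \<Rightarrow> complex^4" where
  "plane_point i j = (\<chi> k. if k = i \<or> k = j then 0 else (vector [2,3,5,7] :: complex^4) $
      k)"

lemma case_A_plane_point:
  assumes "case_A V L"
  shows "\<exists>i j. i \<noteq> j \<and> L = {p. p $ i = 0 \<and> p $ j = 0} \<and>
      plane_point i j \<in> V"
proof -
  obtain i j where ij: "i \<noteq> j" "L = {p. p $ i = 0 \<and> p $ j = 0}" and "L \<subseteq> V"
    using assms unfolding case_A_def by blast
  then have "plane_point i j \<in> V" by (auto simp: plane_point_def)
  with ij show ?thesis by blast
qed

lemma no_case_A:
  assumes "\<And>i j. i \<noteq> j \<Longrightarrow> plane_point i j \<notin> V"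
  shows "\<not> case_A V L"
  using assms case_A_plane_point by blast

lemma case_A_iff:
  assumes L0: "{p. p $ i0 = 0 \<and> p $ j0 = 0} \<subseteq> V" "i0 \<noteq> j0"
    and no: "\<And>i j. i \<noteq> j \<Longrightarrow> {i,j} \<noteq> {i0,j0} \<Longrightarrow>
        plane_point i j \<notin> V"
  shows "case_A V L \<longleftrightarrow> L = {p. p $ i0 = 0 \<and> p $ j0 = 0}"
proof
  assume "case_A V L"
  then obtain i j where ij: "i \<noteq> j" "L = {p. p $ i = 0 \<and> p $ j = 0}"
      "plane_point i j \<in> V"
    using case_A_plane_point by blast
  then have "{i,j} = {i0,j0}" using no[OF ij(1)] by blast
  then show "L = {p. p $ i0 = 0 \<and> p $ j0 = 0}" using ij(2) by (auto simp: doubleton_eq_iff)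
next
  assume "L = {p. p $ i0 = 0 \<and> p $ j0 = 0}"
  then show "case_A V L" using L0 unfolding case_A_def by blast
qed

section \<open>Singular loci\<close>

lemma rank_two_rows:
  fixes u v :: "complex^4"
  shows "rank (vector [u, v] :: complex^4^2) < 2 \<longleftrightarrow>
      (\<forall>i j. u $ i * v $ j = u $ j * v $ i)"
proof -
  have "rows (vector [u, v] :: complex^4^2) =
      range (\<lambda>i. (vector [u, v] :: complex^4^2) $ i)"
    by (auto simp: rows_def row_def vec_lambda_eta)
  then have rows: "rows (vector [u, v] :: complex^4^2) = {u, v}" by (simp add: UNIV_2)
  have r: "rank (vector [u, v] :: complex^4^2) = vec.dim {u, v}"
    by (simp add: row_rank_def_gen rows)
  show ?thesis
  proof
    assume l: "rank (vector [u, v] :: complex^4^2) < 2"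
    show "\<forall>i j. u $ i * v $ j = u $ j * v $ i"
    proof (rule ccontr)
      assume n: "\<not> (\<forall>i j. u $ i * v $ j = u $ j * v $ i)"
      have "v \<noteq> 0" using n by auto
      moreover have "u \<notin> vec.span {v}" using n by (auto simp: vec.span_singleton)
      ultimately have "vec.independent {u, v}" "u \<noteq> v"
        by (auto simp: vec.independent_insert vec.span_base)
      then have "vec.dim {u, v} = 2" by (simp add: vec.dim_eq_card_independent)
      with l r show False by simp
    qed
  next
    assume e: "\<forall>i j. u $ i * v $ j = u $ j * v $ i"
    have "\<exists>x. {u, v} \<subseteq> vec.span {x}"
    proof (cases "u = 0")
      case True
      then show ?thesis by (intro exI[of _ v]) (simp add: vec.span_base vec.span_zero)
    next
      case False
      then obtain i where i: "u $ i \<noteq> 0" by (auto simp: vec_eq_iff)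
      have "v = (v $ i / u $ i) *s u" using e i by (simp add: vec_eq_iff field_simps)
      then have "v \<in> vec.span {u}" by (metis vec.span_base vec.span_scale singletonI)
      then show ?thesis by (intro exI[of _ u]) (simp add: vec.span_base)
    qed
    then obtain x where "{u, v} \<subseteq> vec.span {x}" by blast
    then have "vec.dim {u, v} \<le> card {x}" by (rule vec.dim_le_card) simp
    then show "rank (vector [u, v] :: complex^4^2) < 2" using r by simp
  qed
qed

lemma gradient_nth:
  assumes "cdiff (on_C4 f) p"
  shows "gradient f p $ i = pd (on_C4 f) i p"
proof -
  obtain D where D: "(on_C4 f has_derivative D) (at p)" "\<And>c v. D (c *s v) = c * D v"
    using assms unfolding cdiff_def by blast
  define F where "F = (\<lambda>t. on_C4 f (\<chi> j. if j = i then t else p $ j))"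
  have F: "F t = on_C4 f (rz' p + t *s axis i 1)"
      if "rz' p = (\<chi> j. if j = i then 0 else p $ j)" for t rz'
    unfolding F_def that by (rule arg_cong[of _ _ "on_C4 f"]) (auto simp: vec_eq_iff axis_def)
  \<comment> \<open>\<open>gradient\<close> differentiates at parameter \<open>p $ i\<close> on the
    coordinate line starting at \<open>q\<close>, \<open>pd\<close> at parameter 0 on the line
    starting at \<open>p\<close>. Both give \<open>D (axis i 1)\<close>.\<close>
  define q where "q = (\<chi> j. if j = i then 0 else p $ j)"
  have qp: "q + (p $ i) *s axis i 1 = p" by (auto simp: q_def vec_eq_iff axis_def)
  have "((\<lambda>t. on_C4 f (q + t *s axis i 1)) has_field_derivative D (axis i 1)) (at (p $ i))"
    by (rule cdiff_line) (simp_all add: qp D)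
  moreover have "F = (\<lambda>t. on_C4 f (q + t *s axis i 1))"
    using F[of "\<lambda>_. q"] by (auto simp: q_def)
  ultimately have "deriv F (p $ i) = D (axis i 1)" by (simp add: DERIV_imp_deriv)
  then show ?thesis using pd_eqI[OF D] by (simp add: gradient_def F_def)
qed

lemma singular_locus_iff:
  assumes "\<And>p. cdiff (on_C4 f) p" "\<And>p. cdiff (on_C4 g) p"
  shows "p \<in> singular_locus f g \<longleftrightarrow> on_C4 f p = 0 \<and> on_C4 g p = 0 \<and>
    (\<forall>i j. minor (on_C4 f) (on_C4 g) i j p = 0)"
  by (simp add: singular_locus_def zero_set_def rank_two_rows gradient_nth assms minor_def)

lemma cdiff_minus: "cdiff f p \<Longrightarrow> cdiff (\<lambda>p. - f p) p"
  using cdiff_diff[OF cdiff_const[of 0], of f p] by simp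

lemma pd_minus: "cdiff f p \<Longrightarrow> pd (\<lambda>p. - f p) i p = - pd f i p"
  using pd_diff[OF cdiff_const[of 0], of f p i] by simp

lemmas cdiff_polynomial = cdiff_minus cdiff_diff cdiff_add cdiff_mult cdiff_power
lemmas pd_polynomial = pd_minus pd_diff pd_add pd_mult pd_power pd_nth

text \<open>Complex roots exist, so a punctured axis is one orbit. In case (C) it is the singular
  locus without the origin.\<close>

lemma orb_axis:
  assumes "wt $ k > 0"
  shows "orb wt (axis k 1) = {r. r $ k \<noteq> 0 \<and> (\<forall>j. j \<noteq> k \<longrightarrow>
      r $ j = 0)}"
proof -
  have "r \<in> orb wt (axis k 1)" if r: "r $ k \<noteq> 0"
      "\<forall>j. j \<noteq> k \<longrightarrow> r $ j = 0" for r
  proof -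
    obtain c where "c \<noteq> 0" "c ^ (wt $ k) = r $ k"
        by (rule complex_root_exists[OF r(1) assms])
    then show ?thesis using r(2) by (auto simp: mem_orb vec_eq_iff axis_def intro!: exI[of _ c])
  qed
  moreover have "r $ k \<noteq> 0 \<and> (\<forall>j. j \<noteq> k \<longrightarrow> r $ j = 0)"
      if "r \<in> orb wt (axis k 1)" for r
    using orb_zeros[OF that] by (auto simp: axis_def)
  ultimately show ?thesis by blast
qed

lemma stab_nontrivial:
  assumes "p $ i \<noteq> 0" "wt $ i = m" "m > 1" "\<And>j. p $ j \<noteq> 0 \<Longrightarrow>
      m dvd wt $ j"
  shows "stab wt p \<noteq> {1}"
  using card_stab_cyclic[OF assms(1,2) _ assms(4)] assms(3) by auto

text \<open>Two nonzero coordinates would make \<open>c\<close> a root of unity of two coprime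
  orders, hence 1.\<close>

lemma stab_coprime:
  assumes "stab wt r \<noteq> {1}" "coprime (wt $ i) (wt $ j)" "wt $ i > 0"
  shows "r $ i = 0 \<or> r $ j = 0"
proof (rule ccontr)
  assume n: "\<not> (r $ i = 0 \<or> r $ j = 0)"
  have "c = 1" if "c \<in> stab wt r" for c
    by (rule power_coprime_eq_1[OF _ _ assms(2,3)]) (use that n in \<open>auto simp:
        stab_def\<close>)
  moreover have "1 \<in> stab wt r" by (simp add: stab_def)
  ultimately show False using assms(1) by blast
qed

lemma mem_orbI:
  assumes "r $ i \<noteq> 0" "wt $ i = m" "m > 0" "\<And>j. wt $ j = k j * m \<or> p $ j = 0"
      "\<And>j. r $ j = p $ j * (r $ i) ^ k j"
  shows "r \<in> orb wt p"
proof -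
  obtain c where c: "c \<noteq> 0" "c ^ m = r $ i" by (rule complex_root_exists[OF assms(1,3)])
  have "r $ j = c ^ (wt $ j) * p $ j" for j
    using assms(4)[of j]
  proof
    assume "wt $ j = k j * m"
    then have "c ^ (wt $ j) = (r $ i) ^ k j" by (simp add: mult.commute power_mult c(2))
    then show ?thesis using assms(5)[of j] by simp
  qed (use assms(5)[of j] in simp)
  then show ?thesis using c(1) by (auto simp: mem_orb vec_eq_iff intro!: exI[of _ c])
qed

lemma vec4_cases:
  obtains x y z w where "r = (vector [x, y, z, w] :: complex^4)"
proof
  show "r = vector [r $ 1, r $ 2, r $ 3, r $ 4]" by (simp add: vec_eq_iff forall_4)
qed

text \<open>\<open>k\<close> lists the quotients of the weights by \<open>m\<close> at the nonzero
  coordinates of \<open>p\<close>; its other entries are free. Then the isotropy group consists of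
  the \<open>m\<close>-th roots of unity.\<close>

definition cyclic_at :: "nat^4 \<Rightarrow> complex^4 \<Rightarrow> 4 \<Rightarrow> nat
    \<Rightarrow> nat^4 \<Rightarrow> bool" where
  "cyclic_at wt p i m k \<longleftrightarrow> p $ i \<noteq> 0 \<and> wt $ i = m \<and> m > 1 \<and>
      (\<forall>j. p $ j \<noteq> 0 \<longrightarrow> wt $ j = k $ j * m)"

text \<open>If the \<open>i\<close>-th coordinate of \<open>p\<close> is 1 and \<open>cyclic_at wt p i m k\<close>, then \<open>c\<close> multiplies \<open>p $ j\<close>
  by \<open>(c ^ m) ^ (k $ j)\<close>, and \<open>c ^ m\<close> is the \<open>i\<close>-th coordinate of the result.\<close>

definition multiple_at :: "complex^4 \<Rightarrow> 4 \<Rightarrow> nat^4 \<Rightarrow> complex^4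
    \<Rightarrow> bool" where
  "multiple_at p i k r \<longleftrightarrow> r $ i \<noteq> 0 \<and> (\<forall>j. r $ j =
      p $ j * (r $ i) ^ (k $ j))"

lemma cyclic_atD:
  assumes "cyclic_at wt p i m k"
  shows "card (stab wt p) = m" "stab wt p \<noteq> {1}" "p \<noteq> 0"
proof -
  have c: "p $ i \<noteq> 0" "wt $ i = m" "m > 1"
      and k: "\<forall>j. p $ j \<noteq> 0 \<longrightarrow> wt $ j = k $ j * m"
    using assms unfolding cyclic_at_def by blast+
  have d: "m dvd wt $ j" if "p $ j \<noteq> 0" for j
    using k[rule_format, OF that] by (rule ssubst) (rule dvd_triv_right)
  show "card (stab wt p) = m" by (rule card_stab_cyclic[OF c(1,2) _ d]) (use c(3) in simp)
  show "stab wt p \<noteq> {1}" by (rule stab_nontrivial[OF c d])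
  show "p \<noteq> 0" using c(1) by auto
qed

lemma multiple_at_orb:
  assumes "cyclic_at wt p i m k" "multiple_at p i k r"
  shows "r \<in> orb wt p"
proof (rule mem_orbI)
  show "r $ i \<noteq> 0" using assms(2) unfolding multiple_at_def by blast
  show "wt $ i = m" "m > 0" using assms(1) unfolding cyclic_at_def by (blast, linarith)
  show "wt $ j = k $ j * m \<or> p $ j = 0" for j
    using assms(1) unfolding cyclic_at_def by blast
  show "r $ j = p $ j * (r $ i) ^ (k $ j)" for j using assms(2) unfolding multiple_at_def by blast
qed

lemma isotropy_orders_principal:
  assumes "principal_orbits wt f g = {orb wt p, orb wt q}" "(p $ l = 0) \<noteq> (q $ l = 0)"
    and "cyclic_at wt p i m ki" "cyclic_at wt q j n kj"
  shows "isotropy_orders wt f g = {#m, n#}"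
proof (rule isotropy_orders_two[OF assms(1)])
  show "orb wt p \<noteq> orb wt q" using assms(2) orb_zeros orb_refl by metis
qed (use assms(3,4) cyclic_atD in auto)

text \<open>All six index pairs are listed, each conditional on coprimality, so that concrete
  weights reduce this to a few alternatives \<open>r $ a = 0 \<or> r $ b = 0\<close>.\<close>

abbreviation coprime_zero :: "nat^4 \<Rightarrow> complex^4 \<Rightarrow> bool" where
  "coprime_zero wt r \<equiv> list_all (\<lambda>(a, b). coprime (wt $ a) (wt $ b) \<longrightarrow>
      wt $ a > 0 \<longrightarrow> r $ a = 0 \<or> r $ b = 0)
     [(1,2), (1,3), (1,4), (2,3), (2,4), (3,4)]"

text \<open>Leaves a polynomial classification \<open>cl\<close>: a nonzero solution of the
  equations obeying the coprimality alternatives is a multiple of \<open>p\<close>, a multiple of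
  \<open>q\<close>, or lies in \<open>B\<close>.\<close>

lemma two_exceptionalI:
  assumes cl: "\<And>x y z w. f x y z w = 0 \<Longrightarrow> g x y z w = 0 \<Longrightarrow>
      coprime_zero wt (vector [x,y,z,w]) \<Longrightarrow>
      vector [x,y,z,w] \<noteq> (0 :: complex^4) \<Longrightarrow>
      multiple_at p i ki (vector [x,y,z,w]) \<or> multiple_at q j kj (vector [x,y,z,w]) \<or> vector
          [x,y,z,w] \<in> B"
    and "p \<in> zero_set f g" "q \<in> zero_set f g" "p \<notin> B" "q \<notin> B"
    and cyc: "cyclic_at wt p i m ki" "cyclic_at wt q j n kj"
  shows "two_exceptional wt (zero_set f g) p q B"
proof -
  have "r \<in> orb wt p \<or> r \<in> orb wt q \<or> r \<in> B"
    if r: "r \<in> zero_set f g" "r \<noteq> 0" "stab wt r \<noteq> {1}" for r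
  proof -
    obtain x y z w where rr: "r = vector [x,y,z,w]" by (rule vec4_cases)
    have "coprime_zero wt r" using stab_coprime[OF r(3)] by (simp only: list.pred_inject prod.case)
        blast
    moreover have "f x y z w = 0" "g x y z w = 0" using r(1)
        by (simp_all add: rr zero_set_def on_C4_def)
    ultimately show ?thesis
      using cl[of x y z w] multiple_at_orb[OF cyc(1)] multiple_at_orb[OF cyc(2)] r(2)
      unfolding rr by blast
  qed
  then show ?thesis
    unfolding two_exceptional_def
    using assms(2-5) cyclic_atD[OF cyc(1)] cyclic_atD[OF cyc(2)] by blast
qed

lemma isotropy_orders_A:
  assumes cl: "\<And>x y z w. f x y z w = 0 \<Longrightarrow> g x y z w = 0 \<Longrightarrow>
      coprime_zero wt (vector [x,y,z,w]) \<Longrightarrow>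
      multiple_at p i ki (vector [x,y,z,w]) \<or> multiple_at q j kj (vector [x,y,z,w]) \<or>
      vector [x,y,z,w] \<in> {p. p $ a = 0 \<and> p $ b = 0}"
    and L: "{p. p $ a = 0 \<and> p $ b = 0} \<subseteq> zero_set f g" "a \<noteq> b"
    and no: "\<forall>i j. i \<noteq> j \<longrightarrow> {i,j} \<noteq> {a,b} \<longrightarrow>
        plane_point i j \<notin> zero_set f g"
    and pq: "p \<in> zero_set f g" "q \<in> zero_set f g"
      "p \<notin> {p. p $ a = 0 \<and> p $ b = 0}" "q \<notin> {p. p $ a = 0 \<and> p $ b = 0}"
    and cyc: "cyclic_at wt p i m ki" "cyclic_at wt q j n kj" "(p $ l = 0) \<noteq> (q $ l = 0)"
  shows "isotropy_orders wt f g = {#m, n#}"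
proof (rule isotropy_orders_principal[OF _ cyc(3,1,2)])
  show "principal_orbits wt f g = {orb wt p, orb wt q}"
  proof (rule principal_orbits_A)
    show "case_A (zero_set f g) L \<longleftrightarrow> L = {p. p $ a = 0 \<and> p $ b = 0}" for L
      by (rule case_A_iff[OF L]) (use no in blast)
    show "two_exceptional wt (zero_set f g) p q {p. p $ a = 0 \<and> p $ b = 0}"
      by (rule two_exceptionalI[OF cl pq cyc(1,2)])
  qed
qed

lemma isotropy_orders_B:
  assumes cl: "\<And>x y z w. f x y z w = 0 \<Longrightarrow> g x y z w = 0 \<Longrightarrow>
      coprime_zero wt (vector [x,y,z,w]) \<Longrightarrow>
      multiple_at p i ki (vector [x,y,z,w]) \<or> multiple_at q j kj (vector [x,y,z,w]) \<or> z = 0"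
    and f: "\<And>r c. on_C4 f r = 0 \<Longrightarrow> on_C4 f (act wt c r) = 0"
    and no: "\<forall>i j. i \<noteq> j \<longrightarrow> plane_point i j \<notin> zero_set f g"
    and g1: "\<And>x y z w. f x y z w = eval3 g1 x y w" and g2: "\<And>x y z w. g x y z w =
        z * eval3 g2 x y z"
    and pq: "p \<in> zero_set f g" "q \<in> zero_set f g" "p $ 3 \<noteq> 0" "q $ 3 \<noteq> 0"
    and cyc: "cyclic_at wt p i m ki" "cyclic_at wt q j n kj" "(p $ l = 0) \<noteq> (q $ l = 0)"
  shows "isotropy_orders wt f g = {#m, n#}"
proof (rule isotropy_orders_principal[OF _ cyc(3,1,2)])
  have nA: "\<not> case_A (zero_set f g) L" for L by (rule no_case_A) (use no in blast)
  have "two_exceptional wt (zero_set f g) p q {p. on_C4 f p = 0 \<and> p $ 3 = 0}"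
  proof (rule two_exceptionalI[OF _ pq(1,2) _ _ cyc(1,2)])
    fix x y z w
    assume r: "f x y z w = 0" "g x y z w = 0" "coprime_zero wt (vector [x,y,z,w])"
    show "multiple_at p i ki (vector [x,y,z,w]) \<or> multiple_at q j kj (vector [x,y,z,w]) \<or>
        vector [x,y,z,w] \<in> {p. on_C4 f p = 0 \<and> p $ 3 = 0}"
      using cl[OF r] r(1) by (auto simp: on_C4_def)
  qed (use pq(3,4) in simp_all)
  then show "principal_orbits wt f g = {orb wt p, orb wt q}"
    by (intro principal_orbits_B[OF nA g1 g2 f])
qed

text \<open>The singular locus is the \<open>k\<close>-th coordinate axis in every use.
  \<open>F\<close> and \<open>G\<close> are the gradients in explicit form, which makes
  \<open>sing\<close> and \<open>axis\<close> polynomial statements.\<close>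

lemma isotropy_orders_C:
  assumes cl: "\<And>x y z w. f x y z w = 0 \<Longrightarrow> g x y z w = 0 \<Longrightarrow>
      coprime_zero wt (vector [x,y,z,w]) \<Longrightarrow>
      multiple_at p i ki (vector [x,y,z,w]) \<or> multiple_at q j kj (vector [x,y,z,w]) \<or>
      (\<forall>j. j \<noteq> k \<longrightarrow> (vector [x,y,z,w] :: complex^4) $ j = 0)"
    and sing: "\<And>x y z w. f x y z w = 0 \<Longrightarrow> g x y z w = 0 \<Longrightarrow>
        (\<And>i j. F x y z w $ i * G x y z w $ j = F x y z w $ j * G x y z w $ i) \<Longrightarrow>
        \<forall>j. j \<noteq> k \<longrightarrow> (vector [x,y,z,w] :: complex^4) $ j = 0"
    and axis: "\<And>x y z w. \<forall>j. j \<noteq> k \<longrightarrow>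
        (vector [x,y,z,w] :: complex^4) $ j = 0 \<Longrightarrow>
        f x y z w = 0 \<and> g x y z w = 0 \<and>
        (\<forall>i j. F x y z w $ i * G x y z w $ j = F x y z w $ j * G x y z w $ i)"
    and F: "\<And>x y z w. \<forall>i. pd (on_C4 f) i (vector [x,y,z,w]) = F x y z w $ i"
    and G: "\<And>x y z w. \<forall>i. pd (on_C4 g) i (vector [x,y,z,w]) = G x y z w $ i"
    and d: "\<And>p. cdiff (on_C4 f) p" "\<And>p. cdiff (on_C4 g) p"
    and no: "\<forall>i j. i \<noteq> j \<longrightarrow> plane_point i j \<notin> zero_set f g"
        and B: "g x0 y0 0 w0 \<noteq> 0"
    and k: "wt $ k > 0"
    and pq: "p \<in> zero_set f g" "q \<in> zero_set f g"
      "p \<notin> {r. \<forall>j. j \<noteq> k \<longrightarrow> r $ j = 0}"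
          "q \<notin> {r. \<forall>j. j \<noteq> k \<longrightarrow> r $ j = 0}"
    and cyc: "cyclic_at wt p i m ki" "cyclic_at wt q j n kj" "(p $ l = 0) \<noteq> (q $ l = 0)"
  shows "isotropy_orders wt f g = {#m, n#}"
proof (rule isotropy_orders_principal[OF _ cyc(3,1,2)])
  have nz: "r \<noteq> 0 \<longleftrightarrow> r $ k \<noteq> 0"
      if "\<forall>j. j \<noteq> k \<longrightarrow> r $ j = 0" for r :: "complex^4"
    using that by (auto simp: vec_eq_iff)
  have "r \<in> singular_locus f g - {0} \<longleftrightarrow> r \<in> orb wt (axis k 1)" for r
  proof -
    obtain x y z w where r: "r = vector [x,y,z,w]" by (rule vec4_cases)
    have "r \<in> singular_locus f g \<longleftrightarrow>
        (\<forall>j. j \<noteq> k \<longrightarrow> r $ j = 0)"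
      unfolding r singular_locus_iff[OF d] minor_def F[rule_format] G[rule_format] right_minus_eq
      using sing[of x y z w] axis[of x y z w] by (simp add: on_C4_def) blast
    with nz[of r] show ?thesis unfolding orb_axis[OF k] by blast
  qed
  then have s: "singular_locus f g - {0} = orb wt (axis k 1)" by blast
  have 2: "two_exceptional wt (zero_set f g) p q (orb wt (axis k 1))"
  proof (rule two_exceptionalI[OF _ pq(1,2) _ _ cyc(1,2)])
    fix x y z w
    let ?r = "vector [x,y,z,w] :: complex^4"
    assume r: "f x y z w = 0" "g x y z w = 0" "coprime_zero wt ?r" "?r \<noteq> 0"
    show "multiple_at p i ki ?r \<or> multiple_at q j kj ?r \<or> ?r \<in> orb wt (axis k 1)"
      using cl[OF r(1-3)] nz[of ?r] r(4) unfolding orb_axis[OF k] by blast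
  qed (use pq(3,4) in \<open>auto simp: orb_axis[OF k]\<close>)
  have nA: "\<not> case_A (zero_set f g) L" for L by (rule no_case_A) (use no in blast)
  have "axis k (1::complex) \<noteq> 0" by (simp add: axis_eq_0_iff)
  then show "principal_orbits wt f g = {orb wt p, orb wt q}"
    by (rule principal_orbits_C[where f=f and g=g, OF nA B _ s 2])
qed

lemma coprime_small: "coprime 2 (3::nat)" "coprime 3 (2::nat)" "coprime 4 (3::nat)"
    "coprime 2 (5::nat)"
  "coprime 6 (5::nat)" "coprime 5 (4::nat)" "coprime 5 (3::nat)"
  by code_simp+

lemmas orders_simps = multiple_at_def cyclic_at_def forall_4 zero_set_def on_C4_def plane_point_def

section \<open>Principal orbits of the sixteen weighted homogeneous parts\<close>

lemma isotropy_orders_J2_1: "isotropy_orders (weights1 J2') (h1 J2') (h21 J2') = {#2, 2#}"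
proof (rule isotropy_orders_C[where p="vector [1,0,0,0]" and i=1 and ki="vector [1,0,0,0]"
      and q="vector [1,0,1,0]" and j=1 and kj="vector [1,0,2,0]" and l=3 and k=2 and ?x0.0=1
          and ?y0.0=0 and ?w0.0=1
      and F="\<lambda>x y z w. vector [y, x, 0, -2*w]" and G="\<lambda>x y z w. vector [-2*x*z +
          w^2, 0, -(x^2) + 2*z, 2*x*w]"],
    goal_cases)
  \<comment> \<open>The weight 3 is coprime to 2 and 4, so \<open>w = 0\<close> or only
    \<open>w\<close> is nonzero; the latter contradicts \<open>x*y = w^2\<close>. For
    \<open>w = 0\<close> the equations are \<open>x*y = 0\<close> and
    \<open>z * (z - x^2) = 0\<close>, which leaves the two given orbits and the
    \<open>y\<close>-axis.\<close>
  case (1 x y z w)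
  then show ?case by (simp add: orders_simps coprime_small) algebra
next
  case (2 x y z w)
  have "x = 0" using 2(1,2) 2(3)[of 1 2] 2(3)[of 2 3] 2(3)[of 2 4] by auto
  with 2(1,2) have "z = 0 \<and> w = 0" by simp
  with \<open>x = 0\<close> show ?case by (simp add: forall_4)
qed (simp_all add: orders_simps on_C4_def[abs_def] cdiff_polynomial pd_polynomial)

lemma isotropy_orders_J2_2: "isotropy_orders (weights2 J2') (h1 J2') (h22 J2') = {#6, 2#}"
proof (rule isotropy_orders_C[where p="vector [0,1,0,0]" and i=2 and ki="vector [0,1,0,0]"
      and q="vector [1,1,0,-1]" and j=1 and kj="vector [1,3,0,2]" and l=1 and k=1 and ?x0.0=0
          and ?y0.0=1 and ?w0.0=1
      and F="\<lambda>x y z w. vector [y, x, 0, -2*w]" and G="\<lambda>x y z w. vector [w^2, w, 2*z,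
          2*x*w + y]"],
    goal_cases)
  \<comment> \<open>The weight 5 is coprime to the others, and \<open>z\<close> alone cannot be
    nonzero, so \<open>z = 0\<close>. For \<open>w \<noteq> 0\<close> the equations give
    \<open>w = -(x^2)\<close> and \<open>y = x^3\<close>, the second witness; for
    \<open>w = 0\<close> the \<open>x\<close>- and \<open>y\<close>-axes remain.\<close>
  case (1 x y z w)
  then show ?case by (simp add: orders_simps coprime_small) algebra
next
  case (2 x y z w)
  have "z = 0" using 2(1,2) 2(3)[of 1 3] 2(3)[of 2 3] 2(3)[of 3 4] by auto
  then have "w = 0" using 2(1,2) 2(3)[of 1 2] by simp algebra
  with 2(1,2) 2(3)[of 1 4] \<open>z = 0\<close> have "y = 0" by simp
  with \<open>z = 0\<close> \<open>w = 0\<close> show ?case by (simp add: forall_4)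
qed (simp_all add: orders_simps on_C4_def[abs_def] cdiff_polynomial pd_polynomial)

lemma isotropy_orders_K1_1: "isotropy_orders (weights1 K1') (h1 K1') (h21 K1') = {#2, 2#}"
proof (rule isotropy_orders_C[where p="vector [1,0,0,0]" and i=1 and ki="vector [1,0,0,0]"
      and q="vector [1,1,0,1]" and j=1 and kj="vector [1,1,0,1]" and l=2 and k=2 and ?x0.0=1
          and ?y0.0=0 and ?w0.0=2
      and F="\<lambda>x y z w. vector [y, x, 0, -2*w]" and G="\<lambda>x y z w. vector [-2*x*w +
          w^2, 0, 2*z, -(x^2) + 2*x*w]"],
    goal_cases)
  case (1 x y z w)
  then show ?case by (simp add: orders_simps coprime_small) algebra
next
  case (2 x y z w)
  have "x = 0" using 2(1,2) 2(3)[of 1 2] 2(3)[of 2 4] by simp algebra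
  with 2(1,2) have "z = 0 \<and> w = 0" by simp
  with \<open>x = 0\<close> show ?case by (simp add: forall_4)
qed (simp_all add: orders_simps on_C4_def[abs_def] cdiff_polynomial pd_polynomial)

lemma isotropy_orders_K1_2: "isotropy_orders (weights2 K1') (h1 K1') (h22 K1') = {#4, 4#}"
proof (rule isotropy_orders_C[where p="vector [0,1,0,0]" and i=2 and ki="vector [0,1,0,0]"
      and q="vector [0,1,-1,0]" and j=2 and kj="vector [0,1,1,0]" and l=3 and k=1 and ?x0.0=1
          and ?y0.0=0 and ?w0.0=1
      and F="\<lambda>x y z w. vector [y, x, 0, -2*w]" and G="\<lambda>x y z w. vector [w^2, z,
          2*z + y, 2*x*w]"],
    goal_cases)
  case (1 x y z w)
  then show ?case by (simp add: orders_simps coprime_small) algebra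
next
  case (2 x y z w)
  have "z = 0 \<and> y = 0" using 2(1,2) 2(3)[of 1 2] 2(3)[of 1 3] 2(3)[of 2 3] 2(3)[of 3 4]
      by simp algebra
  with 2(1,2) show ?case by (simp add: forall_4)
qed (simp_all add: orders_simps on_C4_def[abs_def] cdiff_polynomial pd_polynomial)

text \<open>The \<open>z\<close>-axis is exceptional too, with isotropy order 3, but it is the
  singular locus and so not principal.\<close>

lemma isotropy_orders_K1_flat_1: "isotropy_orders (weights1 K1_flat) (h1 K1_flat) (h21 K1_flat) =
    {#2, 4#}"
proof (rule isotropy_orders_C[where p="vector [1,0,0,0]" and i=1 and ki="vector [1,0,0,0]"
      and q="vector [0,1,0,0]" and j=2 and kj="vector [0,1,0,0]" and l=1 and k=3 and ?x0.0=1
          and ?y0.0=0 and ?w0.0=1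
      and F="\<lambda>x y z w. vector [y, x, 0, -2*w]" and G="\<lambda>x y z w. vector [-2*x*w +
          2*x*z, z, x^2 + y, -(x^2)]"],
    goal_cases)
  case (1 x y z w)
  then show ?case by (simp add: orders_simps coprime_small) algebra
next
  case (2 x y z w)
  have "x = 0 \<and> y = 0" using 2(1,2) 2(3)[of 1 3] 2(3)[of 2 3] 2(3)[of 3 4] by simp algebra
  with 2(1,2) show ?case by (simp add: forall_4)
qed (simp_all add: orders_simps on_C4_def[abs_def] cdiff_polynomial pd_polynomial)

lemma isotropy_orders_L1_2: "isotropy_orders (weights2 L1) (h1 L1) (h22 L1) = {#5, 3#}"
proof (rule isotropy_orders_C[where p="vector [0,1,0,0]" and i=2 and ki="vector [0,1,0,0]"
      and q="vector [0,0,0,1]" and j=4 and kj="vector [0,0,0,1]" and l=2 and k=1 and ?x0.0=0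
          and ?y0.0=1 and ?w0.0=1
      and F="\<lambda>x y z w. vector [y, x, -w, -z]" and G="\<lambda>x y z w. vector [w^2, w, 2*z,
          2*x*w + y]"],
    goal_cases)
  case (1 x y z w)
  then show ?case by (simp add: orders_simps coprime_small) algebra
next
  case (2 x y z w)
  have "w = 0" using 2(1,2) 2(3)[of 1 2] 2(3)[of 2 3] 2(3)[of 3 4] by simp algebra
  moreover from this have "z = 0" using 2(1,2) 2(3)[of 3 4] by simp
  moreover from calculation have "y = 0" using 2(3)[of 1 4] by simp
  ultimately show ?case by (simp add: forall_4)
qed (simp_all add: orders_simps on_C4_def[abs_def] cdiff_polynomial pd_polynomial)

lemma isotropy_orders_M1_1: "isotropy_orders (weights1 M1) (h1 M1) (h21 M1) = {#3, 3#}"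
proof (rule isotropy_orders_C[where p="vector [1,0,0,0]" and i=1 and ki="vector [1,0,0,0]"
      and q="vector [1,1,0,-1]" and j=1 and kj="vector [1,1,0,1]" and l=2 and k=2 and ?x0.0=1
          and ?y0.0=0 and ?w0.0=1
      and F="\<lambda>x y z w. vector [y, x, 0, -2*w]" and G="\<lambda>x y z w. vector [w, 0, 3*z^2,
          x + 2*w]"],
    goal_cases)
  case (1 x y z w)
  then show ?case by (simp add: orders_simps coprime_small) algebra
next
  case (2 x y z w)
  have "x = 0" using 2(1,2) 2(3)[of 1 2] 2(3)[of 2 4] by simp algebra
  with 2(1,2) have "z = 0 \<and> w = 0" by simp
  with \<open>x = 0\<close> show ?case by (simp add: forall_4)
qed (simp_all add: orders_simps on_C4_def[abs_def] cdiff_polynomial pd_polynomial)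

lemma isotropy_orders_M1_2: "isotropy_orders (weights2 M1) (h1 M1) (h22 M1) = {#4, 2#}"
proof (rule isotropy_orders_C[where p="vector [0,1,0,0]" and i=2 and ki="vector [0,1,0,0]"
      and q="vector [0,1,1,0]" and j=3 and kj="vector [0,2,1,0]" and l=3 and k=1 and ?x0.0=0
          and ?y0.0=0 and ?w0.0=1
      and F="\<lambda>x y z w. vector [y, x, 0, -2*w]"
          and G="\<lambda>x y z w. vector [0, -z, 3*z^2 - y, 2*w]"],
    goal_cases)
  case (1 x y z w)
  then show ?case by (simp add: orders_simps coprime_small) algebra
next
  case (2 x y z w)
  have "y = 0" using 2(1,2) 2(3)[of 1 2] 2(3)[of 1 3] by auto
  with 2(1,2) have "z = 0 \<and> w = 0" by simp
  with \<open>y = 0\<close> show ?case by (simp add: forall_4)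
qed (simp_all add: orders_simps on_C4_def[abs_def] cdiff_polynomial pd_polynomial)

lemma isotropy_orders_I1_1: "isotropy_orders (weights1 I1) (h1 I1) (h21 I1) = {#3, 3#}"
proof (rule isotropy_orders_C[where p="vector [1,0,0,0]" and i=1 and ki="vector [1,0,0,0]"
      and q="vector [0,1,0,0]" and j=2 and kj="vector [0,1,0,0]" and l=1 and k=3 and ?x0.0=1
          and ?y0.0=0 and ?w0.0=1
      and F="\<lambda>x y z w. vector [y, x, 0, -3*w^2]" and G="\<lambda>x y z w. vector [-w + z, z,
          y + x, -x]"],
    goal_cases)
  case (1 x y z w)
  then show ?case by (simp add: orders_simps coprime_small) algebra
next
  case (2 x y z w)
  have "y = -x" using 2(1,2) 2(3)[of 1 3] 2(3)[of 2 3] by simp algebra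
  then have "x = 0 \<and> w = 0" using 2(1,2) by simp algebra
  with \<open>y = -x\<close> show ?case by (simp add: forall_4)
qed (simp_all add: orders_simps on_C4_def[abs_def] cdiff_polynomial pd_polynomial)

lemma isotropy_orders_L1_1: "isotropy_orders (weights1 L1) (h1 L1) (h21 L1) = {#2, 2#}"
proof (rule isotropy_orders_A[where p="vector [1,0,0,0]" and i=1 and ki="vector [1,0,0,0]"
      and q="vector [1,0,0,1]" and j=1 and kj="vector [1,0,0,1]" and l=4 and a=1 and b=3],
    goal_cases)
  case (1 x y z w)
  then show ?case by (simp add: orders_simps coprime_small) algebra
qed (simp_all add: orders_simps subset_eq doubleton_eq_iff)

text \<open>The \<open>y\<close>- and \<open>z\<close>-axes, with isotropy orders 4 and 3, lie in
  the plane \<open>x = w = 0\<close> and are excluded by case (A).\<close>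

lemma isotropy_orders_L1_sharp_1: "isotropy_orders (weights1 L1_sharp) (h1 L1_sharp) (h21 L1_sharp)
    = {#2, 3#}"
proof (rule isotropy_orders_A[where p="vector [1,0,0,0]" and i=1 and ki="vector [1,0,0,0]"
      and q="vector [0,0,0,1]" and j=4 and kj="vector [0,0,0,1]" and l=1 and a=1 and b=4],
    goal_cases)
  case (1 x y z w)
  then show ?case by (simp add: orders_simps coprime_small) algebra
qed (simp_all add: orders_simps subset_eq doubleton_eq_iff)

lemma isotropy_orders_L1_sharp_2: "isotropy_orders (weights2 L1_sharp) (h1 L1_sharp) (h22 L1_sharp)
    = {#2, 5#}"
proof (rule isotropy_orders_A[where p="vector [1,0,-1,0]" and i=1 and ki="vector [1,0,2,0]"
      and q="vector [0,1,0,0]" and j=2 and kj="vector [0,1,0,0]" and l=1 and a=2 and b=3],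
    goal_cases)
  case (1 x y z w)
  then show ?case by (simp add: orders_simps coprime_small) algebra
qed (simp_all add: orders_simps subset_eq doubleton_eq_iff)

lemma isotropy_orders_M1_sharp_1: "isotropy_orders (weights1 M1_sharp) (h1 M1_sharp) (h21 M1_sharp)
    = {#2, 3#}"
proof (rule isotropy_orders_A[where p="vector [1,0,0,0]" and i=1 and ki="vector [1,0,0,0]"
      and q="vector [0,1,1,0]" and j=2 and kj="vector [0,1,1,0]" and l=1 and a=1 and b=3],
    goal_cases)
  case (1 x y z w)
  then show ?case by (simp add: orders_simps coprime_small) algebra
qed (simp_all add: orders_simps subset_eq doubleton_eq_iff)

lemma isotropy_orders_M1_sharp_2: "isotropy_orders (weights2 M1_sharp) (h1 M1_sharp) (h22 M1_sharp)
    = {#4, 3#}"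
proof (rule isotropy_orders_A[where p="vector [0,1,0,0]" and i=2 and ki="vector [0,1,0,0]"
      and q="vector [0,0,0,1]" and j=4 and kj="vector [0,0,0,1]" and l=2 and a=2 and b=4],
    goal_cases)
  case (1 x y z w)
  then show ?case by (simp add: orders_simps coprime_small) algebra
qed (simp_all add: orders_simps subset_eq doubleton_eq_iff)

text \<open>The nested polynomials encode \<open>x*y - w^2\<close> in \<open>x\<close>,
  \<open>y\<close>, \<open>w\<close> and \<open>x^2 + y + z\<close> in \<open>x\<close>,
  \<open>y\<close>, \<open>z\<close>, the last variable outermost.\<close>

lemma isotropy_orders_K1_flat_2: "isotropy_orders (weights2 K1_flat) (h1 K1_flat) (h22 K1_flat) =
    {#4, 2#}"
proof (rule isotropy_orders_B[where p="vector [0,1,-1,0]" and i=2 and ki="vector [0,1,1,0]"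
      and q="vector [1,0,-1,0]" and j=1 and kj="vector [1,0,2,0]" and l=1
          and ?g1.0="[:[:0,[:0,1:]:],0,-1:]" and ?g2.0="[:[:[:0,0,1:],1:],1:]"],
    goal_cases)
  case (1 x y z w)
  then show ?case by (simp add: orders_simps coprime_small) algebra
next
  case (2 r c)
  then show ?case using weighted_homogeneous(3)[of K1_flat c r] by simp
qed (simp_all add: orders_simps eval3_def power2_eq_square power3_eq_cube algebra_simps)

lemma isotropy_orders_I1_2: "isotropy_orders (weights2 I1) (h1 I1) (h22 I1) = {#3, 3#}"
proof (rule isotropy_orders_B[where p="vector [0,1,-1,0]" and i=2 and ki="vector [0,1,1,0]"
      and q="vector [1,0,-1,0]" and j=1 and kj="vector [1,0,1,0]" and l=1
          and ?g1.0="[:[:0,[:0,1:]:],0,0,-1:]" and ?g2.0="[:[:[:0,1:],1:],1:]"],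
    goal_cases)
  case (1 x y z w)
  then show ?case by (simp add: orders_simps coprime_small) algebra
next
  case (2 r c)
  then show ?case using weighted_homogeneous(3)[of I1 c r] by simp
qed (simp_all add: orders_simps eval3_def power2_eq_square power3_eq_cube algebra_simps)

lemma dolgachev_numbers_eq:
  "dolgachev_numbers J2' = two_pairs 2 2 6 2"
  "dolgachev_numbers K1' = two_pairs 2 2 4 4"
  "dolgachev_numbers K1_flat = two_pairs 2 4 4 2"
  "dolgachev_numbers L1 = two_pairs 2 2 5 3"
  "dolgachev_numbers L1_sharp = two_pairs 2 3 2 5"
  "dolgachev_numbers M1 = two_pairs 3 3 4 2"
  "dolgachev_numbers M1_sharp = two_pairs 2 3 4 3"
  "dolgachev_numbers I1 = two_pairs 3 3 3 3"
  by (simp_all only: dolgachev_numbers_def two_pairs_def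
    isotropy_orders_J2_1 isotropy_orders_J2_2 isotropy_orders_K1_1 isotropy_orders_K1_2
    isotropy_orders_K1_flat_1 isotropy_orders_K1_flat_2 isotropy_orders_L1_1 isotropy_orders_L1_2
    isotropy_orders_L1_sharp_1 isotropy_orders_L1_sharp_2 isotropy_orders_M1_1 isotropy_orders_M1_2
    isotropy_orders_M1_sharp_1 isotropy_orders_M1_sharp_2 isotropy_orders_I1_1 isotropy_orders_I1_2)

lemma gabrielov_numbers_eq:
  "gabrielov_numbers J2' = two_pairs 2 2 6 2"
  "gabrielov_numbers K1' = two_pairs 2 2 4 4"
  "gabrielov_numbers K1_flat = two_pairs 2 2 5 3"
  "gabrielov_numbers L1 = two_pairs 2 4 4 2"
  "gabrielov_numbers L1_sharp = two_pairs 2 3 5 2"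
  "gabrielov_numbers M1 = two_pairs 3 3 2 4"
  "gabrielov_numbers M1_sharp = two_pairs 2 3 4 3"
  "gabrielov_numbers I1 = two_pairs 3 3 3 3"
  by (rule gabrielov_numbersI,
    rule K_equivalent_J2 K_equivalent_K1 K_equivalent_K1_flat K_equivalent_L1 K_equivalent_L1_sharp
      K_equivalent_M1 K_equivalent_M1_sharp K_equivalent_I1, simp_all)+

theorem theorem5:
  fixes X :: virtual_singularity
  shows "gabrielov_numbers X = dolgachev_numbers (dual X) \<and>
         dolgachev_numbers X = gabrielov_numbers (dual X)"
  by (cases X) (simp_all add: gabrielov_numbers_eq dolgachev_numbers_eq two_pairs_def add_mset_commute)

end
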